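(* Let $X\in\mathfrak{sl}_n(\mathbb H)$ be a nilpotent element, $X\neq 0$, whose orbit $\mathcal O_X$ has associated partition $\mathbf d=[d_1^{t_{d_1}},\dots,d_s^{t_{d_s}}]$ of $n$. Let $\{X,H,Y\}$ be an $\mathfrak{sl}_2(\mathbb R)$-triple in $\mathfrak{sl}_n(\mathbb H)$. Let $K$ be a maximal compact subgroup of $\mathcal Z_{\mathrm{SL}_n(\mathbb H)}(X,H,Y)$. Let $\mathcal B$ be the ordered basis of $\mathbb H^n$, and $\Lambda_{\mathcal B}$, $\mathbf D$ the maps, defined in the context. Then $\Lambda_{\mathcal B}(K)$ is given by $$\Lambda_{\mathcal B}(K)=\Big\{\mathbf D(g)\ \Big|\ g\in\prod_{i=1}^s \mathrm{Sp}(t_{d_i})\Big\}.$$ Moreover, the nilpotent orbit $\mathcal O_X$ in $\mathfrak{sl}_n(\mathbb H)$ is homotopic to (has the homotopy type of) $\mathrm{Sp}(n)/\Lambda_{\mathcal B}(K)$.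
   Context: Here $n$ is a positive integer and $\mathbb H$ denotes the real quaternions; $\mathrm{SL}_n(\mathbb H)$ is the group of $g\in\mathrm{GL}_n(\mathbb H)$ of reduced norm $1$, and $\mathfrak{sl}_n(\mathbb H)$ its Lie algebra (matrices of reduced trace $0$). $\mathrm{Sp}(m)=\{g\in\mathrm{GL}_m(\mathbb H):\bar g^{t}g=\mathrm I_m\}$ is the compact symplectic group. An $\mathfrak{sl}_2(\mathbb R)$-triple $\{X,H,Y\}$ satisfies $X\neq0$, $[H,X]=2X$, $[H,Y]=-2Y$, $[X,Y]=H$. $\mathcal Z_G(X,H,Y)$ is the subgroup of elements of $G$ fixing $X,H,Y$ under the adjoint action. $\mathcal O_X=\{\mathrm{Ad}(g)X: g\in\mathrm{SL}_n(\mathbb H)\}$. Let $V=\mathbb H^n$, the right $\mathbb H$-vector space of column vectors. For $d\ge1$ let $M(d-1)$ be the sum of all $\mathbb R$-subspaces of $V$ of real dimension $d$ that are irreducible $\mathrm{Span}_{\mathbb R}\{X,H,Y\}$-submodules, and $L(d-1)=M(d-1)\cap\ker Y$, which is an $\mathbb H$-subspace; put $t_d=\dim_{\mathbb H}L(d-1)$. Let $d_1<\dots<d_s$ be the integers $d$ with $t_d>0$. Then $\sum_i t_{d_i}d_i=n$, and $\mathbf d=[d_1^{t_{d_1}},\dots,d_s^{t_{d_s}}]$ is the partition associated to $\mathcal O_X$ (it depends only on $\mathcal O_X$). For each $d\in\{d_1,\dots,d_s\}$ an ordered $\mathbb H$-basis $(v^d_1,\dots,v^d_{t_d})$ of $L(d-1)$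 is fixed. Let $\mathcal B^l(d)=(X^lv^d_1,\dots,X^lv^d_{t_d})$, an ordered basis of $X^lL(d-1)$, for $0\le l\le d-1$; let $\mathcal B(d)$ be the concatenation of $\mathcal B^0(d),\dots,\mathcal B^{d-1}(d)$ in this order, and let $\mathcal B$ be the concatenation of $\mathcal B(d_1),\dots,\mathcal B(d_s)$; $\mathcal B$ is an ordered $\mathbb H$-basis of $V$. $\Lambda_{\mathcal B}:\mathrm{End}_{\mathbb H}(V)\to\mathrm M_n(\mathbb H)$ is the isomorphism of $\mathbb R$-algebras sending an endomorphism to its matrix with respect to $\mathcal B$. $\mathbf D:\prod_{i=1}^s\mathrm M_{t_{d_i}}(\mathbb H)\to\mathrm M_n(\mathbb H)$ sends $(A_{d_1},\dots,A_{d_s})$ to the block diagonal matrix $\bigoplus_{j=1}^s(A_{d_j}\oplus\cdots\oplus A_{d_j})$ with $A_{d_j}$ repeated $d_j$ times.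
   Formalization: The equality fails for unrelated K and bases (e.g. partition [2^2]); it and the homotopy claim are proved for a conjugate zKz^{-1}, z in the centralizer of the triple, with the given basis, and for K itself with suitably chosen bases of the L(d-1). *)

theory Defs
  imports
    "HOL-Analysis.Analysis"
    "HOL-Algebra.Left_Coset"
    "Jordan_Normal_Form.Matrix"
begin

text \<open>Matrices of the fixed size n are typed, with n = CARD('n); only the blocks, whose sizes depend
  on X, are \<open>mat\<close>s with explicit dimensions. The names and notation that \<open>Matrix\<close> shares with the
  typed vectors refer to the latter below.\<close>

hide_const (open) Matrix.mat Matrix.vec
hide_type (open) Matrix.vec
no_notation vec_index (infixl "$" 100)

datatype quat = Quat (q1: real) (qi: real) (qj: real) (qk: real)

lemma quat_eq_iff: "x = y \<longleftrightarrow> q1 x = q1 y \<and> qi x = qi y \<and> qj x = qj y \<and> qk x = qk y"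
  by (cases x; cases y) simp

instantiation quat :: ring_1
begin
definition "0 = Quat 0 0 0 0"
definition "1 = Quat 1 0 0 0"
definition "x + y = Quat (q1 x + q1 y) (qi x + qi y) (qj x + qj y) (qk x + qk y)"
definition "- x = Quat (- q1 x) (- qi x) (- qj x) (- qk x)"
definition "x - y = Quat (q1 x - q1 y) (qi x - qi y) (qj x - qj y) (qk x - qk y)"
definition "x * y = Quat
  (q1 x * q1 y - qi x * qi y - qj x * qj y - qk x * qk y)
  (q1 x * qi y + qi x * q1 y + qj x * qk y - qk x * qj y)
  (q1 x * qj y - qi x * qk y + qj x * q1 y + qk x * qi y)
  (q1 x * qk y + qi x * qj y - qj x * qi y + qk x * q1 y)"
instance
  by standard
    (simp_all add: quat_eq_iff zero_quat_def one_quat_def plus_quat_def uminus_quat_def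
       minus_quat_def times_quat_def algebra_simps)
end

instantiation quat :: real_inner
begin
definition "r *\<^sub>R x = Quat (r * q1 x) (r * qi x) (r * qj x) (r * qk x)"
definition "inner x y = q1 x * q1 y + qi x * qi y + qj x * qj y + qk x * qk y"
definition "norm x = sqrt (inner x (x::quat))"
definition "dist x y = norm (x - y :: quat)"
definition "sgn x = inverse (norm x) *\<^sub>R (x::quat)"
definition "uniformity = (INF e\<in>{0 <..}. principal {(x, y). dist x (y::quat) < e})"
definition "open (U :: quat set) \<longleftrightarrow>
  (\<forall>x\<in>U. eventually (\<lambda>(x', y). x' = x \<longrightarrow> y \<in> U) uniformity)"
instance
proof
  show "inner x x = 0 \<longleftrightarrow> x = 0" for x :: quat
  proof
    assume h: "inner x x = 0"
    have "q1 x * q1 x \<ge> 0" "qi x * qi x \<ge> 0" "qj x * qj x \<ge> 0" "qk x * qk x \<ge> 0" by simp_all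
    with h have "q1 x * q1 x = 0" "qi x * qi x = 0" "qj x * qj x = 0" "qk x * qk x = 0"
      unfolding inner_quat_def by linarith+
    then show "x = 0" by (simp add: quat_eq_iff zero_quat_def)
  qed (simp add: inner_quat_def zero_quat_def)
qed (simp_all add: quat_eq_iff zero_quat_def plus_quat_def minus_quat_def scaleR_quat_def
       inner_quat_def norm_quat_def dist_quat_def sgn_quat_def uniformity_quat_def open_quat_def
       algebra_simps)
end

instance quat :: real_algebra_1
  by standard (simp_all add: quat_eq_iff zero_quat_def one_quat_def times_quat_def scaleR_quat_def
    algebra_simps)

instance quat :: real_normed_algebra_1
proof
  show "norm (1::quat) = 1"
    by (simp add: norm_quat_def inner_quat_def one_quat_def)
  show "norm (x * y) \<le> norm x * norm y" for x y :: quat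
  proof -
    have "inner (x * y) (x * y) = inner x x * inner y y"
      by (simp add: inner_quat_def times_quat_def algebra_simps)
    then show ?thesis
      by (simp add: norm_quat_def real_sqrt_mult)
  qed
qed

instantiation quat :: euclidean_space
begin
definition "Basis = {Quat 1 0 0 0, Quat 0 1 0 0, Quat 0 0 1 0, Quat 0 0 0 1}"
instance
proof
  show "inner u v = (if u = v then 1 else 0)" if "u \<in> Basis" "v \<in> Basis" for u v :: quat
    using that unfolding Basis_quat_def by (elim insertE emptyE) (simp_all add: inner_quat_def)
  show "(\<forall>u\<in>Basis. inner x u = 0) \<longleftrightarrow> x = 0" for x :: quat
    unfolding Basis_quat_def by (simp add: inner_quat_def zero_quat_def quat.expand quat_eq_iff[of x])
qed (simp_all add: Basis_quat_def)
end

definition quat_cnj :: "quat \<Rightarrow> quat" where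
  "quat_cnj x = Quat (q1 x) (- qi x) (- qj x) (- qk x)"

instantiation quat :: division_ring
begin
definition "inverse x = inverse (inner x x) *\<^sub>R quat_cnj x"
definition "x div y = x * inverse (y::quat)"
instance
proof
  have "quat_cnj x * x = inner x x *\<^sub>R 1" "x * quat_cnj x = inner x x *\<^sub>R 1" for x :: quat
    by (simp_all add: quat_eq_iff scaleR_quat_def quat_cnj_def times_quat_def one_quat_def
        inner_quat_def)
  then show "inverse x * x = 1" "x * inverse x = 1" if "x \<noteq> 0" for x :: quat
    using that by (simp_all add: inverse_quat_def)
qed (simp_all add: divide_quat_def inverse_quat_def quat_eq_iff scaleR_quat_def zero_quat_def
        quat_cnj_def)
end

text \<open>Writing a quaternion as z + w j with z, w complex gives the embedding of the quaternions into
  the complex 2 by 2 matrices with rows (z, w) and (- cnj w, cnj z), and so of the n by n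
  quaternionic matrices into the complex 2n by 2n ones.\<close>

definition quat_z :: "quat \<Rightarrow> complex" where "quat_z x = Complex (q1 x) (qi x)"
definition quat_w :: "quat \<Rightarrow> complex" where "quat_w x = Complex (qj x) (qk x)"

definition complexify :: "quat^'n^'n \<Rightarrow> complex^('n + 'n)^('n + 'n)" where
  "complexify A = (\<chi> p q.
     case p of
       Inl i \<Rightarrow> (case q of Inl j \<Rightarrow> quat_z (A$i$j) | Inr j \<Rightarrow> quat_w (A$i$j))
     | Inr i \<Rightarrow> (case q of Inl j \<Rightarrow> - cnj (quat_w (A$i$j)) | Inr j \<Rightarrow> cnj (quat_z (A$i$j))))"

lemma complexify_mult:
  fixes A B :: "quat^'n^'n"
  shows "complexify (A ** B) = complexify A ** complexify B"
proof -
  have z: "quat_z (sum f S) = (\<Sum>x\<in>S. quat_z (f x))"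
    and w: "quat_w (sum f S) = (\<Sum>x\<in>S. quat_w (f x))" for f :: "'b \<Rightarrow> quat" and S
    by (induction S rule: infinite_finite_induct;
        simp add: quat_z_def quat_w_def plus_quat_def zero_quat_def complex_eq_iff)+
  have m: "quat_z (x * y) = quat_z x * quat_z y - quat_w x * cnj (quat_w y)"
    "quat_w (x * y) = quat_z x * quat_w y + quat_w x * cnj (quat_z y)" for x y
    by (simp_all add: quat_z_def quat_w_def times_quat_def complex_eq_iff algebra_simps)
  have s: "(\<Sum>x\<in>UNIV. f x) = (\<Sum>i\<in>UNIV. f (Inl i)) + (\<Sum>i\<in>UNIV. f (Inr i))"
    for f :: "'n + 'n \<Rightarrow> complex"
    unfolding UNIV_sum by (subst sum.union_disjoint) (auto simp: sum.reindex)
  show ?thesis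
    by (simp add: Finite_Cartesian_Product.vec_eq_iff complexify_def matrix_matrix_mult_def s z w m
        sum.distrib sum_subtractf sum_negf split: sum.split)
qed

definition reduced_norm :: "quat^'n^'n \<Rightarrow> complex" where
  "reduced_norm A = det (complexify A)"

definition reduced_trace :: "quat^'n^'n \<Rightarrow> complex" where
  "reduced_trace A = trace (complexify A)"

definition SLH :: "(quat^'n^'n) set" where
  "SLH = {g. invertible g \<and> reduced_norm g = 1}"

definition slH :: "(quat^'n^'n) set" where
  "slH = {A. reduced_trace A = 0}"

definition lie :: "quat^'n^'n \<Rightarrow> quat^'n^'n \<Rightarrow> quat^'n^'n" where
  "lie A B = A ** B - B ** A"

definition nilpotent_matrix :: "quat^'n^'n \<Rightarrow> bool" where
  "nilpotent_matrix A \<longleftrightarrow> (\<exists>k. (((**) A) ^^ k) (mat 1) = 0)"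

definition sl2_triple :: "quat^'n^'n \<Rightarrow> quat^'n^'n \<Rightarrow> quat^'n^'n \<Rightarrow> bool" where
  "sl2_triple X H Y \<longleftrightarrow> X \<in> slH \<and> H \<in> slH \<and> Y \<in> slH \<and> X \<noteq> 0 \<and>
     lie H X = 2 *\<^sub>R X \<and> lie H Y = (- 2) *\<^sub>R Y \<and> lie X Y = H"

definition Ad :: "quat^'n^'n \<Rightarrow> quat^'n^'n \<Rightarrow> quat^'n^'n" where
  "Ad g A = g ** A ** matrix_inv g"

definition centralizer :: "quat^'n^'n \<Rightarrow> quat^'n^'n \<Rightarrow> quat^'n^'n \<Rightarrow> (quat^'n^'n) set" where
  "centralizer X H Y = {g \<in> SLH. Ad g X = X \<and> Ad g H = H \<and> Ad g Y = Y}"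

definition orbit :: "quat^'n^'n \<Rightarrow> (quat^'n^'n) set" where
  "orbit X = (\<lambda>g. Ad g X) ` SLH"

definition matrix_group :: "(quat^'n^'n) set \<Rightarrow> (quat^'n^'n) monoid" where
  "matrix_group S = \<lparr>carrier = S, mult = (**), one = mat 1\<rparr>"

definition compact_subgroup :: "(quat^'n^'n) set \<Rightarrow> (quat^'n^'n) set \<Rightarrow> bool" where
  "compact_subgroup K G \<longleftrightarrow> subgroup K (matrix_group G) \<and> compact K"

definition maximal_compact_subgroup :: "(quat^'n^'n) set \<Rightarrow> (quat^'n^'n) set \<Rightarrow> bool" where
  "maximal_compact_subgroup K G \<longleftrightarrow>
     compact_subgroup K G \<and> (\<forall>K'. compact_subgroup K' G \<and> K \<subseteq> K' \<longrightarrow> K' = K)"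

definition Sp :: "nat \<Rightarrow> quat mat set" where
  "Sp m = {g \<in> carrier_mat m m. invertible_mat g \<and> transpose_mat (map_mat quat_cnj g) * g = 1\<^sub>m m}"

definition rscale :: "quat^'n \<Rightarrow> quat \<Rightarrow> quat^'n" where
  "rscale v q = (\<chi> i. v$i * q)"

definition hcomb :: "(quat^'n) list \<Rightarrow> (nat \<Rightarrow> quat) \<Rightarrow> quat^'n" where
  "hcomb vs c = (\<Sum>i<length vs. rscale (vs ! i) (c i))"

definition hbasis :: "(quat^'n) set \<Rightarrow> (quat^'n) list \<Rightarrow> bool" where
  "hbasis W vs \<longleftrightarrow>
     W = range (hcomb vs) \<and> (\<forall>c. hcomb vs c = 0 \<longrightarrow> (\<forall>i<length vs. c i = 0))"

definition hdim :: "(quat^'n) set \<Rightarrow> nat" where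
  "hdim W = (THE m. \<exists>vs. hbasis W vs \<and> length vs = m)"

definition sl2_submodule ::
  "quat^'n^'n \<Rightarrow> quat^'n^'n \<Rightarrow> quat^'n^'n \<Rightarrow> (quat^'n) set \<Rightarrow> bool" where
  "sl2_submodule X H Y W \<longleftrightarrow> subspace W \<and> (\<forall>A\<in>span {X, H, Y}. \<forall>w\<in>W. A *v w \<in> W)"

definition irreducible_submodule ::
  "quat^'n^'n \<Rightarrow> quat^'n^'n \<Rightarrow> quat^'n^'n \<Rightarrow> (quat^'n) set \<Rightarrow> bool" where
  "irreducible_submodule X H Y W \<longleftrightarrow> sl2_submodule X H Y W \<and> W \<noteq> {0} \<and>
     (\<forall>W'. sl2_submodule X H Y W' \<and> W' \<subseteq> W \<longrightarrow> W' = {0} \<or> W' = W)"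

text \<open>The argument d is the dimension of the irreducible submodules, so that \<open>isotypic X H Y d\<close> and
  \<open>lowest X H Y d\<close> are M(d-1) and L(d-1).\<close>

definition isotypic :: "quat^'n^'n \<Rightarrow> quat^'n^'n \<Rightarrow> quat^'n^'n \<Rightarrow> nat \<Rightarrow> (quat^'n) set" where
  "isotypic X H Y d = span (\<Union>{W. irreducible_submodule X H Y W \<and> dim W = d})"

definition lowest :: "quat^'n^'n \<Rightarrow> quat^'n^'n \<Rightarrow> quat^'n^'n \<Rightarrow> nat \<Rightarrow> (quat^'n) set" where
  "lowest X H Y d = isotypic X H Y d \<inter> {v. Y *v v = 0}"

definition part_mult :: "quat^'n^'n \<Rightarrow> quat^'n^'n \<Rightarrow> quat^'n^'n \<Rightarrow> nat \<Rightarrow> nat" where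
  "part_mult X H Y d = hdim (lowest X H Y d)"

text \<open>The list of the d_1 < ... < d_s; together with \<open>part_mult\<close> it is the partition associated to
  the orbit of X.\<close>

definition parts :: "quat^'n^'n \<Rightarrow> quat^'n^'n \<Rightarrow> quat^'n^'n \<Rightarrow> nat list" where
  "parts X H Y = sorted_list_of_set {d. 1 \<le> d \<and> 0 < part_mult X H Y d}"

definition ordered_bases ::
  "quat^'n^'n \<Rightarrow> quat^'n^'n \<Rightarrow> quat^'n^'n \<Rightarrow> (nat \<Rightarrow> (quat^'n) list) \<Rightarrow> bool" where
  "ordered_bases X H Y v \<longleftrightarrow> (\<forall>d\<in>set (parts X H Y). hbasis (lowest X H Y d) (v d))"

definition total_basis ::
  "quat^'n^'n \<Rightarrow> quat^'n^'n \<Rightarrow> quat^'n^'n \<Rightarrow> (nat \<Rightarrow> (quat^'n) list) \<Rightarrow> (quat^'n) list" where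
  "total_basis X H Y v =
     concat (map (\<lambda>d. concat (map (\<lambda>l. map (((*v) X) ^^ l) (v d)) [0..<d])) (parts X H Y))"

text \<open>The order of the index type identifies it with {0..<CARD('n)}.\<close>

definition index_pos :: "'n::{finite,linorder} \<Rightarrow> nat" where
  "index_pos i = card {j. j < i}"

definition typed_matrix :: "quat mat \<Rightarrow> quat^('n::{finite,linorder})^('n::{finite,linorder})" where
  "typed_matrix A = (\<chi> i j. A $$ (index_pos i, index_pos j))"

text \<open>The matrix of g with respect to B: its column j holds the coordinates of g (B ! j), which are
  multiplied from the right.\<close>

definition Lambda ::
  "(quat^('n::{finite,linorder})) list \<Rightarrow> quat^('n::{finite,linorder})^('n::{finite,linorder}) \<Rightarrow> quat^('n::{finite,linorder})^('n::{finite,linorder})" where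
  "Lambda B g = (THE A. \<forall>j. g *v (B ! index_pos j) =
     (\<Sum>i\<in>UNIV. rscale (B ! index_pos i) (A$i$j)))"

definition block_D :: "nat list \<Rightarrow> (nat \<Rightarrow> quat mat) \<Rightarrow> quat^('n::{finite,linorder})^('n::{finite,linorder})" where
  "block_D ds A = typed_matrix (diag_block_mat (concat (map (\<lambda>d. replicate d (A d)) ds)))"

definition block_Sp :: "nat list \<Rightarrow> (nat \<Rightarrow> nat) \<Rightarrow> (quat^('n::{finite,linorder})^('n::{finite,linorder})) set" where
  "block_Sp ds t = {block_D ds g | g. g \<in> (\<Pi>\<^sub>E d\<in>set ds. Sp (t d))}"

definition Sp_typed :: "(quat^('n::{finite,linorder})^('n::{finite,linorder})) set" where
  "Sp_typed = typed_matrix ` Sp (CARD('n))"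

definition quotient_topology :: "'a topology \<Rightarrow> ('a \<Rightarrow> 'b) \<Rightarrow> 'b topology" where
  "quotient_topology T q = topology (\<lambda>U. U \<subseteq> q ` topspace T \<and> openin T {x \<in> topspace T. q x \<in> U})"

lemma quotient_map_quotient_topology: "quotient_map T (quotient_topology T q) q"
proof -
  let ?P = "\<lambda>U. U \<subseteq> q ` topspace T \<and> openin T {x \<in> topspace T. q x \<in> U}"
  have "istopology ?P"
    unfolding istopology_def
  proof (intro conjI allI impI)
    fix U V assume UV: "?P U" "?P V"
    have "{x \<in> topspace T. q x \<in> U \<inter> V} = {x \<in> topspace T. q x \<in> U} \<inter> {x \<in> topspace T. q x \<in> V}"
      by blast
    with UV show "openin T {x \<in> topspace T. q x \<in> U \<inter> V}" by (simp add: openin_Int)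
    from UV show "U \<inter> V \<subseteq> q ` topspace T" by blast
  next
    fix \<U> assume U: "\<forall>U\<in>\<U>. ?P U"
    have "{x \<in> topspace T. q x \<in> \<Union>\<U>} = (\<Union>U\<in>\<U>. {x \<in> topspace T. q x \<in> U})"
      by blast
    with U show "openin T {x \<in> topspace T. q x \<in> \<Union>\<U>}" by (metis (no_types, lifting) openin_Union image_iff)
    from U show "\<Union>\<U> \<subseteq> q ` topspace T" by blast
  qed
  then have o: "openin (quotient_topology T q) = ?P"
    unfolding quotient_topology_def by (rule topology_inverse')
  have "{x \<in> topspace T. q x \<in> q ` topspace T} = topspace T" by blast
  then have "?P (q ` topspace T)" by simp
  then have "topspace (quotient_topology T q) = q ` topspace T"
    unfolding topspace_def[of "quotient_topology T q"] o by blast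
  then show ?thesis
    unfolding quotient_map_def o by auto
qed

definition coset_space :: "(quat^'n^'n) set \<Rightarrow> (quat^'n^'n) set \<Rightarrow> (quat^'n^'n) set topology" where
  "coset_space G K =
     quotient_topology (top_of_set G) (\<lambda>g. g <#\<^bsub>matrix_group G\<^esub> K)"

end

theory Submission
  imports Defs
begin

text \<open>By sl(2)-theory the vectors X^l v with v in L(d-1) form a basis of the space, and an invertible matrix
  commutes with X and preserves every L(d-1) if and only if it is block diagonal in such a basis, with
  the block of L(d-1) repeated d times. A compact subgroup K of the centralizer preserves a positive
  definite form. Bases of the L(d-1) that are orthonormal for this form turn K into unitary block
  matrices, and all of these centralize the triple, so maximality of K gives equality.

  For the homotopy type take X in the coordinates of such a basis. Every N in the orbit has a Jordan
  basis with matrix h, canonical up to the stabilizer of X in Sp(n): its strings start at orthonormal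
  bases of the orthogonal complements of ker N^(d-1) + N ker N^(d+1) in ker N^d. Hence h h* depends
  only on N, and does so continuously. Deforming h to its unitary part retracts the orbit to the
  compact orbit of X under Sp(n), where the stabilizer of X is exactly K.\<close>

subsection \<open>Quaternionic matrices\<close>

text \<open>K and the bases \<open>v\<close> are given independently, so K need not be unitary in
  the coordinates of \<open>v\<close>. This is why the conclusion has two forms: K is moved by an
  element \<open>z\<close> of the centralizer, or \<open>v\<close> is replaced by bases
  \<open>v'\<close> adapted to K; \<open>z\<close> is the rescaled change from \<open>v'\<close> to
  \<open>v\<close>. The obstacle in the retraction is continuity. No continuous choice of Jordan
  bases is made: h h* is unaffected by a unitary change of the generators, so only the projections
  onto the generator spaces enter. These are continuous because the dimensions of the spaces are
  constant on the orbit, although conjugation does not respect orthogonal complements. The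
  deformation stays in the orbit because positive definite matrices form a convex set of invertible
  matrices. The condition of reduced norm 1 is handled once: every invertible quaternionic matrix
  has positive reduced norm. A positive scaling therefore moves it into the special linear group
  without changing its adjoint action, and unitary matrices already lie there. Hence Jordan bases
  may be arbitrary invertible matrices.\<close>

lemma quat_cnj_0 [simp]: "quat_cnj 0 = 0"
  and quat_cnj_1 [simp]: "quat_cnj 1 = 1"
  and quat_cnj_cnj [simp]: "quat_cnj (quat_cnj x) = x"
  and quat_cnj_add: "quat_cnj (x + y) = quat_cnj x + quat_cnj y"
  and quat_cnj_diff: "quat_cnj (x - y) = quat_cnj x - quat_cnj y"
  and quat_cnj_mult: "quat_cnj (x * y) = quat_cnj y * quat_cnj x"
  and quat_cnj_scaleR: "quat_cnj (r *\<^sub>R x) = r *\<^sub>R quat_cnj x"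
  by (simp_all add: quat_eq_iff quat_cnj_def zero_quat_def one_quat_def plus_quat_def
      minus_quat_def times_quat_def scaleR_quat_def algebra_simps)

lemma quat_cnj_sum: "quat_cnj (sum f A) = (\<Sum>i\<in>A. quat_cnj (f i))"
  by (induction A rule: infinite_finite_induct) (simp_all add: quat_cnj_add)

lemma q1_add [simp]: "q1 (x + y) = q1 x + q1 y" and q1_0 [simp]: "q1 0 = 0"
  by (simp_all add: plus_quat_def zero_quat_def)

lemma q1_sum: "q1 (sum f A) = (\<Sum>i\<in>A. q1 (f i))"
  by (induction A rule: infinite_finite_induct) simp_all

text \<open>Only the real part of a product forgets the order of the factors; the cyclicity of
  \<open>rtrace\<close> rests on this.\<close>

lemma q1_mult_commute: "q1 (x * y) = q1 (y * x)"
  by (simp add: times_quat_def)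

lemma inner_quat_eq: "inner x y = q1 (quat_cnj x * y)"
  by (simp add: inner_quat_def quat_cnj_def times_quat_def)

lemma quat_cnj_mult_self: "quat_cnj x * x = (norm x)\<^sup>2 *\<^sub>R 1" "x * quat_cnj x = (norm x)\<^sup>2 *\<^sub>R 1"
  by (simp_all add: power2_norm_eq_inner quat_eq_iff scaleR_quat_def quat_cnj_def times_quat_def
      one_quat_def inner_quat_def)

lemma norm_quat_mult: "norm (x * y :: quat) = norm x * norm y"
proof -
  have "inner (x * y) (x * y) = inner x x * inner y y"
    by (simp add: inner_quat_def times_quat_def algebra_simps)
  then show ?thesis by (simp add: norm_quat_def real_sqrt_mult)
qed

lemma inner_quat_mult_right: "inner (x * q) y = inner x (y * quat_cnj q)"
  and inner_quat_mult_left: "inner (q * x) y = inner x (quat_cnj q * y)"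
  by (simp_all add: inner_quat_def quat_cnj_def times_quat_def algebra_simps)

definition adj :: "quat^'n^'m \<Rightarrow> quat^'m^'n" where
  "adj A = (\<chi> i j. quat_cnj (A$j$i))"

lemma adj_nth: "adj A $ i $ j = quat_cnj (A$j$i)"
  by (simp add: adj_def)

lemma adj_adj [simp]: "adj (adj A) = A"
  by (simp add: adj_def Finite_Cartesian_Product.vec_eq_iff)

lemma adj_mult: "adj (A ** B) = adj B ** adj A"
  by (simp add: adj_def Finite_Cartesian_Product.vec_eq_iff matrix_matrix_mult_def quat_cnj_sum quat_cnj_mult)

lemma adj_one [simp]: "adj (mat 1) = mat 1"
  by (auto simp: adj_def Finite_Cartesian_Product.vec_eq_iff Finite_Cartesian_Product.mat_def)

lemma adj_add: "adj (A + B) = adj A + adj B"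
  and adj_diff: "adj (A - B) = adj A - adj B"
  and adj_scaleR: "adj (r *\<^sub>R A) = r *\<^sub>R adj A"
  and adj_0 [simp]: "adj 0 = 0"
  by (simp_all add: adj_def Finite_Cartesian_Product.vec_eq_iff quat_cnj_add quat_cnj_diff quat_cnj_scaleR)

lemma linear_adj: "linear adj"
  by (rule linearI) (simp_all add: adj_add adj_scaleR)

lemma adj_sum: "adj (sum f A) = (\<Sum>i\<in>A. adj (f i))"
  using linear_adj by (rule linear_sum)

lemma continuous_on_adj [continuous_intros]:
  "continuous_on S f \<Longrightarrow> continuous_on S (\<lambda>x. adj (f x))"
  using linear_adj linear_conv_bounded_linear bounded_linear.continuous_on by blast

lemma tendsto_adj [tendsto_intros]: "(f \<longlongrightarrow> l) F \<Longrightarrow> ((\<lambda>x. adj (f x)) \<longlongrightarrow> adj l) F"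
  using linear_adj linear_conv_bounded_linear bounded_linear.tendsto by blast

lemma linear_qmv: "linear ((*v) (A :: quat^'n^'m))"
  by (rule matrix_vector_mul_linear)

lemmas qmv_scaleR = linear_scale[OF linear_qmv]
lemmas qmv_add = linear_add[OF linear_qmv]
lemmas qmv_diff = linear_diff[OF linear_qmv]
lemmas qmv_neg = linear_neg[OF linear_qmv]
lemmas qmv_sum = linear_sum[OF linear_qmv]

lemma qmv_scaleR_left: "(r *\<^sub>R A) *v x = r *\<^sub>R (A *v x)" for A :: "quat^'n^'m"
  by (simp add: matrix_vector_mult_def Finite_Cartesian_Product.vec_eq_iff scaleR_sum_right)

lemma qmv_sum_left: "(sum f S) *v x = (\<Sum>i\<in>S. f i *v x)" for f :: "'i \<Rightarrow> quat^'n^'m"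
  by (induction S rule: infinite_finite_induct) (simp_all add: matrix_vector_mult_add_rdistrib)

lemma inner_qmv: "inner (A *v x) y = inner x (adj A *v y)" for A :: "quat^'n^'m"
proof -
  have "inner (A *v x) y = (\<Sum>i\<in>UNIV. \<Sum>j\<in>UNIV. inner (A$i$j * x$j) (y$i))"
    by (simp add: inner_vec_def matrix_vector_mult_def inner_sum_left)
  also have "\<dots> = (\<Sum>j\<in>UNIV. \<Sum>i\<in>UNIV. inner (x$j) (quat_cnj (A$i$j) * y$i))"
    by (subst sum.swap) (simp add: inner_quat_mult_left)
  also have "\<dots> = inner x (adj A *v y)"
    by (simp add: inner_vec_def matrix_vector_mult_def inner_sum_right adj_def)
  finally show ?thesis .
qed

lemma rscale_nth [simp]: "rscale v q $ i = v$i * q"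
  by (simp add: rscale_def)

lemma qmv_rscale: "A *v rscale x q = rscale (A *v x) q"
  by (simp add: matrix_vector_mult_def Finite_Cartesian_Product.vec_eq_iff sum_distrib_right mult.assoc)

lemma inner_rscale: "inner (rscale x q) y = inner x (rscale y (quat_cnj q))"
  by (simp add: inner_vec_def inner_quat_mult_right)

lemma rscale_add: "rscale (x + y) q = rscale x q + rscale y q"
  and rscale_diff: "rscale (x - y) q = rscale x q - rscale y q"
  and rscale_add_right: "rscale x (p + q) = rscale x p + rscale x q"
  and rscale_rscale: "rscale (rscale x p) q = rscale x (p * q)"
  and rscale_1 [simp]: "rscale x 1 = x"
  and rscale_0 [simp]: "rscale x 0 = 0" "rscale 0 q = 0"
  and rscale_scaleR: "rscale (r *\<^sub>R x) q = r *\<^sub>R rscale x q" "rscale x (r *\<^sub>R q) = r *\<^sub>R rscale x q"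
  by (simp_all add: Finite_Cartesian_Product.vec_eq_iff algebra_simps)

lemma rscale_sum: "rscale (sum f A) q = (\<Sum>i\<in>A. rscale (f i) q)"
  by (induction A rule: infinite_finite_induct) (simp_all add: rscale_add)

lemma rscale_sum_right: "rscale x (sum f A) = (\<Sum>i\<in>A. rscale x (f i))"
  by (induction A rule: infinite_finite_induct) (simp_all add: rscale_add_right)

lemma linear_rscale: "linear (\<lambda>x. rscale x q)"
  by (rule linearI) (simp_all add: rscale_add rscale_scaleR)

lemma qmv_columns: "A *v x = (\<Sum>j\<in>UNIV. rscale (column j A) (x$j))"
  by (simp add: matrix_vector_mult_def Finite_Cartesian_Product.vec_eq_iff column_def)

lemma qmv_axis: "(A::quat^'n^'m) *v axis j 1 = column j A"
  by (simp add: matrix_vector_mult_def Finite_Cartesian_Product.vec_eq_iff column_def axis_def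
      if_distrib[where f="\<lambda>x. _ * x"] cong: if_cong)

lemma column_mult: "column j (A ** B) = (A::quat^'n^'m) *v column j B"
  by (simp add: matrix_matrix_mult_def matrix_vector_mult_def column_def Finite_Cartesian_Product.vec_eq_iff)

lemma matrix_eq_columns: "A = B \<longleftrightarrow> (\<forall>j. column j A = column j B)" for A B :: "quat^'n^'m"
  by (auto simp: column_def Finite_Cartesian_Product.vec_eq_iff)

lemma axis_expansion: "x = (\<Sum>j\<in>UNIV. rscale (axis j 1) (x$j))" for x :: "quat^'n"
  using qmv_columns[of "mat 1" x] by (simp add: qmv_axis[symmetric])

lemma bounded_bilinear_qmult: "bounded_bilinear ((**) :: quat^'n^'m \<Rightarrow> quat^'p^'n \<Rightarrow> quat^'p^'m)"
  unfolding bilinear_conv_bounded_bilinear[symmetric] bilinear_def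
  by (auto intro!: linearI simp: matrix_add_ldistrib matrix_matrix_mult_def scaleR_sum_right
      Finite_Cartesian_Product.vec_eq_iff algebra_simps sum.distrib)

lemma bounded_bilinear_qmv: "bounded_bilinear ((*v) :: quat^'n^'m \<Rightarrow> quat^'n \<Rightarrow> quat^'m)"
  unfolding bilinear_conv_bounded_bilinear[symmetric] bilinear_def
  by (auto intro!: linearI simp: matrix_vector_mult_def scaleR_sum_right
      Finite_Cartesian_Product.vec_eq_iff algebra_simps sum.distrib)

lemmas continuous_on_qmult [continuous_intros] = bounded_bilinear.continuous_on[OF bounded_bilinear_qmult]
lemmas tendsto_qmult [tendsto_intros] = bounded_bilinear.tendsto[OF bounded_bilinear_qmult]
lemmas tendsto_qmv [tendsto_intros] = bounded_bilinear.tendsto[OF bounded_bilinear_qmv]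
lemmas qmult_diff_left = bounded_bilinear.diff_left[OF bounded_bilinear_qmult]
lemmas qmult_diff_right = bounded_bilinear.diff_right[OF bounded_bilinear_qmult]
lemmas qmult_add_left = bounded_bilinear.add_left[OF bounded_bilinear_qmult]
lemmas qmult_add_right = bounded_bilinear.add_right[OF bounded_bilinear_qmult]
lemmas qmult_scaleR_left = bounded_bilinear.scaleR_left[OF bounded_bilinear_qmult]
lemmas qmult_scaleR_right = bounded_bilinear.scaleR_right[OF bounded_bilinear_qmult]
lemmas qmult_sum_left = bounded_bilinear.sum_left[OF bounded_bilinear_qmult]
lemmas qmult_sum_right = bounded_bilinear.sum_right[OF bounded_bilinear_qmult]

text \<open>Real linearity alone would give a real matrix of four times the size; compatibility with
  right scalars is what yields a quaternionic one. Linear inverses and the fixed point in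
  \<open>sqrt_fixed_point\<close> become matrices this way.\<close>

lemma right_linear_matrix:
  fixes f :: "quat^'n \<Rightarrow> quat^'m"
  assumes "linear f" "\<And>x q. f (rscale x q) = rscale (f x) q"
  shows "matrix f *v x = f x"
proof -
  have "f x = f (\<Sum>j\<in>UNIV. rscale (axis j 1) (x$j))" using axis_expansion[of x] by simp
  also have "\<dots> = (\<Sum>j\<in>UNIV. rscale (f (axis j 1)) (x$j))" by (simp add: linear_sum assms)
  also have "\<dots> = matrix f *v x"
    by (simp add: qmv_columns matrix_def column_def)
  finally show ?thesis ..
qed

text \<open>A left inverse makes the underlying real linear map injective, hence surjective in
  finite dimension; this replaces determinants over the noncommutative entries.\<close>

lemma left_inverse_imp_invertible:
  fixes A :: "quat^'n^'n"
  assumes "B ** A = mat 1" shows "invertible A" "A ** B = mat 1"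
proof -
  have BA: "B *v (A *v x) = x" for x using assms by (simp add: matrix_vector_mul_assoc)
  then have "inj ((*v) A)" by (metis injI)
  then have "surj ((*v) A)" by (rule linear_injective_imp_surjective[OF linear_qmv _ refl])
  then have "A *v (B *v x) = x" for x using BA by (metis surjD)
  then show "A ** B = mat 1" by (simp add: matrix_eq matrix_vector_mul_assoc[symmetric])
  with assms show "invertible A" by (auto simp: invertible_def)
qed

lemma invertible_iff_ker: "invertible A \<longleftrightarrow> (\<forall>x. A *v x = 0 \<longrightarrow> x = 0)" for A :: "quat^'n^'n"
proof
  assume "invertible A" then show "\<forall>x. A *v x = 0 \<longrightarrow> x = 0"
    by (metis invertible_def matrix_vector_mul_assoc matrix_vector_mul_lid matrix_vector_mult_0_right)
next
  assume "\<forall>x. A *v x = 0 \<longrightarrow> x = 0"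
  then have inj: "inj ((*v) A)" by (simp add: linear_injective_0[OF linear_qmv])
  then obtain g where g: "linear g" "\<forall>x. g (A *v x) = x" "\<forall>x. A *v g x = x"
    using linear_injective_isomorphism[OF linear_qmv inj refl] by blast
  \<comment> \<open>The real inverse inherits right linearity from \<open>A\<close>, so it comes
    from a quaternionic matrix.\<close>
  have "g (rscale x q) = rscale (g x) q" for x q
    by (metis g(2,3) qmv_rscale)
  then have m: "matrix g *v x = g x" for x using g(1) by (intro right_linear_matrix) auto
  then have "matrix g ** A = mat 1"
    by (simp add: matrix_eq matrix_vector_mul_assoc[symmetric] g)
  then show "invertible A" by (rule left_inverse_imp_invertible)
qed

section \<open>Inverse matrices and their continuity\<close>

lemma matrix_inv_mult:
  assumes "invertible (A :: quat^'n^'n)"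
  shows "A ** matrix_inv A = mat 1" "matrix_inv A ** A = mat 1"
  using assms unfolding invertible_def matrix_inv_def by (metis (mono_tags, lifting) someI_ex)+

lemma matrix_inv_unique:
  fixes A :: "quat^'n^'n"
  assumes "B ** A = mat 1" shows "matrix_inv A = B"
  using left_inverse_imp_invertible[OF assms] assms matrix_inv_mult
  by (metis matrix_mul_assoc matrix_mul_lid matrix_mul_rid)

lemma invertible_matrix_inv: "invertible A \<Longrightarrow> invertible (matrix_inv (A::quat^'n^'n))"
  using matrix_inv_mult by (metis invertible_def)

lemma matrix_inv_mult_distrib:
  fixes A B :: "quat^'n^'n"
  assumes "invertible A" "invertible B"
  shows "matrix_inv (A ** B) = matrix_inv B ** matrix_inv A"
proof (rule matrix_inv_unique)
  have "matrix_inv B ** matrix_inv A ** (A ** B) = matrix_inv B ** (matrix_inv A ** A) ** B"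
    by (simp add: matrix_mul_assoc)
  then show "matrix_inv B ** matrix_inv A ** (A ** B) = mat 1"
    by (simp add: assms matrix_inv_mult)
qed

lemma matrix_inv_one [simp]: "matrix_inv (mat 1 :: quat^'n^'n) = mat 1"
  by (rule matrix_inv_unique) simp

lemma invertible_one [simp]: "invertible (mat 1 :: quat^'n^'n)"
  by (rule left_inverse_imp_invertible) simp

text \<open>The norm of typed matrices is the Frobenius norm; Cauchy-Schwarz in every entry makes it
  submultiplicative.\<close>

lemma norm_qmult_le: "norm (A ** B) \<le> norm A * norm B" for A :: "quat^'n^'m" and B :: "quat^'p^'n"
proof -
  have *: "norm (\<Sum>k\<in>UNIV. A$i$k * B$k$j) \<le> norm (A$i) * norm (column j B)" for i j
  proof -
    have "norm (\<Sum>k\<in>UNIV. A$i$k * B$k$j) \<le> (\<Sum>k\<in>UNIV. \<bar>norm (A$i$k)\<bar> * \<bar>norm (B$k$j)\<bar>)"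
      by (rule sum_norm_le) (simp add: norm_quat_mult)
    also have "\<dots> \<le> L2_set (\<lambda>k. norm (A$i$k)) UNIV * L2_set (\<lambda>k. norm (B$k$j)) UNIV"
      by (rule L2_set_mult_ineq)
    finally show ?thesis by (simp add: norm_vec_def column_def)
  qed
  have c: "(\<Sum>j\<in>UNIV. (norm (column j B))\<^sup>2) = (norm B)\<^sup>2"
    by (simp add: norm_vec_def L2_set_def column_def sum_nonneg) (rule sum.swap)
  have "(norm (A ** B))\<^sup>2 = (\<Sum>i\<in>UNIV. \<Sum>j\<in>UNIV. (norm (\<Sum>k\<in>UNIV. A$i$k * B$k$j))\<^sup>2)"
    by (simp add: norm_vec_def L2_set_def matrix_matrix_mult_def sum_nonneg)
  also have "\<dots> \<le> (\<Sum>i\<in>UNIV. \<Sum>j\<in>UNIV. (norm (A$i) * norm (column j B))\<^sup>2)"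
    by (intro sum_mono power_mono * norm_ge_zero)
  also have "\<dots> = (\<Sum>i\<in>UNIV. (norm (A$i))\<^sup>2) * (norm B)\<^sup>2"
    by (simp add: power_mult_distrib sum_distrib_left[symmetric] sum_distrib_right[symmetric] c)
  also have "\<dots> = (norm A * norm B)\<^sup>2"
    by (simp add: norm_vec_def L2_set_def sum_nonneg power_mult_distrib)
  finally show ?thesis by (rule power2_le_imp_le) simp
qed

text \<open>With C the inverse of \<open>A\<close> and D that of \<open>f x\<close>, D - C = (1 - C
  f x) D. Once 1 - C f x has norm below 1/2, this bounds D by twice the norm of C, and then D - C
  tends to 0.\<close>

lemma tendsto_matrix_inv:
  fixes f :: "'a \<Rightarrow> quat^'n^'n"
  assumes f: "(f \<longlongrightarrow> A) F" and A: "invertible A" and inv: "\<forall>\<^sub>F x in F. invertible (f x)"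
  shows "((\<lambda>x. matrix_inv (f x)) \<longlongrightarrow> matrix_inv A) F"
proof -
  let ?C = "matrix_inv A"
  let ?e = "\<lambda>x. norm (mat 1 - ?C ** f x)"
  have "((\<lambda>x. mat 1 - ?C ** f x) \<longlongrightarrow> mat 1 - ?C ** A) F" by (intro tendsto_intros f)
  then have e0: "(?e \<longlongrightarrow> 0) F" using matrix_inv_mult[OF A] by (metis diff_self tendsto_norm_zero)
  then have half: "\<forall>\<^sub>F x in F. ?e x < 1/2" by (rule order_tendstoD) simp
  have bound: "\<forall>\<^sub>F x in F. norm (matrix_inv (f x) - ?C) \<le> ?e x * (2 * norm ?C)"
    using half inv
  proof eventually_elim
    case (elim x)
    let ?D = "matrix_inv (f x)"
    have "?D - ?C = (mat 1 - ?C ** f x) ** ?D"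
      using matrix_inv_mult[OF elim(2)]
      by (simp add: qmult_diff_left matrix_mul_assoc[symmetric])
    then have 1: "norm (?D - ?C) \<le> ?e x * norm ?D" by (metis norm_qmult_le)
    have "norm ?D \<le> norm (?D - ?C) + norm ?C" by (metis diff_add_cancel norm_triangle_ineq)
    also have "\<dots> \<le> 1/2 * norm ?D + norm ?C"
      using 1 elim(1) by (meson add_right_mono mult_right_mono norm_ge_zero order_trans less_imp_le)
    finally have "norm ?D \<le> 2 * norm ?C" by simp
    then show ?case using 1 by (meson mult_left_mono norm_ge_zero order_trans)
  qed
  have "((\<lambda>x. ?e x * (2 * norm ?C)) \<longlongrightarrow> 0 * (2 * norm ?C)) F" by (rule tendsto_mult[OF e0 tendsto_const])
  then have "((\<lambda>x. matrix_inv (f x) - ?C) \<longlongrightarrow> 0) F"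
    by (intro Lim_null_comparison[OF bound]) simp
  then show ?thesis by (simp add: LIM_zero_iff)
qed

lemma continuous_on_matrix_inv [continuous_intros]:
  fixes f :: "'a::topological_space \<Rightarrow> quat^'n^'n"
  assumes "continuous_on S f" "\<And>x. x \<in> S \<Longrightarrow> invertible (f x)"
  shows "continuous_on S (\<lambda>x. matrix_inv (f x))"
  using assms unfolding continuous_on_def
  by (auto intro!: tendsto_matrix_inv simp: eventually_at_filter)

subsection \<open>The reduced norm\<close>

lemma reduced_norm_mult: "reduced_norm (A ** B) = reduced_norm A * reduced_norm B"
  by (simp add: reduced_norm_def complexify_mult det_mul)

lemma complexify_scalar: "complexify (mat (r *\<^sub>R 1)) = mat (of_real r)"
  by (auto simp: complexify_def Finite_Cartesian_Product.mat_def Finite_Cartesian_Product.vec_eq_iff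
      quat_z_def quat_w_def scaleR_quat_def one_quat_def zero_quat_def complex_eq_iff split: sum.split)

lemma reduced_norm_scalar: "reduced_norm (mat (r *\<^sub>R 1) :: quat^'n^'n) = of_real (r ^ CARD('n + 'n))"
proof -
  have "det (mat (of_real r) :: complex^('n+'n)^('n+'n)) = (\<Prod>i\<in>(UNIV::('n+'n) set). of_real r)"
    by (subst det_diagonal) (auto simp: Finite_Cartesian_Product.mat_def)
  then show ?thesis by (simp add: reduced_norm_def complexify_scalar)
qed

lemma reduced_norm_one [simp]: "reduced_norm (mat 1) = 1"
  using reduced_norm_scalar[of 1] by simp

lemma scaleR_eq_scalar_mult: "r *\<^sub>R A = mat (r *\<^sub>R 1) ** A" for A :: "quat^'n^'m"
  by (simp add: Finite_Cartesian_Product.mat_def matrix_matrix_mult_def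
      Finite_Cartesian_Product.vec_eq_iff if_distrib[where f="\<lambda>x. x * _"] cong: if_cong)

lemma mat_mult_mat: "mat p ** mat q = (mat (p * q) :: quat^'n^'n)"
  by (simp add: Finite_Cartesian_Product.mat_def matrix_matrix_mult_def
      Finite_Cartesian_Product.vec_eq_iff if_distrib[where f="\<lambda>x. x * _"] cong: if_cong)

lemma det_cnj: "det (map_matrix cnj M) = cnj (det M)"
  by (simp add: det_def)

text \<open>Conjugating by the quaternion j conjugates the complexification entrywise.\<close>

lemma cnj_reduced_norm: "cnj (reduced_norm A) = reduced_norm A"
proof -
  let ?j = "Quat 0 0 1 0"
  have "(mat ?j ** A ** mat (- ?j)) $ a $ b = ?j * A $ a $ b * (- ?j)" for a b
    by (simp add: Finite_Cartesian_Product.mat_def matrix_matrix_mult_def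
        if_distrib[where f="\<lambda>x. x * _"] if_distrib[where f="\<lambda>x. _ * x"] cong: if_cong)
  then have "complexify (mat ?j ** A ** mat (- ?j)) = map_matrix cnj (complexify A)"
    by (auto simp: complexify_def Finite_Cartesian_Product.vec_eq_iff quat_z_def quat_w_def
        times_quat_def uminus_quat_def complex_eq_iff split: sum.split)
  moreover have "mat ?j ** mat (- ?j) = (mat 1 :: quat^'a^'a)"
    unfolding mat_mult_mat by (simp add: times_quat_def uminus_quat_def one_quat_def)
  then have "reduced_norm (mat ?j :: quat^'a^'a) * reduced_norm (mat (- ?j) :: quat^'a^'a) = 1"
    by (metis reduced_norm_mult reduced_norm_one)
  ultimately show ?thesis
    by (metis (no_types, lifting) reduced_norm_def reduced_norm_mult det_cnj mult.left_commute mult.commute mult.right_neutral)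
qed

text \<open>Complexification turns \<open>adj\<close> into the conjugate transpose, and the
  determinant is real by \<open>cnj_reduced_norm\<close>.\<close>

lemma reduced_norm_adj: "reduced_norm (adj A) = reduced_norm A"
proof -
  have "complexify (adj A) = map_matrix cnj (transpose (complexify A))"
    by (auto simp: complexify_def adj_def transpose_def Finite_Cartesian_Product.vec_eq_iff quat_z_def
        quat_w_def quat_cnj_def complex_eq_iff split: sum.split)
  then show ?thesis
    using cnj_reduced_norm[of A] by (simp add: reduced_norm_def det_cnj det_transpose)
qed

lemma reduced_norm_nonzero: "invertible A \<Longrightarrow> reduced_norm A \<noteq> 0" for A :: "quat^'n^'n"
  by (metis invertible_def mult_zero_left reduced_norm_mult reduced_norm_one zero_neq_one)

text \<open>\<open>cnj_reduced_norm\<close> makes the reduced norm real but leaves its sign open; a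
  positive scaling can reach reduced norm 1 only from a positive value.\<close>

definition pos_reduced_norm :: "quat^'n^'n \<Rightarrow> bool" where
  "pos_reduced_norm A \<longleftrightarrow> (\<exists>r>0. reduced_norm A = of_real r)"

lemma pos_reduced_norm_mult:
  "pos_reduced_norm A \<Longrightarrow> pos_reduced_norm B \<Longrightarrow> pos_reduced_norm (A ** B)"
  unfolding pos_reduced_norm_def reduced_norm_mult by (metis mult_pos_pos of_real_mult)

lemma pos_reduced_norm_cancel:
  assumes "pos_reduced_norm (A ** B)" "pos_reduced_norm A" shows "pos_reduced_norm B"
proof -
  obtain r s where rs: "r > 0" "s > 0" "of_real r = of_real s * reduced_norm B"
    using assms unfolding pos_reduced_norm_def reduced_norm_mult by force
  then have "reduced_norm B = of_real (r / s)" by (simp add: field_simps)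
  then show ?thesis using rs unfolding pos_reduced_norm_def by (metis divide_pos_pos)
qed

text \<open>The source of positivity: a real nonzero number has a positive square, and the
  elementary factors below are recognised as squares.\<close>

lemma pos_reduced_norm_square:
  fixes B :: "quat^'n^'n"
  assumes "invertible (B ** B)" shows "pos_reduced_norm (B ** B)"
proof -
  have "reduced_norm B \<in> \<real>" using cnj_reduced_norm Reals_cnj_iff by blast
  then obtain r where r: "reduced_norm B = of_real r" by (auto elim: Reals_cases)
  have "r \<noteq> 0" using reduced_norm_nonzero[OF assms] r by (auto simp: reduced_norm_mult)
  then have "r * r > 0" by (metis not_real_square_gt_zero)
  then show ?thesis unfolding pos_reduced_norm_def reduced_norm_mult r by (metis of_real_mult)
qed

text \<open>Excluding -1 makes 1 + b invertible, which \<open>pos_reduced_norm_column_matrix\<close>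
  divides by.\<close>

lemma quat_sqrt_exists: "\<exists>b. b * b = a \<and> b \<noteq> - (1::quat)"
proof -
  define n where "n = norm a"
  have n: "n * n = q1 a * q1 a + qi a * qi a + qj a * qj a + qk a * qk a"
    by (simp add: n_def norm_quat_def inner_quat_def)
  have n0: "n \<ge> 0" by (simp add: n_def)
  show ?thesis
  proof (cases "n + q1 a > 0")
    case True
    \<comment> \<open>The identity (a + |a|)^2 = 2 (|a| + Re a) a makes a + |a| a square root up to
      this factor, and its real part is positive.\<close>
    define t where "t = 1 / sqrt (2 * (n + q1 a))"
    have t: "t * t * (2 * (n + q1 a)) = 1" "t > 0" using True by (simp_all add: t_def)
    define b where "b = t *\<^sub>R (a + n *\<^sub>R 1)"
    have sq: "(a + n *\<^sub>R 1) * (a + n *\<^sub>R 1) = (2 * (n + q1 a)) *\<^sub>R a"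
      using n by (simp add: quat_eq_iff times_quat_def plus_quat_def scaleR_quat_def one_quat_def algebra_simps)
    have "b * b = (t * t) *\<^sub>R ((2 * (n + q1 a)) *\<^sub>R a)" by (simp add: b_def sq)
    then have "b * b = a" using t(1) by simp
    moreover have "q1 b > 0"
      using True t(2) by (simp add: b_def scaleR_quat_def plus_quat_def one_quat_def add.commute)
    then have "b \<noteq> - 1" by (auto simp: uminus_quat_def one_quat_def)
    ultimately show ?thesis by blast
  next
    case False
    \<comment> \<open>Now |a| = - Re a, so a is a real number \<le> 0 and has a root on the
      i-axis.\<close>
    have "q1 a * q1 a \<ge> n * n" using False n0 by (smt (verit) mult_mono minus_mult_minus)
    then have "qi a * qi a + qj a * qj a + qk a * qk a \<le> 0" using n by linarith
    then have 0: "qi a = 0" "qj a = 0" "qk a = 0"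
      by (smt (verit) not_real_square_gt_zero zero_le_square)+
    have "q1 a \<le> 0" using False n0 by linarith
    then have "Quat 0 (sqrt (- q1 a)) 0 0 * Quat 0 (sqrt (- q1 a)) 0 0 = a"
      using 0 by (simp add: quat_eq_iff times_quat_def)
    moreover have "Quat 0 (sqrt (- q1 a)) 0 0 \<noteq> - 1" by (auto simp: uminus_quat_def one_quat_def)
    ultimately show ?thesis by blast
  qed
qed

section \<open>Elementary matrices and the sign of the reduced norm\<close>

definition column_matrix :: "'n \<Rightarrow> quat^'n \<Rightarrow> quat^'n^'n" where
  "column_matrix k a = (\<chi> i j. if j = k then a$i else axis j 1 $ i)"

lemma column_column_matrix: "column j (column_matrix k a) = (if j = k then a else axis j 1)"
  by (auto simp: column_def column_matrix_def Finite_Cartesian_Product.vec_eq_iff)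

lemma column_matrix_qmv: "column_matrix k a *v x = x + rscale (a - axis k 1) (x$k)"
proof -
  have "column_matrix k a *v x = (\<Sum>j\<in>UNIV. rscale (axis j 1) (x$j) +
      (if j = k then rscale (a - axis k 1) (x$k) else 0))"
    unfolding qmv_columns column_column_matrix by (rule sum.cong) (auto simp: rscale_diff)
  then show ?thesis by (simp add: sum.distrib axis_expansion[symmetric])
qed

lemma invertible_column_matrix:
  assumes "a$k \<noteq> 0" shows "invertible (column_matrix k a)"
proof (unfold invertible_iff_ker, intro allI impI)
  fix x assume "column_matrix k a *v x = 0"
  then have e: "x + rscale (a - axis k 1) (x$k) = 0" by (simp add: column_matrix_qmv)
  then have "x$k + (a$k - 1) * x$k = 0"
    by (metis (no_types, lifting) axis_nth rscale_nth vector_add_component vector_minus_component zero_index)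
  then have "x$k = 0" using assms by (simp add: algebra_simps)
  with e show "x = 0" by simp
qed

lemma pos_reduced_norm_column_matrix:
  assumes "a$k \<noteq> 0" shows "pos_reduced_norm (column_matrix k a)"
proof -
  obtain c where c: "c * c = a$k" "c \<noteq> - 1" using quat_sqrt_exists by blast
  \<comment> \<open>The square of \<open>column_matrix k b\<close> has the entries b_i (1 + c) and c
    c in column k, which fixes this choice.\<close>
  define b where "b = (\<chi> i. if i = k then c else a$i * inverse (1 + c))"
  have c1: "1 + c \<noteq> 0" using c(2) by (metis add.commute eq_neg_iff_add_eq_0)
  have "b + rscale (b - axis k 1) (b$k) = a"
    unfolding Finite_Cartesian_Product.vec_eq_iff
  proof
    fix i
    have "a$i * inverse (1 + c) + a$i * (inverse (1 + c) * c) = a$i"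
      using c1 by (metis distrib_left left_inverse mult.right_neutral)
    then show "(b + rscale (b - axis k 1) (b$k)) $ i = a $ i"
      using c(1) c1 by (auto simp: b_def axis_def algebra_simps)
  qed
  then have "column_matrix k b ** column_matrix k b = column_matrix k a"
    unfolding matrix_eq_columns column_mult column_column_matrix
    by (auto simp: column_matrix_qmv axis_def)
  then show ?thesis
    using pos_reduced_norm_square[of "column_matrix k b"] invertible_column_matrix[of a k] assms by simp
qed

text \<open>Column elimination writes an invertible matrix as a product of the matrices above.\<close>

lemma pos_reduced_norm_invertible:
  fixes A :: "quat^'n^'n"
  assumes "invertible A" shows "pos_reduced_norm A"
proof -
  \<comment> \<open>The induction is over the set of columns that may still differ from the standard
    ones.\<close>
  have "\<forall>A :: quat^'n^'n. invertible A \<longrightarrow> (\<forall>j. j \<notin> S \<longrightarrow> column j A = axis j 1) \<longrightarrow> pos_reduced_norm A"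
    if "finite S" for S :: "'n set"
    using that
  proof induction
    case empty
    have "pos_reduced_norm (mat 1)" by (auto simp: pos_reduced_norm_def intro: exI[of _ 1])
    moreover have "A = mat 1" if "\<forall>j. column j A = axis j 1" for A :: "quat^'n^'n"
      using that unfolding matrix_eq_columns by (metis matrix_vector_mul_lid qmv_axis)
    ultimately show ?case by auto
  next
    case (insert k S)
    show ?case
    proof (intro allI impI)
      fix A :: "quat^'n^'n"
      assume A: "invertible A" and col: "\<forall>j. j \<notin> insert k S \<longrightarrow> column j A = axis j 1"
      define a where "a = column k A"
      obtain T :: "quat^'n^'n" where T: "invertible T" "pos_reduced_norm T"
        "\<And>j. j \<notin> insert k S \<Longrightarrow> T *v axis j 1 = axis j 1" "(T *v a)$k \<noteq> 0"
      proof (cases "a$k = 0")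
        case False
        then show ?thesis
          by (intro that[of "mat 1"]) (auto simp: pos_reduced_norm_def intro: exI[of _ 1])
      next
        case True
        \<comment> \<open>If a vanished on S as well as at k, then A a = a = A e_k, because the
          columns outside are standard. Injectivity would give a = e_k, against the zero pivot. The
          nonzero entry at i is added to the pivot by \<open>column_matrix i c\<close>.\<close>
        have "\<exists>i\<in>S. a$i \<noteq> 0"
        proof (rule ccontr)
          assume "\<not> (\<exists>i\<in>S. a$i \<noteq> 0)"
          then have "A *v a = (\<Sum>j\<in>UNIV. rscale (axis j 1) (a$j))"
            using col True unfolding qmv_columns by (intro sum.cong) (metis insertE rscale_0(1))+
          then have "A *v (a - axis k 1) = 0"
            using axis_expansion[of a] by (simp add: qmv_diff qmv_axis a_def)
          then have "a = axis k 1" using A unfolding invertible_iff_ker by (metis eq_iff_diff_eq_0)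
          with True show False by simp
        qed
        then obtain i where i: "i \<in> S" "a$i \<noteq> 0" by blast
        define c where "c = axis i 1 + (axis k 1 :: quat^'n)"
        have ik: "i \<noteq> k" using i True by auto
        have c1: "c$i \<noteq> 0" using ik by (simp add: c_def axis_def)
        show ?thesis
        proof (rule that[of "column_matrix i c"])
          show "column_matrix i c *v axis j 1 = axis j 1" if "j \<notin> insert k S" for j
            using that i by (auto simp: column_matrix_qmv axis_def)
          show "(column_matrix i c *v a)$k \<noteq> 0"
            using i True by (simp add: column_matrix_qmv c_def)
        qed (use c1 invertible_column_matrix pos_reduced_norm_column_matrix in auto)
      qed
      \<comment> \<open>Dividing by D from the left turns column k into e_k and fixes the columns
        that are already standard.\<close>
      define D where "D = column_matrix k (T *v a)"
      have D: "invertible D" "pos_reduced_norm D"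
        using T(4) by (simp_all add: D_def invertible_column_matrix pos_reduced_norm_column_matrix)
      have DD: "matrix_inv D *v (D *v x) = x" "D ** (matrix_inv D ** M) = M" for x M
        by (simp_all add: matrix_vector_mul_assoc matrix_mul_assoc matrix_inv_mult D(1))
      define A2 where "A2 = matrix_inv D ** (T ** A)"
      have "column j A2 = axis j 1" if "j \<notin> S" for j
      proof (cases "j = k")
        case True
        have "D *v axis k 1 = T *v a" by (simp add: D_def qmv_axis column_column_matrix)
        with True show ?thesis using DD(1)[of "axis k 1"] by (simp add: A2_def column_mult a_def)
      next
        case False
        have "D *v axis j 1 = axis j 1" using False by (simp add: D_def qmv_axis column_column_matrix)
        with False that show ?thesis
          using DD(1)[of "axis j 1"] col T(3) by (simp add: A2_def column_mult)
      qed
      moreover have "invertible A2"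
        unfolding A2_def by (intro invertible_mult invertible_matrix_inv A D T)
      ultimately have "pos_reduced_norm A2" using insert.IH by blast
      then have "pos_reduced_norm (D ** A2)" using D(2) by (rule pos_reduced_norm_mult[rotated])
      then have "pos_reduced_norm (T ** A)" by (simp add: A2_def DD)
      then show "pos_reduced_norm A" using T(2) by (rule pos_reduced_norm_cancel)
    qed
  qed
  then show ?thesis using assms by (metis finite_class.finite_UNIV UNIV_I)
qed

text \<open>The factor r multiplies the reduced norm by r^(2n), 2n being the size of the
  complexification; positivity of the reduced norm supplies the real root.\<close>

lemma SLH_scaling:
  fixes A :: "quat^'n^'n"
  assumes "invertible A" obtains r where "r > 0" "r *\<^sub>R A \<in> SLH"
proof -
  obtain s where s: "s > 0" "reduced_norm A = of_real s"
    using pos_reduced_norm_invertible[OF assms] by (auto simp: pos_reduced_norm_def)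
  define r where "r = root (CARD('n + 'n)) (1 / s)"
  have p: "0 < CARD('n + 'n)" by simp
  then have r: "r > 0" "r ^ CARD('n + 'n) = 1 / s"
    using s(1) by (simp_all add: r_def del: card_sum)
  have "reduced_norm (r *\<^sub>R A) = 1"
    unfolding scaleR_eq_scalar_mult reduced_norm_mult reduced_norm_scalar r(2) s(2) using s(1) by simp
  moreover have "invertible (r *\<^sub>R A)" by (rule scalar_invertible) (use r(1) assms in auto)
  ultimately show ?thesis using that r(1) by (auto simp: SLH_def)
qed

text \<open>Unitarity gives only that the reduced norm squares to 1; positivity excludes -1.\<close>

lemma unitary_SLH:
  fixes u :: "quat^'n^'n"
  assumes "adj u ** u = mat 1" shows "u \<in> SLH"
proof -
  have u: "invertible u" using assms by (rule left_inverse_imp_invertible)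
  obtain s where s: "s > 0" "reduced_norm u = of_real s"
    using pos_reduced_norm_invertible[OF u] by (auto simp: pos_reduced_norm_def)
  have "reduced_norm u * reduced_norm u = 1" using assms by (metis reduced_norm_adj reduced_norm_mult reduced_norm_one)
  then have "s * s = 1" unfolding s(2) by (metis of_real_eq_1_iff of_real_mult)
  then have "s = 1" using s(1) by (metis abs_of_pos abs_square_eq_1 power2_eq_square)
  then show ?thesis using u s by (simp add: SLH_def)
qed

subsection \<open>Quaternionic subspaces and projections\<close>

text \<open>The quaternion-valued Hermitian form with real part \<open>inner\<close>; the order of
  the factors makes it right linear in the second argument.\<close>

definition hinner :: "quat^'n \<Rightarrow> quat^'n \<Rightarrow> quat" where
  "hinner x y = (\<Sum>k\<in>UNIV. quat_cnj (x$k) * y$k)"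

lemma q1_hinner: "q1 (hinner x y) = inner x y"
  by (simp add: hinner_def q1_sum inner_vec_def inner_quat_eq)

lemma hinner_rscale_left: "hinner (rscale x q) y = quat_cnj q * hinner x y"
  by (simp add: hinner_def quat_cnj_mult sum_distrib_left mult.assoc)

lemma hinner_rscale_right: "hinner x (rscale y q) = hinner x y * q"
  by (simp add: hinner_def sum_distrib_right mult.assoc)

lemma hinner_cnj: "quat_cnj (hinner x y) = hinner y x"
  by (simp add: hinner_def quat_cnj_sum quat_cnj_mult)

lemma linear_hinner: "linear (hinner x)"
  by (rule linearI) (simp_all add: hinner_def algebra_simps sum.distrib scaleR_sum_right)

lemmas hinner_sum_right = linear_sum[OF linear_hinner]
lemmas hinner_diff_right = linear_diff[OF linear_hinner]
lemmas hinner_scaleR_right = linear_scale[OF linear_hinner]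

lemma hinner_scaleR_left: "hinner (r *\<^sub>R x) y = r *\<^sub>R hinner x y"
  using hinner_scaleR_right[of y r x] by (metis hinner_cnj quat_cnj_scaleR)

lemma hinner_0_right [simp]: "hinner x 0 = 0"
  by (rule linear_0[OF linear_hinner])

lemma hinner_self: "hinner x x = (norm x)\<^sup>2 *\<^sub>R 1"
  by (simp add: hinner_def quat_cnj_mult_self scaleR_sum_left[symmetric] norm_vec_def L2_set_def sum_nonneg)

lemma q1_diff: "q1 (x - y) = q1 x - q1 y"
  by (simp add: minus_quat_def)

text \<open>A quaternion is determined by the real parts of its right multiples, so the real
  identity \<open>inner_qmv\<close>, tested on all right multiples of y, suffices.\<close>

lemma hinner_qmv: "hinner (A *v x) y = hinner x (adj A *v y)"
proof -
  have "q1 (hinner (A *v x) y * q) = q1 (hinner x (adj A *v y) * q)" for q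
    by (metis hinner_rscale_right inner_qmv q1_hinner qmv_rscale)
  then have "q1 ((hinner (A *v x) y - hinner x (adj A *v y)) * q) = 0" for q
    by (simp add: left_diff_distrib q1_diff)
  then have "q1 (quat_cnj (hinner (A *v x) y - hinner x (adj A *v y)) *
      (hinner (A *v x) y - hinner x (adj A *v y))) = 0"
    by (metis q1_mult_commute)
  then show ?thesis unfolding inner_quat_eq[symmetric] by simp
qed

definition outer :: "quat^'n \<Rightarrow> quat^'m \<Rightarrow> quat^'m^'n" where
  "outer x y = (\<chi> i j. x$i * quat_cnj (y$j))"

lemma outer_qmv: "outer x y *v z = rscale x (hinner y z)"
  by (simp add: outer_def hinner_def matrix_vector_mult_def Finite_Cartesian_Product.vec_eq_iff
      sum_distrib_left mult.assoc)

lemma adj_outer: "adj (outer x y) = outer y x"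
  by (simp add: outer_def adj_def Finite_Cartesian_Product.vec_eq_iff quat_cnj_mult)

lemma qmult_outer: "A ** outer x y = outer (A *v x) y"
  by (simp add: matrix_eq matrix_vector_mul_assoc[symmetric] outer_qmv qmv_rscale)

lemma outer_qmult: "outer x y ** B = outer x (adj B *v y)"
  by (metis adj_adj adj_mult adj_outer qmult_outer)

text \<open>If \<open>ws\<close> are the columns of a matrix h, this is h h*; for orthonormal
  \<open>ws\<close> it is the orthogonal projection onto their span.\<close>

definition osum :: "(quat^'n) list \<Rightarrow> quat^'n^'n" where
  "osum ws = sum_list (map (\<lambda>w. outer w w) ws)"

lemma osum_Nil [simp]: "osum [] = 0"
  and osum_Cons: "osum (w # ws) = outer w w + osum ws"
  and osum_append: "osum (vs @ ws) = osum vs + osum ws"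
  by (simp_all add: osum_def)

lemma osum_concat: "osum (concat wss) = sum_list (map osum wss)"
  by (induction wss) (simp_all add: osum_append)

lemma osum_conv_sum: "osum ws = (\<Sum>i<length ws. outer (ws!i) (ws!i))"
  by (simp add: osum_def sum_list_sum_nth atLeast0LessThan)

lemma adj_osum: "adj (osum ws) = osum ws"
  by (simp add: osum_conv_sum adj_sum adj_outer)

lemma osum_map: "osum (map ((*v) A) ws) = A ** osum ws ** adj A"
  by (simp add: osum_conv_sum qmult_sum_left qmult_sum_right qmult_outer outer_qmult)

lemma osum_qmv: "osum ws *v x = hcomb ws (\<lambda>i. hinner (ws!i) x)"
  by (simp add: osum_conv_sum hcomb_def qmv_sum_left outer_qmv)

lemma hcomb_cong: "(\<And>i. i < length vs \<Longrightarrow> c i = d i) \<Longrightarrow> hcomb vs c = hcomb vs d"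
  by (simp add: hcomb_def)

lemma hcomb_add: "hcomb vs (\<lambda>i. c i + d i) = hcomb vs c + hcomb vs d"
  and hcomb_diff: "hcomb vs (\<lambda>i. c i - d i) = hcomb vs c - hcomb vs d"
  by (simp_all add: hcomb_def rscale_add_right sum.distrib sum_subtractf[symmetric]
      Finite_Cartesian_Product.vec_eq_iff algebra_simps)

lemma hcomb_scaleR: "hcomb vs (\<lambda>i. r *\<^sub>R c i) = r *\<^sub>R hcomb vs c"
  by (simp add: hcomb_def rscale_scaleR scaleR_sum_right)

lemma hcomb_rscale: "rscale (hcomb vs c) q = hcomb vs (\<lambda>i. c i * q)"
  by (simp add: hcomb_def rscale_sum rscale_rscale)

lemma hcomb_map: "hcomb (map ((*v) A) vs) c = A *v hcomb vs c"
  by (simp add: hcomb_def qmv_sum qmv_rscale)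

lemma hcomb_single: "i < length vs \<Longrightarrow> hcomb vs (\<lambda>k. if k = i then q else 0) = rscale (vs!i) q"
  by (simp add: hcomb_def if_distrib[where f="rscale _"] cong: if_cong)

lemma hcomb_zero [simp]: "hcomb vs (\<lambda>i. 0) = 0"
  by (simp add: hcomb_def)

section \<open>Quaternionic subspaces and orthonormal bases\<close>

definition hsubspace :: "(quat^'n) set \<Rightarrow> bool" where
  "hsubspace W \<longleftrightarrow> subspace W \<and> (\<forall>x\<in>W. \<forall>q. rscale x q \<in> W)"

lemma hsubspace_hcomb: "hsubspace W \<Longrightarrow> set vs \<subseteq> W \<Longrightarrow> hcomb vs c \<in> W"
  unfolding hcomb_def hsubspace_def by (metis (no_types, lifting) subspace_sum lessThan_iff nth_mem subsetD)

lemma hsubspace_range_hcomb: "hsubspace (range (hcomb vs))"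
  unfolding hsubspace_def
proof (intro conjI ballI allI)
  show "subspace (range (hcomb vs))"
  proof (rule subspaceI)
    show "0 \<in> range (hcomb vs)" by (metis hcomb_zero rangeI)
    show "x + y \<in> range (hcomb vs)" if "x \<in> range (hcomb vs)" "y \<in> range (hcomb vs)" for x y
      using that by (auto simp: hcomb_add[symmetric])
    show "r *\<^sub>R x \<in> range (hcomb vs)" if "x \<in> range (hcomb vs)" for r x
      using that by (auto simp: hcomb_scaleR[symmetric])
  qed
qed (auto simp: hcomb_rscale)

lemma set_subset_range_hcomb: "set vs \<subseteq> range (hcomb vs)"
proof
  fix x assume "x \<in> set vs"
  then obtain i where "i < length vs" "x = vs!i" by (auto simp: in_set_conv_nth)
  then have "x = hcomb vs (\<lambda>k. if k = i then 1 else 0)" by (simp add: hcomb_single)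
  then show "x \<in> range (hcomb vs)" by simp
qed

definition hortho :: "(quat^'n) list \<Rightarrow> bool" where
  "hortho ws \<longleftrightarrow> (\<forall>i<length ws. \<forall>j<length ws. hinner (ws!i) (ws!j) = (if i = j then 1 else 0))"

lemma hinner_hcomb:
  assumes "hortho ws" "i < length ws" shows "hinner (ws!i) (hcomb ws c) = c i"
proof -
  have "hinner (ws!i) (hcomb ws c) = (\<Sum>j<length ws. if i = j then c i else 0)"
    unfolding hcomb_def hinner_sum_right hinner_rscale_right
    using assms by (intro sum.cong) (auto simp: hortho_def)
  then show ?thesis using assms by simp
qed

lemma hortho_hbasis: "hortho ws \<Longrightarrow> hbasis (range (hcomb ws)) ws"
  unfolding hbasis_def by (metis hinner_0_right hinner_hcomb)

lemma hortho_length: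
  fixes ws :: "(quat^'n) list"
  assumes "hortho ws" shows "length ws \<le> DIM(quat^'n)"
proof -
  have o: "inner (ws!i) (ws!j) = (if i = j then 1 else 0)" if "i < length ws" "j < length ws" for i j
    using assms that unfolding hortho_def q1_hinner[symmetric] by (auto simp: one_quat_def)
  then have "distinct ws" unfolding distinct_conv_nth by (metis zero_neq_one)
  moreover have "independent (set ws)"
  proof (rule pairwise_orthogonal_independent)
    show "pairwise real_inner_class.orthogonal (set ws)"
      unfolding pairwise_def real_inner_class.orthogonal_def by (metis in_set_conv_nth o)
    show "0 \<notin> set ws" by (metis in_set_conv_nth inner_zero_left o zero_neq_one)
  qed
  ultimately show ?thesis using independent_bound_general[of "set ws"] by (metis distinct_card dim_UNIV order_trans dim_subset_UNIV independent_bound)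
qed

text \<open>An orthonormal list of maximal length in W spans W, since the normalised remainder of a
  missed vector could be appended; \<open>hortho_length\<close> bounds the lengths.\<close>

lemma hortho_basis_exists:
  fixes W :: "(quat^'n) set"
  assumes W: "hsubspace W" obtains ws where "hortho ws" "W = range (hcomb ws)"
proof -
  let ?P = "\<lambda>ws. hortho ws \<and> set ws \<subseteq> W"
  have "?P []" by (simp add: hortho_def)
  then obtain ws where ws: "?P ws" and max: "\<And>vs. ?P vs \<Longrightarrow> length vs \<le> length ws"
    using ex_has_greatest_nat[of ?P "[]" length "DIM(quat^'n) + 1"] hortho_length
    by (metis le_imp_less_Suc less_imp_le_nat Suc_eq_plus1)
  have "x \<in> range (hcomb ws)" if "x \<in> W" for x
  proof (rule ccontr)
    assume x: "x \<notin> range (hcomb ws)"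
    define y where "y = x - osum ws *v x"
    have y0: "y \<noteq> 0" using x by (auto simp: y_def osum_qmv)
    have yW: "y \<in> W" using that W ws hsubspace_hcomb[OF W]
      by (auto simp: y_def osum_qmv hsubspace_def intro: subspace_diff)
    have orth: "hinner (ws!i) y = 0" if "i < length ws" for i
      using ws that by (simp add: y_def hinner_diff_right osum_qmv hinner_hcomb)
    define z where "z = (1 / norm y) *\<^sub>R y"
    have zW: "z \<in> W" using yW W by (simp add: z_def hsubspace_def subspace_scale)
    have z1: "hinner z z = 1" using y0 by (simp add: hinner_self z_def)
    have oz: "hinner (ws!i) z = 0" "hinner z (ws!i) = 0" if "i < length ws" for i
      using orth[OF that] hinner_cnj[of "ws!i" y]
      by (simp_all add: z_def hinner_scaleR_right hinner_scaleR_left)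
    have "hortho (ws @ [z])"
      using ws z1 oz unfolding hortho_def by (auto simp: nth_append less_Suc_eq)
    then have "length (ws @ [z]) \<le> length ws" using zW ws by (intro max) auto
    then show False by simp
  qed
  then have "W = range (hcomb ws)" using ws hsubspace_hcomb[OF W] by blast
  then show ?thesis using that ws by blast
qed

lemma hbasis_hsubspace: "hbasis W vs \<Longrightarrow> hsubspace W"
  using hsubspace_range_hcomb by (auto simp: hbasis_def)

lemma hbasis_exists: "hsubspace W \<Longrightarrow> \<exists>vs. hbasis W vs"
  by (metis hortho_basis_exists hortho_hbasis)

lemma hbasis_coords_unique:
  assumes "hbasis W vs" "hcomb vs c = hcomb vs d" "i < length vs" shows "c i = d i"
proof -
  have "hcomb vs (\<lambda>i. c i - d i) = 0" using assms(2) by (simp add: hcomb_diff)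
  then have "c i - d i = 0" using assms(1,3) unfolding hbasis_def by blast
  then show ?thesis by simp
qed

section \<open>Real and quaternionic dimension\<close>

lemma DIM_quat: "DIM(quat) = 4"
  by (simp add: Basis_quat_def)

text \<open>The basis vectors multiplied by the four units form a real basis. So the length of a
  quaternionic basis is determined by W, and all dimension counts can be done over the
  reals.\<close>

lemma hbasis_dim:
  assumes "hbasis W vs" shows "dim W = 4 * length vs"
proof -
  let ?I = "{..<length vs} \<times> (Basis :: quat set)"
  let ?f = "\<lambda>(i, b). rscale (vs!i) b"
  have comb: "(\<Sum>p\<in>?I. u p *\<^sub>R ?f p) = hcomb vs (\<lambda>i. \<Sum>b\<in>Basis. u (i, b) *\<^sub>R b)" for u
    unfolding hcomb_def rscale_sum_right rscale_scaleR sum.cartesian_product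
    by (rule sum.cong) auto
  have indep: "u (i, b) = 0" if "(\<Sum>p\<in>?I. u p *\<^sub>R ?f p) = 0" "i < length vs" "b \<in> Basis" for u i b
  proof -
    have "(\<Sum>b\<in>Basis. u (i, b) *\<^sub>R b) = 0" using assms that by (auto simp: comb hbasis_def)
    then have "(\<Sum>b\<in>Basis. u (i, b) *\<^sub>R b) \<bullet> b = 0" by simp
    then show ?thesis using that(3) by simp
  qed
  have inj: "inj_on ?f ?I"
  proof (rule inj_onI, rule ccontr)
    fix p q assume pq: "p \<in> ?I" "q \<in> ?I" "?f p = ?f q" "p \<noteq> q"
    define u where "u = (\<lambda>r. (if r = p then 1 else 0) - (if r = q then (1::real) else 0))"
    have "(\<Sum>r\<in>?I. u r *\<^sub>R ?f r) = (\<Sum>r\<in>?I. (if r = p then ?f p else 0) - (if r = q then ?f q else 0))"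
      by (rule sum.cong) (auto simp: u_def)
    also have "\<dots> = 0" using pq by (simp add: sum_subtractf)
    finally have "u (fst p, snd p) = 0" using pq by (intro indep) auto
    then show False using pq by (simp add: u_def)
  qed
  have "independent (?f ` ?I)"
  proof (rule independent_if_scalars_zero)
    fix g x assume g: "(\<Sum>x\<in>?f ` ?I. g x *\<^sub>R x) = 0" and x: "x \<in> ?f ` ?I"
    have "(\<Sum>p\<in>?I. g (?f p) *\<^sub>R ?f p) = 0" using g by (simp add: sum.reindex[OF inj])
    then show "g x = 0" using x indep[of "\<lambda>p. g (?f p)"] by auto
  qed simp
  moreover have "span (?f ` ?I) = W"
  proof
    have sub: "subspace W" using hbasis_hsubspace[OF assms] by (simp add: hsubspace_def)
    have "?f ` ?I \<subseteq> W" using assms unfolding hbasis_def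
      by (auto simp: hcomb_single[symmetric])
    then show "span (?f ` ?I) \<subseteq> W" using sub by (rule span_minimal)
    show "W \<subseteq> span (?f ` ?I)"
    proof
      fix x assume "x \<in> W"
      then obtain c where "x = hcomb vs c" using assms by (auto simp: hbasis_def)
      then have "x = (\<Sum>p\<in>?I. (c (fst p) \<bullet> snd p) *\<^sub>R ?f p)" by (simp add: comb euclidean_representation)
      also have "\<dots> \<in> span (?f ` ?I)" by (intro span_sum span_scale span_base imageI)
      finally show "x \<in> span (?f ` ?I)" .
    qed
  qed
  ultimately have "dim W = card (?f ` ?I)" by (metis dim_span_eq_card_independent)
  also have "\<dots> = 4 * length vs" by (simp add: card_image[OF inj] card_cartesian_product DIM_quat)
  finally show ?thesis .
qed

lemma hdim_eq: "hbasis W vs \<Longrightarrow> hdim W = length vs"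
  unfolding hdim_def
proof (rule the_equality)
  fix m assume "hbasis W vs" "\<exists>vs. hbasis W vs \<and> length vs = m"
  then show "m = length vs" by (metis hbasis_dim mult_left_cancel zero_neq_numeral)
qed blast

lemma hdim_dim: "hsubspace W \<Longrightarrow> 4 * hdim W = dim W"
  using hbasis_exists hdim_eq hbasis_dim by metis

text \<open>The choice of the orthonormal basis is immaterial by \<open>proj_osum\<close>.\<close>

definition proj :: "(quat^'n) set \<Rightarrow> quat^'n^'n" where
  "proj W = osum (SOME ws. hortho ws \<and> W = range (hcomb ws))"

text \<open>W contains the right multiple of x by q = \<open>hinner x z\<close>, and real
  orthogonality to that vector says that the norm of q is 0.\<close>

lemma hsubspace_orthogonal:
  assumes "hsubspace W" "x \<in> W" "\<And>w. w \<in> W \<Longrightarrow> inner w z = 0"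
  shows "hinner x z = 0"
proof -
  have "q1 (hinner (rscale x (hinner x z)) z) = 0"
    using assms by (simp add: q1_hinner hsubspace_def)
  then show ?thesis unfolding hinner_rscale_left inner_quat_eq[symmetric] by simp
qed

lemma proj_basis:
  assumes "hsubspace W" obtains ws where "hortho ws" "W = range (hcomb ws)" "proj W = osum ws"
  using hortho_basis_exists[OF assms] unfolding proj_def by (metis (mono_tags, lifting) someI_ex)

lemma proj_in: "hsubspace W \<Longrightarrow> proj W *v x \<in> W"
  by (metis proj_basis osum_qmv rangeI)

lemma proj_id: assumes "hsubspace W" "x \<in> W" shows "proj W *v x = x"
proof -
  obtain ws where ws: "hortho ws" "W = range (hcomb ws)" "proj W = osum ws" using proj_basis[OF assms(1)] .
  obtain c where "x = hcomb ws c" using ws assms by auto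
  then show ?thesis using ws by (auto simp: osum_qmv hinner_hcomb intro: hcomb_cong)
qed

lemma adj_proj: "hsubspace W \<Longrightarrow> adj (proj W) = proj W"
  by (metis proj_basis adj_osum)

lemma proj_ortho: assumes "hsubspace W" "w \<in> W" shows "inner w (x - proj W *v x) = 0"
  using inner_qmv[of "proj W" w x] adj_proj[OF assms(1)] proj_id[OF assms] by (simp add: inner_diff_right)

lemma proj_unique:
  assumes "hsubspace W" "\<And>x. x \<in> W \<Longrightarrow> P *v x = x" "\<And>x. (\<And>w. w \<in> W \<Longrightarrow> inner w x = 0) \<Longrightarrow> P *v x = 0"
  shows "P = proj W"
  unfolding matrix_eq
proof
  fix x
  have "P *v (x - proj W *v x) = 0" using assms(1) by (intro assms(3)) (rule proj_ortho)
  then show "P *v x = proj W *v x" using assms(2)[OF proj_in[OF assms(1)]] by (simp add: qmv_diff)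
qed

lemma proj_osum:
  assumes "hortho ws" "W = range (hcomb ws)" shows "proj W = osum ws"
proof (rule proj_unique[symmetric])
  show W: "hsubspace W" using assms(2) hsubspace_range_hcomb by simp
  show "osum ws *v x = x" if "x \<in> W" for x
    using that assms by (auto simp: osum_qmv hinner_hcomb intro: hcomb_cong)
  fix x assume "\<And>w. w \<in> W \<Longrightarrow> inner w x = 0"
  then have "hinner (ws!i) x = 0" if "i < length ws" for i
    using assms(2) set_subset_range_hcomb[of ws] that by (intro hsubspace_orthogonal[OF W]) auto
  then show "osum ws *v x = 0" unfolding osum_qmv by (metis (no_types, lifting) hcomb_cong hcomb_zero)
qed

text \<open>The real part is taken because the quaternionic trace is not cyclic; with it the inner
  product of matrices is Re tr (A* B), see \<open>inner_matrix_rtrace\<close>.\<close>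

definition rtrace :: "quat^'n^'n \<Rightarrow> real" where
  "rtrace A = (\<Sum>i\<in>UNIV. q1 (A$i$i))"

lemma inner_matrix_rtrace: "inner A B = rtrace (adj A ** B)"
  unfolding inner_vec_def rtrace_def inner_quat_eq adj_def matrix_matrix_mult_def
  by (simp add: q1_sum) (rule sum.swap)

lemma linear_rtrace: "linear rtrace"
  by (rule linearI) (simp_all add: rtrace_def sum.distrib scaleR_quat_def sum_distrib_left)

lemma rtrace_outer: "rtrace (outer x x) = (norm x)\<^sup>2"
  by (simp add: rtrace_def outer_def quat_cnj_mult_self scaleR_quat_def one_quat_def norm_vec_def
      L2_set_def sum_nonneg)

lemma rtrace_proj: assumes "hsubspace W" shows "rtrace (proj W) = dim W / 4"
proof -
  obtain ws where ws: "hortho ws" "W = range (hcomb ws)" "proj W = osum ws" using proj_basis[OF assms] .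
  have "(norm (ws!i))\<^sup>2 = 1" if "i < length ws" for i
    using ws(1) that by (auto simp: power2_norm_eq_inner q1_hinner[symmetric] hortho_def one_quat_def)
  then have "rtrace (osum ws) = length ws"
    by (simp add: osum_conv_sum linear_sum[OF linear_rtrace] rtrace_outer)
  moreover have "dim W = 4 * length ws" using ws hortho_hbasis hbasis_dim by blast
  ultimately show ?thesis using ws by simp
qed

lemma proj_idem: "hsubspace W \<Longrightarrow> proj W ** proj W = proj W"
  by (simp add: matrix_eq matrix_vector_mul_assoc[symmetric] proj_id proj_in)

lemma norm_proj: assumes "hsubspace W" shows "(norm (proj W))\<^sup>2 = dim W / 4"
  using assms by (simp add: power2_norm_eq_inner inner_matrix_rtrace adj_proj proj_idem rtrace_proj)

text \<open>The difference R of the two projections is again a Hermitian idempotent, because Q maps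
  into W. Its squared norm is its trace, which is 0 by the equality of ranks.\<close>

lemma hermitian_idempotent_eq_proj:
  assumes W: "hsubspace W" and Q: "adj Q = Q" "Q ** Q = Q" "rtrace Q = dim W / 4"
    and r: "\<And>x. Q *v x \<in> W"
  shows "Q = proj W"
proof -
  have PQ: "proj W ** Q = Q" by (simp add: matrix_eq matrix_vector_mul_assoc[symmetric] proj_id[OF W r])
  then have QP: "Q ** proj W = Q" by (metis Q(1) W adj_mult adj_proj)
  let ?R = "proj W - Q"
  have "adj ?R ** ?R = ?R"
    by (simp add: adj_diff adj_proj W Q qmult_diff_left qmult_diff_right PQ QP proj_idem)
  moreover have "rtrace ?R = 0" by (simp add: linear_diff[OF linear_rtrace] rtrace_proj W Q)
  ultimately have "inner ?R ?R = 0" by (simp add: inner_matrix_rtrace)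
  then show ?thesis by simp
qed

text \<open>For the projections and the square roots this reduces continuity to a bound and an
  identification of the limit points.\<close>

lemma LIMSEQ_unique_cluster:
  fixes f :: "nat \<Rightarrow> 'a::heine_borel"
  assumes b: "bounded (range f)" and u: "\<And>r Q. strict_mono r \<Longrightarrow> (f \<circ> r) \<longlonglongrightarrow> Q \<Longrightarrow> Q = L"
  shows "f \<longlonglongrightarrow> L"
proof (rule ccontr)
  assume "\<not> f \<longlonglongrightarrow> L"
  then obtain e where e: "e > 0" "\<not> (\<forall>\<^sub>F n in sequentially. dist (f n) L < e)"
    unfolding tendsto_iff by blast
  then have inf: "infinite {n. \<not> dist (f n) L < e}"
    unfolding eventually_sequentially infinite_nat_iff_unbounded_le by blast
  define r where "r = enumerate {n. \<not> dist (f n) L < e}"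
  have r: "strict_mono r" "\<And>n. \<not> dist (f (r n)) L < e"
    using inf strict_mono_enumerate enumerate_in_set unfolding r_def by blast+
  have "bounded (range (f \<circ> r))" using b by (rule bounded_subset) auto
  then obtain Q s where s: "strict_mono s" "((f \<circ> r) \<circ> s) \<longlonglongrightarrow> Q"
    using bounded_imp_convergent_subsequence by blast
  have "Q = L" using r(1) s by (intro u[of "r \<circ> s"]) (simp_all add: strict_mono_o o_assoc)
  then have "\<forall>\<^sub>F n in sequentially. dist (f (r (s n))) L < e" using s(2) e(1) unfolding tendsto_iff by simp
  then show False using r(2) by (auto simp: eventually_sequentially)
qed

text \<open>The projections stay in a compact set, and each of their limit points is an orthogonal projection
  into W a, of the right rank by the trace.\<close>

lemma continuous_on_proj:
  fixes W :: "'a::metric_space \<Rightarrow> (quat^'n) set"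
  assumes W: "\<And>a. a \<in> S \<Longrightarrow> hsubspace (W a)" and d: "\<And>a. a \<in> S \<Longrightarrow> dim (W a) = m"
    and closed: "\<And>a s x z. a \<in> S \<Longrightarrow> (\<And>n. s n \<in> S) \<Longrightarrow> s \<longlonglongrightarrow> a \<Longrightarrow> (\<And>n. x n \<in> W (s n)) \<Longrightarrow>
      x \<longlonglongrightarrow> z \<Longrightarrow> z \<in> W a"
  shows "continuous_on S (\<lambda>a. proj (W a))"
  unfolding continuous_on_sequentially
proof (intro allI ballI impI, elim conjE)
  fix s a assume a: "a \<in> S" and s: "\<forall>n. s n \<in> S" "s \<longlonglongrightarrow> a"
  let ?P = "\<lambda>n. proj (W (s n))"
  have WS: "hsubspace (W (s n))" for n using W s by blast
  have "norm (?P n) \<le> sqrt (m / 4)" for n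
    by (rule real_le_rsqrt) (simp add: norm_proj WS d s)
  then have b: "bounded (range ?P)" by (auto simp: bounded_iff)
  have "?P \<longlonglongrightarrow> proj (W a)"
  proof (rule LIMSEQ_unique_cluster[OF b])
    fix r :: "nat \<Rightarrow> nat" and Q assume r: "strict_mono r" and Q: "(?P \<circ> r) \<longlonglongrightarrow> Q"
    then have Q': "(\<lambda>n. ?P (r n)) \<longlonglongrightarrow> Q" by (simp add: o_def)
    have eq: "l = l'" if "f \<longlonglongrightarrow> l" "g \<longlonglongrightarrow> l'" "\<And>n. f n = g n" for f g :: "nat \<Rightarrow> 'z::t2_space" and l l'
      using that LIMSEQ_unique by (metis ext)
    show "Q = proj (W a)"
    proof (rule hermitian_idempotent_eq_proj[OF W[OF a]])
      show "adj Q = Q" by (rule eq[OF tendsto_adj[OF Q'] Q']) (simp add: adj_proj WS)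
      show "Q ** Q = Q" by (rule eq[OF tendsto_qmult[OF Q' Q'] Q']) (simp add: proj_idem WS)
      have "bounded_linear (rtrace :: quat^'n^'n \<Rightarrow> real)" using linear_rtrace linear_conv_bounded_linear by blast
      from bounded_linear.tendsto[OF this Q'] show "rtrace Q = dim (W a) / 4"
        by (rule eq[OF _ tendsto_const]) (simp add: rtrace_proj WS d s a)
      fix x
      show "Q *v x \<in> W a"
      proof (rule closed[OF a])
        show "(s \<circ> r) \<longlonglongrightarrow> a" using s(2) r by (rule LIMSEQ_subseq_LIMSEQ)
        show "(\<lambda>n. ?P (r n) *v x) \<longlonglongrightarrow> Q *v x" by (intro tendsto_qmv Q' tendsto_const)
      qed (use s WS in \<open>auto intro: proj_in\<close>)
    qed
  qed
  then show "((\<lambda>a. proj (W a)) \<circ> s) \<longlonglongrightarrow> proj (W a)" by (simp add: o_def)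
qed

subsection \<open>Positive definite matrices\<close>

definition posdef :: "quat^'n^'n \<Rightarrow> bool" where
  "posdef A \<longleftrightarrow> adj A = A \<and> (\<forall>x. x \<noteq> 0 \<longrightarrow> 0 < inner x (A *v x))"

lemma posdef_one: "posdef (mat 1)"
  by (simp add: posdef_def)

lemma posdef_add: "posdef A \<Longrightarrow> posdef B \<Longrightarrow> posdef (A + B)"
  by (simp add: posdef_def adj_add matrix_vector_mult_add_rdistrib inner_add_right add_pos_pos)

lemma posdef_scaleR: "posdef A \<Longrightarrow> r > 0 \<Longrightarrow> posdef (r *\<^sub>R A)"
  by (simp add: posdef_def adj_scaleR qmv_scaleR_left)

text \<open>Serves twice: the convex hull of the forms k* k stays positive definite, and so does the
  segment from 1 to the square root along which the orbit is deformed.\<close>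

lemma convex_posdef: "convex (Collect posdef :: (quat^'n^'n) set)"
  unfolding convex_alt
proof safe
  fix A B :: "quat^'n^'n" and u :: real assume "posdef A" "posdef B" "0 \<le> u" "u \<le> 1"
  then show "posdef ((1 - u) *\<^sub>R A + u *\<^sub>R B)"
    by (cases "u = 0"; cases "u = 1") (auto intro!: posdef_add posdef_scaleR)
qed

lemma posdef_invertible: "posdef A \<Longrightarrow> invertible A"
  unfolding invertible_iff_ker posdef_def by (metis inner_zero_right less_irrefl)

lemma posdef_adj_mult: "invertible g \<Longrightarrow> posdef (adj g ** g)" for g :: "quat^'n^'n"
  unfolding posdef_def invertible_iff_ker
  by (auto simp: adj_mult matrix_vector_mul_assoc[symmetric] inner_qmv[symmetric])

lemma invertible_adj: "invertible g \<Longrightarrow> invertible (adj g)" for g :: "quat^'n^'n"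
  by (metis adj_mult adj_one invertible_def)

lemma posdef_mult_adj: "invertible g \<Longrightarrow> posdef (g ** adj g)" for g :: "quat^'n^'n"
  using posdef_adj_mult[of "adj g"] by (simp add: invertible_adj)

lemma posdef_lower_bound:
  fixes A :: "quat^'n^'n"
  assumes "posdef A" obtains m where "m > 0" "\<And>x. m * (norm x)\<^sup>2 \<le> inner x (A *v x)"
proof -
  let ?S = "sphere (0 :: quat^'n) 1"
  have cont: "continuous_on ?S (\<lambda>x. inner x (A *v x))"
    by (intro continuous_intros)
  have "axis undefined 1 \<in> ?S" by (simp add: norm_eq_sqrt_inner inner_axis_axis inner_quat_def one_quat_def)
  then have "?S \<noteq> {}" by blast
  then obtain z where z: "z \<in> ?S" "\<And>x. x \<in> ?S \<Longrightarrow> inner z (A *v z) \<le> inner x (A *v x)"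
    using continuous_attains_inf[OF compact_sphere _ cont] by blast
  show ?thesis
  proof (rule that[of "inner z (A *v z)"])
    have "z \<noteq> 0" using z(1) by auto
    then show "inner z (A *v z) > 0" using assms by (simp add: posdef_def)
    fix x :: "quat^'n"
    show "inner z (A *v z) * (norm x)\<^sup>2 \<le> inner x (A *v x)"
    proof (cases "x = 0")
      case False
      have x: "norm x *\<^sub>R sgn x = x" by (simp add: sgn_div_norm False)
      have "inner (norm x *\<^sub>R sgn x) (A *v (norm x *\<^sub>R sgn x)) = (norm x)\<^sup>2 * inner (sgn x) (A *v sgn x)"
        by (simp add: qmv_scaleR power2_eq_square)
      then have "inner x (A *v x) = (norm x)\<^sup>2 * inner (sgn x) (A *v sgn x)" unfolding x .
      moreover have "inner z (A *v z) \<le> inner (sgn x) (A *v sgn x)"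
        using False by (intro z(2)) (simp add: norm_sgn)
      ultimately show ?thesis by (simp add: mult.commute[of _ "(norm x)\<^sup>2"] mult_left_mono)
    qed simp
  qed
qed

text \<open>If Y solves 2 Y = B + Y Y, then 1 - Y is a square root of 1 - B.\<close>

lemma sqrt_fixed_point:
  fixes B :: "quat^'n^'n"
  assumes B: "adj B = B" and b: "\<And>x. norm (B *v x) \<le> b * norm x" "0 \<le> b" "b < 1"
  obtains Y r where "adj Y = Y" "r < 1" "\<And>x. norm (Y *v x) \<le> r * norm x" "2 *\<^sub>R Y = B + Y ** Y"
proof -
  \<comment> \<open>The smaller root of r^2 - 2 r + b = 0: then (b + r r)/2 = r, so the ball of
    radius r is preserved, and r is also the contraction factor.\<close>
  define r where "r = 1 - sqrt (1 - b)"
  have r: "0 \<le> r" "r < 1" "r * r = 2 * r - b"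
    using b(2,3) by (simp_all add: r_def algebra_simps)
  \<comment> \<open>Right linearity and symmetry are closed conditions preserved by the iteration,
    so the fixed point is again a Hermitian quaternionic matrix.\<close>
  define S where "S = {F :: (quat^'n) \<Rightarrow>\<^sub>L (quat^'n). norm F \<le> r \<and>
    (\<forall>x q. blinfun_apply F (rscale x q) = rscale (blinfun_apply F x) q) \<and>
    (\<forall>x y. inner (blinfun_apply F x) y = inner x (blinfun_apply F y))}"
  let ?B = "Blinfun ((*v) B)"
  have bl: "bounded_linear ((*v) B)" using linear_qmv linear_conv_bounded_linear by blast
  have Bx: "blinfun_apply ?B x = B *v x" for x by (simp add: bounded_linear_Blinfun_apply bl)
  have nB: "norm ?B \<le> b" using b by (intro norm_blinfun_bound) (simp_all add: Bx)
  define f where "f = (\<lambda>F. (1/2) *\<^sub>R (?B + (F o\<^sub>L F)))"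
  have fx: "blinfun_apply (f F) x = (1/2) *\<^sub>R (B *v x + blinfun_apply F (blinfun_apply F x))" for F x
    by (simp add: f_def blinfun.bilinear_simps Bx)
  have "\<exists>!F. F \<in> S \<and> f F = F"
  proof (rule Banach_fix)
    have cr: "continuous_on UNIV (\<lambda>F::(quat^'n) \<Rightarrow>\<^sub>L (quat^'n). rscale (blinfun_apply F x) q)" for x q
      using linear_rscale linear_conv_bounded_linear
      by (intro bounded_linear.continuous_on[of "\<lambda>x. rscale x q"] continuous_intros) blast
    have "closed S"
      unfolding S_def by (intro closed_Collect_conj closed_Collect_all closed_Collect_le closed_Collect_eq
          continuous_intros cr)
    then show "complete S" by (simp add: complete_eq_closed)
    show "S \<noteq> {}" using r by (auto simp: S_def intro!: exI[of _ 0])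
    show "f ` S \<subseteq> S"
    proof (rule image_subsetI)
      fix F assume F: "F \<in> S"
      have "norm (f F) \<le> (1/2) * (b + norm F * norm F)"
        unfolding f_def using nB norm_blinfun_compose[of F F]
        by (simp add: order_trans[OF norm_triangle_ineq] add_mono)
      also have "\<dots> \<le> (1/2) * (b + r * r)" using F r by (intro mult_left_mono add_left_mono mult_mono) (auto simp: S_def)
      also have "\<dots> = r" using r by simp
      finally show "f F \<in> S"
        using F B unfolding S_def
        by (auto simp: fx qmv_rscale rscale_add rscale_scaleR inner_add_left inner_add_right inner_qmv)
    qed
    show "dist (f F) (f G) \<le> r * dist F G" if "F \<in> S" "G \<in> S" for F G
    proof -
      have "f F - f G = (1/2) *\<^sub>R ((F o\<^sub>L (F - G)) + ((F - G) o\<^sub>L G))"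
        by (rule blinfun_eqI) (simp add: fx blinfun.bilinear_simps scaleR_diff_right[symmetric])
      then have "norm (f F - f G) \<le> (1/2) * (norm (F o\<^sub>L (F - G)) + norm ((F - G) o\<^sub>L G))"
        by (simp add: norm_triangle_ineq)
      also have "\<dots> \<le> (1/2) * (norm F * norm (F - G) + norm (F - G) * norm G)"
        using norm_blinfun_compose by (intro mult_left_mono add_mono) auto
      also have "\<dots> \<le> (1/2) * (r * norm (F - G) + norm (F - G) * r)"
        using that by (intro mult_left_mono add_mono mult_right_mono) (auto simp: S_def)
      finally show ?thesis by (simp add: dist_norm mult.commute)
    qed
  qed (use r in auto)
  then obtain F where F: "F \<in> S" "f F = F" by blast
  define Y where "Y = matrix (blinfun_apply F)"
  have Y: "Y *v x = blinfun_apply F x" for x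
    unfolding Y_def using F
    by (intro right_linear_matrix bounded_linear.linear[OF blinfun.bounded_linear_right]) (auto simp: S_def)
  show ?thesis
  proof (rule that)
    have "inner x (adj Y *v y - Y *v y) = 0" for x y
      using F by (simp add: inner_diff_right inner_qmv[symmetric] Y S_def)
    then have "adj Y *v y - Y *v y = 0" for y by (metis inner_eq_zero_iff)
    then show "adj Y = Y" by (simp add: matrix_eq)
    show "r < 1" by (rule r)
    show "norm (Y *v x) \<le> r * norm x" for x
    proof -
      have "norm F \<le> r" using F by (simp add: S_def)
      then show ?thesis unfolding Y by (meson mult_right_mono norm_blinfun norm_ge_zero order_trans)
    qed
    have "2 *\<^sub>R blinfun_apply F x = B *v x + blinfun_apply F (blinfun_apply F x)" for x
    proof -
      have "2 *\<^sub>R blinfun_apply (f F) x = B *v x + blinfun_apply F (blinfun_apply F x)" unfolding fx by simp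
      then show ?thesis unfolding F(2) .
    qed
    then show "2 *\<^sub>R Y = B + Y ** Y"
      by (simp add: matrix_eq qmv_scaleR_left matrix_vector_mult_add_rdistrib matrix_vector_mul_assoc[symmetric] Y)
  qed
qed

lemma norm_diff_square: "(norm (x - y))\<^sup>2 = (norm x)\<^sup>2 - 2 * inner x y + (norm y)\<^sup>2"
  for x y :: "'a::real_inner"
  by (simp add: power2_norm_eq_inner inner_diff_left inner_diff_right inner_commute)

lemma posdef_sqrt_exists:
  fixes M :: "quat^'n^'n"
  assumes M: "posdef M" obtains p where "posdef p" "p ** p = M"
proof -
  obtain m where m: "m > 0" "\<And>x. m * (norm x)\<^sup>2 \<le> inner x (M *v x)" using posdef_lower_bound[OF M] by blast
  have "bounded_linear ((*v) M)" using linear_qmv linear_conv_bounded_linear by blast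
  then obtain C where C: "C > 0" "\<And>x. norm (M *v x) \<le> norm x * C"
    using bounded_linear.pos_bounded by blast
  \<comment> \<open>The first summand makes |M x|^2 / c^2 \<le> (m / c) |x|^2, so that B = 1 - M / c
    satisfies |B x|^2 \<le> (1 - m / c) |x|^2; the second ensures m \<le> c.\<close>
  define c where "c = C * C / m + m"
  have c: "c > 0" "C * C \<le> m * c" "m \<le> c" using m C by (simp_all add: c_def field_simps add_pos_pos)
  define B where "B = mat 1 - (1 / c) *\<^sub>R M"
  have Bx: "B *v x = x - (1/c) *\<^sub>R (M *v x)" for x
    by (simp add: B_def matrix_vector_mult_diff_rdistrib qmv_scaleR_left)
  define b where "b = sqrt (1 - m / c)"
  have b01: "0 \<le> b" "b < 1" using c m by (simp_all add: b_def)
  have bB: "norm (B *v x) \<le> b * norm x" for x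
  proof (rule power2_le_imp_le)
    have "(norm (B *v x))\<^sup>2 = (norm x)\<^sup>2 - 2 / c * inner x (M *v x) + (norm (M *v x))\<^sup>2 / c\<^sup>2"
      unfolding Bx norm_diff_square using c by (simp add: power_divide)
    also have "\<dots> \<le> (norm x)\<^sup>2 - 2 / c * (m * (norm x)\<^sup>2) + m / c * (norm x)\<^sup>2"
    proof -
      have "(norm (M *v x))\<^sup>2 \<le> (norm x * C)\<^sup>2" using C by (intro power_mono) auto
      also have "\<dots> \<le> (norm x)\<^sup>2 * (m * c)" 
        using mult_left_mono[OF c(2), of "(norm x)\<^sup>2"] by (simp add: power_mult_distrib power2_eq_square mult_ac)
      finally have "(norm (M *v x))\<^sup>2 / c\<^sup>2 \<le> (norm x)\<^sup>2 * (m * c) / c\<^sup>2" by (rule divide_right_mono) simp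
      also have "\<dots> = m / c * (norm x)\<^sup>2" using c by (simp add: power2_eq_square)
      finally have 1: "(norm (M *v x))\<^sup>2 / c\<^sup>2 \<le> m / c * (norm x)\<^sup>2" .
      have "2 / c * (m * (norm x)\<^sup>2) \<le> 2 / c * inner x (M *v x)" using m c by (intro mult_left_mono) auto
      from add_mono[OF diff_left_mono[OF this] 1] show ?thesis .
    qed
    also have "\<dots> = (b * norm x)\<^sup>2"
      using c m by (simp add: b_def power_mult_distrib algebra_simps)
    finally show "(norm (B *v x))\<^sup>2 \<le> (b * norm x)\<^sup>2" .
  qed (use b01 in simp)
  have "adj B = B" using M by (simp add: B_def adj_diff adj_scaleR posdef_def)
  then obtain Y r where Y: "adj Y = Y" "r < 1" "\<And>x. norm (Y *v x) \<le> r * norm x" "2 *\<^sub>R Y = B + Y ** Y"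
    using sqrt_fixed_point bB b01 by blast
  show ?thesis
  proof (rule that)
    have "0 < inner x ((mat 1 - Y) *v x)" if "x \<noteq> 0" for x
    proof -
      have "inner x (Y *v x) \<le> norm x * (r * norm x)"
        using Y(3)[of x] norm_cauchy_schwarz[of x "Y *v x"] by (meson mult_left_mono norm_ge_zero order_trans)
      also have "\<dots> < norm x * (1 * norm x)" using Y(2) that by (intro mult_strict_left_mono mult_strict_right_mono) auto
      finally show ?thesis by (simp add: matrix_vector_mult_diff_rdistrib inner_diff_right norm_eq_sqrt_inner)
    qed
    then have "posdef (mat 1 - Y)" using Y(1) by (simp add: posdef_def adj_diff)
    then show "posdef (sqrt c *\<^sub>R (mat 1 - Y))" using c by (simp add: posdef_scaleR)
    have "(mat 1 - Y) ** (mat 1 - Y) = mat 1 - 2 *\<^sub>R Y + Y ** Y"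
      by (simp add: qmult_diff_left qmult_diff_right scaleR_2)
    also have "\<dots> = (1 / c) *\<^sub>R M" by (simp add: Y(4) B_def)
    finally show "sqrt c *\<^sub>R (mat 1 - Y) ** (sqrt c *\<^sub>R (mat 1 - Y)) = M"
      using c by (simp add: qmult_scaleR_left qmult_scaleR_right)
  qed
qed

lemma rtrace_commute: "rtrace (A ** B) = rtrace (B ** A)"
proof -
  have "rtrace (A ** B) = (\<Sum>i\<in>UNIV. \<Sum>k\<in>UNIV. q1 (B$k$i * A$i$k))"
    unfolding rtrace_def matrix_matrix_mult_def by (simp add: q1_sum q1_mult_commute)
  also have "\<dots> = rtrace (B ** A)"
    unfolding rtrace_def matrix_matrix_mult_def by (subst sum.swap) (simp add: q1_sum)
  finally show ?thesis .
qed

lemma inner_matrix_columns: "inner A B = (\<Sum>j\<in>UNIV. inner (column j A) (column j B))"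
  for A B :: "quat^'n^'m"
  unfolding inner_vec_def column_def by (simp, subst sum.swap) simp

text \<open>For D = p - q one has D p + q D = 0. Multiplying by D and taking traces writes 0 as a
  sum of two nonnegative terms, and definiteness of p forces D = 0. q is only semidefinite because
  limits of positive definite roots are a priori only that.\<close>

lemma posdef_sqrt_unique:
  fixes p q :: "quat^'n^'n"
  assumes p: "posdef p" and q: "adj q = q" "\<And>x. 0 \<le> inner x (q *v x)" and e: "p ** p = q ** q"
  shows "p = q"
proof -
  define D where "D = p - q"
  have aD: "adj D = D" using p q by (simp add: D_def adj_diff posdef_def)
  have "D ** p + q ** D = 0" by (simp add: D_def qmult_diff_left qmult_diff_right e)
  then have "rtrace (D ** (D ** p)) + rtrace (D ** (q ** D)) = 0"
    by (metis linear_0 linear_add linear_rtrace qmult_add_right times0_right)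
  then have "inner D (p ** D) + inner D (q ** D) = 0"
    by (metis aD inner_matrix_rtrace matrix_mul_assoc rtrace_commute)
  moreover have "inner D (q ** D) \<ge> 0"
    unfolding inner_matrix_columns column_mult by (intro sum_nonneg q)
  moreover have p0: "0 \<le> inner x (p *v x)" for x using p by (cases "x = 0") (auto simp: posdef_def less_imp_le)
  then have "inner D (p ** D) \<ge> 0"
    unfolding inner_matrix_columns column_mult by (intro sum_nonneg)
  ultimately have "inner D (p ** D) = 0" by linarith
  then have "\<forall>j. inner (column j D) (p *v column j D) = 0"
    unfolding inner_matrix_columns column_mult using p0 by (simp add: sum_nonneg_eq_0_iff)
  then have "column j D = 0" for j using p unfolding posdef_def by (metis less_irrefl)
  then have "D = 0" by (simp add: matrix_eq_columns column_def Finite_Cartesian_Product.vec_eq_iff)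
  then show ?thesis by (simp add: D_def)
qed

definition psqrt :: "quat^'n^'n \<Rightarrow> quat^'n^'n" where
  "psqrt M = (THE p. posdef p \<and> p ** p = M)"

lemma posdef_nonneg: "posdef p \<Longrightarrow> 0 \<le> inner x (p *v x)"
  by (cases "x = 0") (auto simp: posdef_def less_imp_le)

lemma psqrt_square: "posdef p \<Longrightarrow> psqrt (p ** p) = p"
  unfolding psqrt_def
  by (rule the_equality) (auto intro!: posdef_sqrt_unique posdef_nonneg simp: posdef_def)

lemma psqrt: assumes "posdef M" shows "posdef (psqrt M)" "psqrt M ** psqrt M = M"
  using posdef_sqrt_exists[OF assms] psqrt_square by metis+

text \<open>The squared norm of the root of M is the trace of M, so the roots along a convergent
  sequence are bounded; every limit point is a semidefinite root of the limit and hence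
  unique.\<close>

lemma continuous_on_psqrt: "continuous_on (Collect posdef) (psqrt :: quat^'n^'n \<Rightarrow> quat^'n^'n)"
  unfolding continuous_on_sequentially
proof (intro allI ballI impI, elim conjE)
  fix s :: "nat \<Rightarrow> quat^'n^'n" and M
  assume M: "M \<in> Collect posdef" and s: "\<forall>n. s n \<in> Collect posdef" "s \<longlonglongrightarrow> M"
  have ps: "posdef (psqrt (s n))" "psqrt (s n) ** psqrt (s n) = s n" for n using s(1) psqrt by auto
  then have as: "adj (psqrt (s n)) = psqrt (s n)" for n by (simp add: posdef_def)
  have bl: "bounded_linear (rtrace :: quat^'n^'n \<Rightarrow> real)" using linear_rtrace linear_conv_bounded_linear by blast
  have "(\<lambda>n. rtrace (s n)) \<longlonglongrightarrow> rtrace M" using bounded_linear.tendsto[OF bl s(2)] .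
  then have "Bseq (\<lambda>n. rtrace (s n))" by (rule convergent_imp_Bseq[OF convergentI])
  then obtain K where K: "\<And>n. norm (rtrace (s n)) \<le> K" by (auto simp: Bseq_def)
  have "(norm (psqrt (s n)))\<^sup>2 \<le> K" for n
    using K[of n] by (simp add: power2_norm_eq_inner inner_matrix_rtrace as ps)
  then have "norm (psqrt (s n)) \<le> sqrt K" for n by (rule real_le_rsqrt)
  then have b: "bounded (range (\<lambda>n. psqrt (s n)))" by (auto simp: bounded_iff)
  have "(\<lambda>n. psqrt (s n)) \<longlonglongrightarrow> psqrt M"
  proof (rule LIMSEQ_unique_cluster[OF b])
    fix r :: "nat \<Rightarrow> nat" and Q assume r: "strict_mono r" and "((\<lambda>n. psqrt (s n)) \<circ> r) \<longlonglongrightarrow> Q"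
    then have Q: "(\<lambda>n. psqrt (s (r n))) \<longlonglongrightarrow> Q" by (simp add: o_def)
    have "adj Q = Q" using tendsto_adj[OF Q] Q LIMSEQ_unique by (simp add: as) blast
    moreover have "Q ** Q = M"
      using tendsto_qmult[OF Q Q] LIMSEQ_subseq_LIMSEQ[OF s(2) r] LIMSEQ_unique by (simp add: ps o_def) blast
    moreover have "0 \<le> inner x (Q *v x)" for x
    proof (rule LIMSEQ_le_const)
      show "(\<lambda>n. inner x (psqrt (s (r n)) *v x)) \<longlonglongrightarrow> inner x (Q *v x)"
        by (intro tendsto_inner tendsto_const tendsto_qmv Q)
      show "\<exists>N. \<forall>n\<ge>N. 0 \<le> inner x (psqrt (s (r n)) *v x)" using ps posdef_nonneg by blast
    qed
    ultimately show "Q = psqrt M"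
      using posdef_sqrt_unique[of "psqrt M" Q] psqrt[of M] M by auto
  qed
  then show "(psqrt \<circ> s) \<longlonglongrightarrow> psqrt M" by (simp add: o_def)
qed

text \<open>The invariant form minimises the strictly convex function A \<mapsto> max |k* A k| on the convex hull
  of the forms k* k.\<close>

lemma invariant_form_exists:
  fixes K :: "(quat^'n^'n) set"
  assumes K: "compact K" "mat 1 \<in> K" "\<And>k. k \<in> K \<Longrightarrow> invertible k"
    and mult: "\<And>k l. k \<in> K \<Longrightarrow> l \<in> K \<Longrightarrow> k ** l \<in> K"
  obtains M where "posdef M" "\<And>k. k \<in> K \<Longrightarrow> adj k ** M ** k = M"
proof -
  define act where "act = (\<lambda>k A. adj k ** A ** (k :: quat^'n^'n))"
  have act_act: "act k (act l A) = act (l ** k) A" for k l A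
    by (simp add: act_def adj_mult matrix_mul_assoc)
  have lin: "linear (act k)" for k
    by (rule linearI) (simp_all add: act_def qmult_add_left qmult_add_right qmult_scaleR_left qmult_scaleR_right)
  define C where "C = convex hull ((\<lambda>k. act k (mat 1)) ` K)"
  have cont: "continuous_on K (\<lambda>k. act k A)" for A
    unfolding act_def by (intro continuous_intros continuous_on_id)
  have C: "compact C" "C \<noteq> {}"
    unfolding C_def using K(2) by (auto intro!: compact_convex_hull compact_continuous_image cont K(1))
  have "C \<subseteq> Collect posdef"
    unfolding C_def by (rule hull_minimal) (use K(3) posdef_adj_mult in \<open>auto simp: act_def convex_posdef\<close>)
  have inv: "act l A \<in> C" if "l \<in> K" "A \<in> C" for l A
  proof -
    have "act l ` C \<subseteq> C" unfolding C_def convex_hull_linear_image[OF lin]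
      by (rule hull_mono) (use mult that in \<open>auto simp: act_act image_image\<close>)
    with that show ?thesis by blast
  qed
  define f where "f = (\<lambda>A. SUP k\<in>K. norm (act k A))"
  have max: "\<exists>k\<in>K. \<forall>l\<in>K. norm (act l A) \<le> norm (act k A)" for A
    using K(2) by (intro continuous_attains_sup K(1) continuous_on_norm cont) auto
  have f_max: "\<exists>k\<in>K. f A = norm (act k A)" for A
  proof -
    obtain k where "k \<in> K" "\<forall>l\<in>K. norm (act l A) \<le> norm (act k A)" using max by blast
    then show ?thesis unfolding f_def by (intro bexI[of _ k] cSup_eq_maximum) auto
  qed
  have f_ge: "norm (act k A) \<le> f A" if "k \<in> K" for k A
    unfolding f_def using max[of A] that by (intro cSUP_upper) (auto simp: bdd_above_def)
  obtain R where R: "R > 0" "\<And>k. k \<in> K \<Longrightarrow> norm k \<le> R"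
    using compact_imp_bounded[OF K(1)] bounded_pos by blast
  have norm_adj: "norm (adj k) = norm k" for k :: "quat^'n^'n"
    by (metis adj_adj inner_matrix_rtrace norm_eq_sqrt_inner rtrace_commute)
  have bound: "norm (act k A) \<le> R * R * norm A" if "k \<in> K" for k A
  proof -
    have "norm (act k A) \<le> norm (adj k) * norm A * norm k"
      unfolding act_def by (meson mult_right_mono norm_ge_zero norm_qmult_le order_trans)
    also have "\<dots> \<le> R * norm A * R" using R that by (intro mult_mono) (auto simp: norm_adj)
    finally show ?thesis by (simp add: mult_ac)
  qed
  have lip: "f A \<le> f B + R * R * norm (A - B)" for A B
  proof -
    obtain k where k: "k \<in> K" "f A = norm (act k A)" using f_max by blast
    have "act k A = act k B + act k (A - B)" by (simp add: linear_diff[OF lin])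
    then have "f A \<le> norm (act k B) + norm (act k (A - B))" unfolding k(2) by (metis norm_triangle_ineq)
    then show ?thesis using f_ge[OF k(1), of B] bound[OF k(1), of "A - B"] by linarith
  qed
  have "continuous_on C f"
  proof (rule continuous_onI)
    fix A e assume "0 < (e::real)"
    moreover have "dist (f B) (f A) < e" if "dist B A < e / (R * R)" for B
    proof -
      have "\<bar>f B - f A\<bar> \<le> R * R * norm (B - A)" using lip[of A B] lip[of B A] by (simp add: norm_minus_commute)
      also have "\<dots> < e" using that R by (simp add: dist_norm field_simps)
      finally show ?thesis by (simp add: dist_real_def)
    qed
    ultimately show "\<exists>d>0. \<forall>x'\<in>C. dist x' A < d \<longrightarrow> dist (f x') (f A) \<le> e"
      using R by (metis divide_pos_pos less_imp_le mult_pos_pos)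
  qed
  then obtain M where M: "M \<in> C" "\<And>A. A \<in> C \<Longrightarrow> f M \<le> f A"
    using continuous_attains_inf[OF C] by blast
  have "act l M = M" if l: "l \<in> K" for l
  proof (rule ccontr)
    assume ne: "act l M \<noteq> M"
    \<comment> \<open>For the k attaining the maximum at the midpoint A, the parallelogram law
      subtracts a quarter of the squared distance of the two translates. As k acts injectively, this
      makes f A < f M.\<close>
    define A where "A = (1/2) *\<^sub>R M + (1/2) *\<^sub>R act l M"
    have "convex C" by (simp add: C_def convex_convex_hull)
    then have AC: "A \<in> C" unfolding A_def using M(1) inv[OF l M(1)] by (rule convexD) auto
    obtain k where k: "k \<in> K" "f A = norm (act k A)" using f_max by blast
    let ?a = "act k M" and ?b = "act k (act l M)"
    have "?a \<noteq> ?b"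
    proof
      assume "?a = ?b"
      then have "adj (matrix_inv k) ** ?a ** matrix_inv k = adj (matrix_inv k) ** ?b ** matrix_inv k" by simp
      then have "act (k ** matrix_inv k) M = act (k ** matrix_inv k) (act l M)"
        by (simp add: act_def adj_mult matrix_mul_assoc)
      with ne show False using K(3)[OF k(1)] by (simp add: act_def matrix_inv_mult)
    qed
    have "act k A = (1/2) *\<^sub>R (?a + ?b)"
      by (simp add: A_def linear_add[OF lin] linear_scale[OF lin] scaleR_add_right)
    then have "(f A)\<^sup>2 = (1/2 * norm (?a + ?b))\<^sup>2" unfolding k(2) by simp
    also have "\<dots> = (norm (?a + ?b))\<^sup>2 / 4" by (simp add: power_divide)
    also have "(norm (?a + ?b))\<^sup>2 = 2 * (norm ?a)\<^sup>2 + 2 * (norm ?b)\<^sup>2 - (norm (?a - ?b))\<^sup>2"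
      by (simp add: power2_norm_eq_inner inner_add_left inner_add_right inner_diff_left
          inner_diff_right inner_commute)
    also have "\<dots> / 4 = ((norm ?a)\<^sup>2 + (norm ?b)\<^sup>2) / 2 - (norm (?a - ?b))\<^sup>2 / 4" by simp
    also have "\<dots> < ((norm ?a)\<^sup>2 + (norm ?b)\<^sup>2) / 2"
    proof -
      have "(norm (?a - ?b))\<^sup>2 > 0" using \<open>?a \<noteq> ?b\<close> by simp
      then show ?thesis by linarith
    qed
    \<comment> \<open>The second norm is bounded too: \<open>act k (act l M)\<close> is
      \<open>act (l ** k) M\<close>, and K is closed under products.\<close>
    also have "\<dots> \<le> ((f M)\<^sup>2 + (f M)\<^sup>2) / 2"
      using f_ge[OF k(1), of M] f_ge[OF mult[OF l k(1)], of M]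
      by (intro divide_right_mono add_mono power_mono) (auto simp: act_act)
    finally have "(f A)\<^sup>2 < (f M)\<^sup>2" by simp
    moreover have "f M \<ge> 0" using f_ge[OF k(1), of M] norm_ge_zero order_trans by blast
    ultimately have "f A < f M" by (metis power2_less_imp_less)
    with M(2)[OF AC] show False by simp
  qed
  then show ?thesis using that M(1) \<open>C \<subseteq> Collect posdef\<close> by (auto simp: act_def)
qed

subsection \<open>Representations of sl(2)\<close>

lemma subspace_ker: "linear f \<Longrightarrow> subspace {x. f x = 0}"
  by (rule subspaceI) (simp_all add: linear_0 linear_add linear_scale)

lemma rank_nullity:
  fixes f :: "'a::euclidean_space \<Rightarrow> 'b::euclidean_space"
  assumes f: "linear f" shows "dim {x. f x = 0} + dim (range f) = DIM('a)"
proof -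
  let ?K = "{x. f x = 0}"
  let ?P = "{y \<in> UNIV. \<forall>x\<in>?K. real_inner_class.orthogonal x y}"
  have K: "subspace ?K" by (rule subspace_ker[OF f])
  have P: "subspace ?P"
    by (rule subspaceI) (auto simp: real_inner_class.orthogonal_def inner_add_right)
  have "dim ?P + dim ?K = dim (UNIV :: 'a set)"
    by (rule dim_subspace_orthogonal_to_vectors[OF K subspace_UNIV]) simp
  moreover have "dim (f ` ?P) = dim ?P"
  proof (rule dim_image_eq[OF f], rule inj_onI)
    fix x y assume "x \<in> span ?P" "y \<in> span ?P" "f x = f y"
    moreover have "span ?P = ?P" using P by (simp only: span_eq_iff)
    ultimately have "x \<in> ?P" "y \<in> ?P" by (simp_all only:)
    then have "x - y \<in> ?P" by (rule subspace_diff[OF P])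
    moreover have "x - y \<in> ?K" using \<open>f x = f y\<close> by (simp add: linear_diff[OF f])
    ultimately have "inner (x - y) (x - y) = 0" by (auto simp: real_inner_class.orthogonal_def)
    then show "x = y" by simp
  qed
  moreover have "f ` ?P = range f"
  proof
    show "range f \<subseteq> f ` ?P"
    proof
      fix y assume "y \<in> range f"
      then obtain x where x: "y = f x" by blast
      obtain k p where kp: "k \<in> span ?K" "\<And>w. w \<in> span ?K \<Longrightarrow> real_inner_class.orthogonal p w" "x = k + p"
        using orthogonal_subspace_decomp_exists[of ?K x] by metis
      have "f k = 0" using kp(1) K by (simp add: span_eq_iff[THEN iffD2, OF K])
      then have "y = f p" using x kp(3) by (simp add: linear_add[OF f])
      moreover have "p \<in> ?P" using kp(2) by (auto simp: span_base orthogonal_commute)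
      ultimately show "y \<in> f ` ?P" by blast
    qed
  qed auto
  ultimately show ?thesis by simp
qed

lemma funpow_linear: "linear f \<Longrightarrow> linear (f ^^ k)" for f :: "'v::real_vector \<Rightarrow> 'v"
proof (induction k)
  case (Suc k)
  then show ?case using linear_compose[of "f ^^ k" f] by (simp only: funpow.simps)
qed (simp add: linear_iff)

text \<open>Applying T - c k removes the k-th summand and multiplies the others by nonzero factors.
  Zero summands are allowed, so this expresses directness of a sum of eigenspaces.\<close>

lemma eigenvectors_independent:
  fixes T :: "'v::real_vector \<Rightarrow> 'v"
  assumes T: "linear T" and "finite I" "inj_on c I" "\<And>i. i \<in> I \<Longrightarrow> T (x i) = c i *\<^sub>R x i"
    "(\<Sum>i\<in>I. x i) = 0"
  shows "\<forall>i\<in>I. x i = 0"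
  using assms(2-)
proof (induction I arbitrary: x rule: finite_induct)
  case (insert k I)
  let ?y = "\<lambda>i. (c i - c k) *\<^sub>R x i"
  have "(\<Sum>i\<in>insert k I. ?y i) = (\<Sum>i\<in>insert k I. T (x i)) - c k *\<^sub>R (\<Sum>i\<in>insert k I. x i)"
    using insert.prems(2) by (simp add: scaleR_sum_right sum_subtractf[symmetric] algebra_simps)
  also have "\<dots> = 0" unfolding linear_sum[OF T, symmetric] insert.prems(3) by (simp add: linear_0[OF T])
  finally have "(\<Sum>i\<in>I. ?y i) = 0" using insert.hyps by simp
  moreover have "T (?y i) = c i *\<^sub>R ?y i" if "i \<in> I" for i
    using insert.prems(2) that by (simp add: linear_scale[OF T])
  ultimately have "\<forall>i\<in>I. ?y i = 0" using insert.prems(1) by (intro insert.IH) auto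
  then have z: "\<forall>i\<in>I. x i = 0" using insert.prems(1) insert.hyps by (auto simp: inj_on_def)
  then have "(\<Sum>i\<in>I. x i) = 0" by simp
  with z insert show ?case by simp
qed simp

text \<open>Formulated for abstract real linear maps so that Y, -H, X is an instance on the same
  space (\<open>swap\<close>). Nilpotency of X and Y is the input from which the eigenvectors of H
  are produced.\<close>

locale sl2_rep =
  fixes X H Y :: "'v::euclidean_space \<Rightarrow> 'v" and m :: nat
  assumes lin: "linear X" "linear H" "linear Y"
    and HX: "H (X v) = X (H v) + 2 *\<^sub>R X v"
    and HY: "H (Y v) = Y (H v) - 2 *\<^sub>R Y v"
    and XY: "X (Y v) = Y (X v) + H v"
    and nilX: "(X ^^ m) v = 0" and nilY: "(Y ^^ m) v = 0"
begin

lemmas simps0 [simp] = linear_0[OF lin(1)] linear_0[OF lin(2)] linear_0[OF lin(3)]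
lemmas adds = linear_add[OF lin(1)] linear_add[OF lin(2)] linear_add[OF lin(3)]
lemmas diffs = linear_diff[OF lin(1)] linear_diff[OF lin(2)] linear_diff[OF lin(3)]
lemmas scales = linear_scale[OF lin(1)] linear_scale[OF lin(2)] linear_scale[OF lin(3)]

lemma swap: "sl2_rep Y (\<lambda>v. - H v) X m"
proof (rule sl2_rep.intro)
  fix v
  show "linear Y" "linear (\<lambda>v. - H v)" "linear X" by (simp_all only: lin linear_compose_neg)
  show "- H (Y v) = Y (- H v) + 2 *\<^sub>R Y v" unfolding HY linear_neg[OF lin(3)] by simp
  show "- H (X v) = X (- H v) - 2 *\<^sub>R X v" unfolding HX linear_neg[OF lin(1)] by simp
  show "Y (X v) = X (Y v) + - H v" unfolding XY by simp
qed (rule nilX nilY)+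

lemma linX: "linear (X ^^ k)" and linY: "linear (Y ^^ k)"
  by (simp_all add: lin funpow_linear)

lemma X_pow_nil: "m \<le> k \<Longrightarrow> (X ^^ k) v = 0"
  by (metis comp_apply funpow_add le_add_diff_inverse nilX)

lemma HX_pow: "H ((X ^^ k) v) = (X ^^ k) (H v) + (2 * real k) *\<^sub>R (X ^^ k) v"
  by (induction k) (simp_all add: HX adds scales algebra_simps)

lemma HX_eigen: "H v = c *\<^sub>R v \<Longrightarrow> H ((X ^^ k) v) = (c + 2 * real k) *\<^sub>R (X ^^ k) v"
  by (simp add: HX_pow linear_scale[OF linX] scaleR_add_left)

text \<open>Moving H through the powers of X adds the shifts 0, 2, ..., 2k, whose sum (k + 1) k
  gives the second term.\<close>

lemma YX_pow: "Y ((X ^^ Suc k) v) = (X ^^ Suc k) (Y v) - real (Suc k) *\<^sub>R (X ^^ k) (H v + real k *\<^sub>R v)"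
proof (induction k)
  case 0
  have "Y (X v) = X (Y v) - H v" using XY[of v] by simp
  then show ?case by simp
next
  case (Suc k)
  let ?w = "(X ^^ Suc k) v"
  have "Y (X ?w) = X (Y ?w) - H ?w" using XY[of ?w] by simp
  also have "\<dots> = X ((X ^^ Suc k) (Y v)) - real (Suc k) *\<^sub>R X ((X ^^ k) (H v + real k *\<^sub>R v))
      - ((X ^^ Suc k) (H v) + (2 * real (Suc k)) *\<^sub>R ?w)"
    unfolding Suc.IH HX_pow by (simp only: diffs scales)
  also have "\<dots> = (X ^^ Suc (Suc k)) (Y v) - real (Suc (Suc k)) *\<^sub>R (X ^^ Suc k) (H v + real (Suc k) *\<^sub>R v)"
  proof -
    have *: "c - real (Suc k) *\<^sub>R (a + real k *\<^sub>R b) - (a + (2 * real (Suc k)) *\<^sub>R b) =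
        c - real (Suc (Suc k)) *\<^sub>R (a + real (Suc k) *\<^sub>R b)" for a b c :: 'v
      by (simp add: algebra_simps scaleR_2)
    have 1: "(X ^^ Suc k) (H v + c *\<^sub>R v) = (X ^^ Suc k) (H v) + c *\<^sub>R ?w" for c
      by (simp only: linear_add[OF linX] linear_scale[OF linX])
    have 2: "X ((X ^^ j) z) = (X ^^ Suc j) z" for j z by simp
    show ?thesis unfolding 2 1 by (rule *)
  qed
  finally show ?case by (simp only: funpow.simps comp_apply)
qed

text \<open>The lowest weight vectors of the irreducible submodules of dimension j + 1.\<close>

definition E :: "nat \<Rightarrow> 'v set" where
  "E j = {v. Y v = 0 \<and> H v = (- real j) *\<^sub>R v}"

lemma subspace_E: "subspace (E j)"
  by (rule subspaceI) (simp_all add: E_def adds scales algebra_simps)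

lemma YX_E:
  assumes "v \<in> E j" shows "Y ((X ^^ Suc l) v) = (real (Suc l) * (real j - real l)) *\<^sub>R (X ^^ l) v"
proof -
  have v: "Y v = 0" "H v + real l *\<^sub>R v = (real l - real j) *\<^sub>R v"
    using assms by (simp_all add: E_def algebra_simps)
  have "Y ((X ^^ Suc l) v) = 0 - real (Suc l) *\<^sub>R (real l - real j) *\<^sub>R (X ^^ l) v"
    unfolding YX_pow v by (simp only: linear_scale[OF linX] linear_0[OF linX])
  also have "\<dots> = (- (real (Suc l) * (real l - real j))) *\<^sub>R (X ^^ l) v"
    by (simp only: scaleR_scaleR diff_0 scaleR_minus_left)
  also have "- (real (Suc l) * (real l - real j)) = real (Suc l) * (real j - real l)" by (simp add: algebra_simps)
  finally show ?thesis .
qed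

lemma HX_E: "v \<in> E j \<Longrightarrow> H ((X ^^ l) v) = (2 * real l - real j) *\<^sub>R (X ^^ l) v"
  using HX_eigen[of v "- real j" l] by (simp add: E_def)

lemma Y_nonzero: "Y w \<noteq> 0 \<Longrightarrow> w \<noteq> 0"
  by auto

text \<open>By \<open>YX_E\<close>, Y returns X^(l+1) v to a multiple of X^l v with the factor (l +
  1) (j - l), which is nonzero below the top of the string.\<close>

lemma X_E_nonzero: "v \<in> E j \<Longrightarrow> v \<noteq> 0 \<Longrightarrow> l \<le> j \<Longrightarrow> (X ^^ l) v \<noteq> 0"
proof (induction l)
  case (Suc l)
  then have "(real (Suc l) * (real j - real l)) *\<^sub>R (X ^^ l) v \<noteq> 0" by simp
  then have "Y ((X ^^ Suc l) v) \<noteq> 0" unfolding YX_E[OF Suc.prems(1)] .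
  then show ?case by (rule Y_nonzero)
qed simp

text \<open>Beyond l = j the factor (l + 1) (j - l) is nonzero again, so a string continuing past j
  would never end, against nilpotency of X.\<close>

lemma X_E_zero: assumes v: "v \<in> E j" "j < l" shows "(X ^^ l) v = 0"
proof -
  let ?w = "(X ^^ Suc j) v"
  have "?w = 0"
  proof (rule ccontr)
    assume w: "?w \<noteq> 0"
    have "(X ^^ l) v \<noteq> 0" if "Suc j \<le> l" for l
      using that
    proof (induction l rule: dec_induct)
      case (step l)
      then have "(real (Suc l) * (real j - real l)) *\<^sub>R (X ^^ l) v \<noteq> 0" by simp
      then have "Y ((X ^^ Suc l) v) \<noteq> 0" unfolding YX_E[OF v(1)] .
      then show ?case by (rule Y_nonzero)
    qed (use w in simp)
    from this[of "max (Suc j) m"] show False by (simp add: X_pow_nil)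
  qed
  moreover have "(X ^^ l) v = (X ^^ (l - Suc j)) ?w" using v(2)
    by (metis Suc_leI comp_apply funpow_add le_add_diff_inverse2)
  ultimately show ?thesis by (simp add: linear_0[OF linX])
qed

section \<open>Weight decomposition of the kernel of Y\<close>

lemma kerY_H: "Y v = 0 \<Longrightarrow> Y (H v) = 0"
  using HY[of v] by simp

lemma kerY_step: "Y v = 0 \<Longrightarrow> (X ^^ Suc k) v = 0 \<Longrightarrow> (X ^^ k) (H v + real k *\<^sub>R v) = 0"
  using YX_pow[of k v] by (simp add: linear_0[OF linX])

text \<open>On ker Y the operator T = H + k lowers the power of X that kills a vector, and T is
  bijective on the span of the E j with j < k, having eigenvalues k - j there. So T v = T u with u
  in that span, and v - u lies in E k.\<close>

lemma kerY_decomp: "Y v = 0 \<Longrightarrow> (X ^^ k) v = 0 \<Longrightarrow> v \<in> span (\<Union>j<k. E j)"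
proof (induction k arbitrary: v)
  case (Suc k)
  let ?T = "\<lambda>w. H w + real k *\<^sub>R w"
  have T: "linear ?T" by (rule linearI) (simp_all add: adds scales algebra_simps)
  let ?S = "span (\<Union>j<k. E j)"
  have "?T v \<in> ?S"
    using Suc.prems by (intro Suc.IH kerY_step) (simp_all add: adds scales kerY_H del: funpow.simps)
  also have "?S \<subseteq> ?T ` ?S"
  proof (rule span_minimal)
    show "subspace (?T ` ?S)" by (intro linear_subspace_image T subspace_span)
    show "(\<Union>j<k. E j) \<subseteq> ?T ` ?S"
    proof
      fix e assume "e \<in> (\<Union>j<k. E j)"
      then obtain j where j: "j < k" "e \<in> E j" by blast
      have "?T ((1 / (real k - real j)) *\<^sub>R e) = (1 / (real k - real j)) *\<^sub>R (real k - real j) *\<^sub>R e"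
        using j(2) by (simp add: scales E_def algebra_simps)
      also have "\<dots> = e" using j(1) by simp
      finally have "e = ?T ((1 / (real k - real j)) *\<^sub>R e)" ..
      moreover have "(1 / (real k - real j)) *\<^sub>R e \<in> ?S" using j by (intro span_scale span_base) blast
      ultimately show "e \<in> ?T ` ?S" by blast
    qed
  qed
  finally obtain u where u: "u \<in> ?S" "?T v = ?T u" by auto
  have "?S \<subseteq> {w. Y w = 0}"
    by (rule span_minimal) (auto simp: E_def subspace_ker[OF lin(3)])
  then have "Y u = 0" using u by blast
  then have "v - u \<in> E k" using u(2) Suc.prems by (simp add: E_def diffs algebra_simps eq_neg_iff_add_eq_0)
  moreover have "u \<in> span (\<Union>j<Suc k. E j)" 
    by (rule subsetD[OF span_mono u(1)]) (intro UN_mono, auto)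
  ultimately show ?case using span_add[OF span_base[of "v - u"], of "\<Union>j<Suc k. E j" u] by auto
qed simp

text \<open>Take a nonzero u in Z killed by the smallest power X^(j+1). By \<open>kerY_step\<close>,
  X^j kills H u + j u, which is therefore 0 by minimality.\<close>

lemma kerY_eigenvector:
  assumes "v \<in> Z" "v \<noteq> 0" "\<And>v. v \<in> Z \<Longrightarrow> Y v = 0" "\<And>v c. v \<in> Z \<Longrightarrow> H v + c *\<^sub>R v \<in> Z"
  shows "\<exists>j. \<exists>u\<in>Z. u \<noteq> 0 \<and> u \<in> E j"
proof -
  define k where "k = (LEAST k. \<exists>v\<in>Z. v \<noteq> 0 \<and> (X ^^ k) v = 0)"
  have "\<exists>k. \<exists>v\<in>Z. v \<noteq> 0 \<and> (X ^^ k) v = 0" using assms(1,2) nilX by blast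
  then have "\<exists>v\<in>Z. v \<noteq> 0 \<and> (X ^^ k) v = 0" unfolding k_def by (rule LeastI_ex)
  then obtain u where u: "u \<in> Z" "u \<noteq> 0" "(X ^^ k) u = 0" by blast
  obtain j where j: "k = Suc j" using u(2,3) by (cases k) auto
  have "H u + real j *\<^sub>R u = 0"
  proof (rule ccontr)
    assume "H u + real j *\<^sub>R u \<noteq> 0"
    moreover have "(X ^^ j) (H u + real j *\<^sub>R u) = 0" using u j assms(3) by (intro kerY_step) auto
    ultimately have "k \<le> j" unfolding k_def using assms(4)[OF u(1)] by (intro Least_le) blast
    then show False using j by simp
  qed
  then have "u \<in> E j" using assms(3)[OF u(1)] by (simp add: E_def eq_neg_iff_add_eq_0)
  then show ?thesis using u by blast
qed

text \<open>By the swapped decomposition, ker X is spanned by eigenvectors of H with eigenvalues i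
  \<ge> 0, on which H + j + 2 acts by the positive number i + j + 2.\<close>

lemma kerX_solve:
  assumes "X z = 0" obtains u where "X u = 0" "H u + (real j + 2) *\<^sub>R u = z"
proof -
  interpret s: sl2_rep Y "\<lambda>v. - H v" X m by (rule swap)
  let ?T = "\<lambda>w. H w + (real j + 2) *\<^sub>R w"
  let ?S = "span (\<Union>i<m. s.E i)"
  have T: "linear ?T" by (rule linearI) (simp_all add: adds scales algebra_simps)
  have "z \<in> ?S" using assms nilY by (rule s.kerY_decomp)
  also have "?S \<subseteq> ?T ` ?S"
  proof (rule span_minimal)
    show "subspace (?T ` ?S)" by (intro linear_subspace_image T subspace_span)
    show "(\<Union>i<m. s.E i) \<subseteq> ?T ` ?S"
    proof
      fix e assume "e \<in> (\<Union>i<m. s.E i)"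
      then obtain i where i: "i < m" "e \<in> s.E i" by blast
      then have He: "H e = real i *\<^sub>R e" by (simp add: s.E_def)
      have p: "real i + real j + 2 > 0" by simp
      have "?T ((1 / (real i + real j + 2)) *\<^sub>R e) = (1 / (real i + real j + 2)) *\<^sub>R (real i + real j + 2) *\<^sub>R e"

        unfolding linear_scale[OF T] by (simp add: He algebra_simps)
      also have "\<dots> = e" using p by simp
      finally have "e = ?T ((1 / (real i + real j + 2)) *\<^sub>R e)" ..
      moreover have "(1 / (real i + real j + 2)) *\<^sub>R e \<in> ?S" using i by (intro span_scale span_base) blast
      ultimately show "e \<in> ?T ` ?S" by blast
    qed
  qed
  finally obtain u where u: "u \<in> ?S" "?T u = z" by auto
  have "?S \<subseteq> {w. X w = 0}"
    by (rule span_minimal) (auto simp: s.E_def subspace_ker[OF lin(1)])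
  then show ?thesis using u that by blast
qed

text \<open>A counterexample would give a nonzero vector X x in some E j. Correcting x by an element
  of ker X makes it an eigenvector y of weight -(j + 2). Then X Y^(k+1) y is a nonzero multiple of
  Y^k y, so no power of Y kills y, which contradicts nilpotency.\<close>

lemma kerY_Int_range_X: assumes "Y (X w) = 0" shows "X w = 0"
proof (rule ccontr)
  assume "X w \<noteq> 0"
  let ?Z = "{v. Y v = 0} \<inter> range X"
  have "\<exists>j. \<exists>u\<in>?Z. u \<noteq> 0 \<and> u \<in> E j"
  proof (rule kerY_eigenvector)
    show "X w \<in> ?Z" using assms by simp
    fix v c assume "v \<in> ?Z"
    then obtain x where x: "v = X x" "Y v = 0" by blast
    have *: "H v + c *\<^sub>R v = X (H x + 2 *\<^sub>R x + c *\<^sub>R x)" by (simp add: x HX adds scales)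
    from * have "H v + c *\<^sub>R v \<in> range X" by (rule range_eqI)
    moreover have "Y (H v + c *\<^sub>R v) = 0" using x(2) by (simp add: adds scales kerY_H)
    ultimately show "H v + c *\<^sub>R v \<in> ?Z" by blast
  qed (use \<open>X w \<noteq> 0\<close> in auto)
  then obtain j x where x: "X x \<noteq> 0" "X x \<in> E j" by blast
  have "X (H x + (real j + 2) *\<^sub>R x) = 0"
  proof -
    have "X (H x) = H (X x) - 2 *\<^sub>R X x" unfolding HX by simp
    moreover have "H (X x) = (- real j) *\<^sub>R X x" using x(2) by (simp add: E_def)
    ultimately have "X (H x) = (- real j) *\<^sub>R X x - 2 *\<^sub>R X x" by simp
    then show ?thesis unfolding adds scales by (simp add: scaleR_add_left)
  qed
  then obtain u where u: "X u = 0" "H u + (real j + 2) *\<^sub>R u = H x + (real j + 2) *\<^sub>R x"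
    by (rule kerX_solve)
  define y where "y = x - u"
  have y: "X y = X x" "Y (X y) = 0" "H y = (- (real j + 2)) *\<^sub>R y"
    using u x(2) by (simp_all add: y_def diffs E_def algebra_simps eq_neg_iff_add_eq_0)
  interpret s: sl2_rep Y "\<lambda>v. - H v" X m by (rule swap)
  have "(Y ^^ k) y \<noteq> 0" for k
  proof (induction k)
    case 0 show ?case using x(1) y(1) by auto
  next
    case (Suc k)
    have "(Y ^^ Suc k) (X y) = 0" using y(2) by (simp add: funpow_swap1 linear_0[OF linY])
    then have "X ((Y ^^ Suc k) y) = - (real (Suc k) *\<^sub>R (Y ^^ k) (- H y + real k *\<^sub>R y))"
      using s.YX_pow[of k y] by simp
    also have "- H y + real k *\<^sub>R y = (real j + 2 + real k) *\<^sub>R y" unfolding y(3) by (simp add: algebra_simps)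
    finally have "X ((Y ^^ Suc k) y) = - (real (Suc k) * (real j + 2 + real k)) *\<^sub>R (Y ^^ k) y"
      by (simp add: linear_scale[OF linY])
    moreover have "real (Suc k) * (real j + 2 + real k) > 0" by (intro mult_pos_pos) linarith+
    ultimately have "X ((Y ^^ Suc k) y) \<noteq> 0" using Suc by simp
    then show ?case by auto
  qed
  then show False using nilY by blast
qed

section \<open>Complete reducibility\<close>

lemma dim_kerY_le: "dim {v. Y v = 0} \<le> dim {v. X v = 0}"
proof -
  have K: "subspace {v. Y v = 0}" "subspace (range X)"
    using subspace_ker[OF lin(3)] linear_subspace_image[OF lin(1) subspace_UNIV] by auto
  have "{v. Y v = 0} \<inter> range X = {0}" using kerY_Int_range_X by (auto intro: image_eqI[of _ _ 0])
  then have "dim {x + y |x y. x \<in> {v. Y v = 0} \<and> y \<in> range X} = dim {v. Y v = 0} + dim (range X)"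
    using dim_sums_Int[OF K] by simp
  moreover have "dim {x + y |x y. x \<in> {v. Y v = 0} \<and> y \<in> range X} \<le> DIM('v)" by (rule dim_subset_UNIV)
  ultimately have "dim {v. Y v = 0} + dim (range X) \<le> DIM('v)" by (simp only:)
  then show ?thesis using rank_nullity[OF lin(1)] by linarith
qed

text \<open>The inequality of \<open>dim_kerY_le\<close> and its swapped form give equal dimensions
  of ker X and ker Y, so the direct sum of ker Y and range X has full dimension.\<close>

lemma kerY_plus_range_X: "\<exists>u w. Y u = 0 \<and> v = u + X w"
proof -
  interpret s: sl2_rep Y "\<lambda>v. - H v" X m by (rule swap)
  have K: "subspace {v. Y v = 0}" "subspace (range X)"
    using subspace_ker[OF lin(3)] linear_subspace_image[OF lin(1) subspace_UNIV] by auto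
  let ?S = "{x + y |x y. x \<in> {v. Y v = 0} \<and> y \<in> range X}"
  have "{v. Y v = 0} \<inter> range X = {0}" using kerY_Int_range_X by (auto intro: image_eqI[of _ _ 0])
  then have "dim ?S = dim {v. Y v = 0} + dim (range X)" using dim_sums_Int[OF K] by simp
  also have "\<dots> = DIM('v)" using dim_kerY_le s.dim_kerY_le rank_nullity[OF lin(1)] by linarith
  finally have "span ?S = UNIV" by (simp add: dim_eq_full)
  moreover have "span ?S = ?S" using subspace_sums[OF K] by (simp only: span_eq_iff)
  ultimately have "v \<in> ?S" by (simp only: UNIV_I)
  then show ?thesis by blast
qed

text \<open>Iterating V = ker Y + X V ends because X^m = 0. The kernel part lies in the span of the
  strings by \<open>kerY_decomp\<close>, and that span is stable under X.\<close>

lemma complete_reducibility: "v \<in> span {(X ^^ l) e |l j e. e \<in> E j \<and> l \<le> j}" (is "_ \<in> span ?B")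
proof -
  have ker: "u \<in> span ?B" if "Y u = 0" for u
  proof -
    have "u \<in> span (\<Union>j<m. E j)" using that nilX by (rule kerY_decomp)
    also have "\<dots> \<subseteq> span ?B"
    proof (rule span_mono, rule subsetI)
      fix e assume "e \<in> (\<Union>j<m. E j)"
      then obtain j where "e \<in> E j" by blast
      moreover have "e = (X ^^ 0) e" "0 \<le> j" by simp_all
      ultimately show "e \<in> ?B" by blast
    qed
    finally show ?thesis .
  qed
  have X: "X u \<in> span ?B" if "u \<in> span ?B" for u
  proof -
    have "X ` span ?B = span (X ` ?B)" by (rule linear_span_image[OF lin(1), symmetric])
    also have "\<dots> \<subseteq> span ?B"
    proof (rule span_minimal, rule image_subsetI)
      fix b assume "b \<in> ?B"
      then obtain l j e where b: "b = (X ^^ l) e" "e \<in> E j" "l \<le> j" by blast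
      show "X b \<in> span ?B"
      proof (cases "l = j")
        case True
        then have "X b = 0" using X_E_zero[OF b(2), of "Suc l"] b by simp
        then show ?thesis by (simp add: span_zero)
      next
        case False
        then have "X b = (X ^^ Suc l) e" "Suc l \<le> j" using b by auto
        then show ?thesis using b(2) by (intro span_base) blast
      qed
    qed simp
    finally show ?thesis using that by blast
  qed
  have "\<exists>u\<in>span ?B. \<exists>w. v = u + (X ^^ k) w" for k
  proof (induction k)
    case 0 show ?case by (rule bexI[of _ 0]) (auto simp: span_zero)
  next
    case (Suc k)
    then obtain u w where u: "u \<in> span ?B" "v = u + (X ^^ k) w" by blast
    obtain a b where a: "Y a = 0" "w = a + X b" using kerY_plus_range_X by blast
    have "(X ^^ k) a \<in> span ?B" by (induction k) (simp_all add: ker a(1) X)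
    moreover have "v = (u + (X ^^ k) a) + (X ^^ Suc k) b"
      by (simp add: u(2) a(2) linear_add[OF linX] funpow_swap1)
    ultimately show ?case using u(1) span_add by blast
  qed
  from this[of m] show ?thesis by (auto simp: nilX)
qed

text \<open>The Casimir operator 4 Y X + H^2 + 2 H is constant along a string, so it can separate
  strings of different lengths even when they share weights.\<close>

lemma casimir:
  assumes "e \<in> E j"
  shows "4 *\<^sub>R Y (X ((X ^^ l) e)) + H (H ((X ^^ l) e)) + 2 *\<^sub>R H ((X ^^ l) e) =
    (real j * (real j + 2)) *\<^sub>R (X ^^ l) e"
proof -
  let ?w = "(X ^^ l) e" and ?a = "2 * real l - real j" and ?b = "real (Suc l) * (real j - real l)"
  have Y: "Y (X ?w) = ?b *\<^sub>R ?w" using YX_E[OF assms, of l] by (simp only: funpow.simps comp_apply)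
  have c: "4 * ?b + ?a * ?a + 2 * ?a = real j * (real j + 2)" by (simp add: algebra_simps)
  show ?thesis
    unfolding Y HX_E[OF assms] scales scaleR_scaleR scaleR_add_left[symmetric] c ..
qed

lemma string_sum_direct:
  assumes e: "\<And>l. l \<le> j \<Longrightarrow> e l \<in> E j" and 0: "(\<Sum>l\<le>j. (X ^^ l) (e l)) = 0" and "l \<le> j"
  shows "e l = 0"
proof -
  have "\<forall>l\<in>{..j}. (X ^^ l) (e l) = 0"
    by (rule eigenvectors_independent[OF lin(2) _ _ _ 0, of "\<lambda>l. 2 * real l - real j"])
      (use e HX_E in \<open>auto simp: inj_on_def\<close>)
  then show ?thesis using X_E_nonzero[of "e l" j l] assms by auto
qed

text \<open>The Casimir eigenvalues j (j + 2) are distinct for natural j and split the sum by string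
  length; \<open>string_sum_direct\<close> then splits each part by weight.\<close>

lemma sum_direct:
  assumes D: "finite D" and e: "\<And>j l. j \<in> D \<Longrightarrow> l \<le> j \<Longrightarrow> e j l \<in> E j"
    and 0: "(\<Sum>j\<in>D. \<Sum>l\<le>j. (X ^^ l) (e j l)) = 0" and "j \<in> D" "l \<le> j"
  shows "e j l = 0"
proof -
  let ?T = "\<lambda>v. 4 *\<^sub>R Y (X v) + H (H v) + 2 *\<^sub>R H v"
  have T: "linear ?T" by (rule linearI) (simp_all add: adds scales algebra_simps)
  have "\<forall>j\<in>D. (\<Sum>l\<le>j. (X ^^ l) (e j l)) = 0"
  proof (rule eigenvectors_independent[OF T D _ _ 0, of "\<lambda>j. real j * (real j + 2)"])
    show "inj_on (\<lambda>j. real j * (real j + 2)) D"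
    proof (rule inj_onI)
      fix i j assume "real i * (real i + 2) = real j * (real j + 2)"
      then have "(real i - real j) * (real i + real j + 2) = 0" by (simp add: algebra_simps)
      moreover have "real i + real j + 2 \<noteq> 0" by linarith
      ultimately show "i = j" by simp
    qed
    fix j assume j: "j \<in> D"
    have "?T (\<Sum>l\<le>j. (X ^^ l) (e j l)) = (\<Sum>l\<le>j. ?T ((X ^^ l) (e j l)))" by (rule linear_sum[OF T])
    also have "\<dots> = (\<Sum>l\<le>j. (real j * (real j + 2)) *\<^sub>R (X ^^ l) (e j l))"
      by (rule sum.cong) (use e[OF j] casimir in auto)
    finally show "?T (\<Sum>l\<le>j. (X ^^ l) (e j l)) = (real j * (real j + 2)) *\<^sub>R (\<Sum>l\<le>j. (X ^^ l) (e j l))"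
      by (simp add: scaleR_sum_right)
  qed
  then have "(\<Sum>l\<le>j. (X ^^ l) (e j l)) = 0" using assms(4) by blast
  then show ?thesis using string_sum_direct[of j "e j" l] e assms by blast
qed

end

subsection \<open>Isotypic components\<close>

definition mpow :: "quat^'n^'n \<Rightarrow> nat \<Rightarrow> quat^'n^'n" where
  "mpow A k = ((**) A ^^ k) (mat 1)"

lemma mpow_0 [simp]: "mpow A 0 = mat 1" and mpow_Suc: "mpow A (Suc k) = A ** mpow A k"
  by (simp_all add: mpow_def)

lemma mpow_qmv: "mpow A k *v x = ((*v) A ^^ k) x"
  by (induction k) (simp_all add: mpow_Suc matrix_vector_mul_assoc[symmetric])

lemma funpow_qmv: "(*v) A ^^ k = (*v) (mpow A k)"
  by (simp add: fun_eq_iff mpow_qmv)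

text \<open>The bracket with A multiplies X^k by c k, while it enlarges norms at most by the factor
  2 |A|; hence X^k = 0 for large k.\<close>

lemma ad_eigen_nilpotent:
  fixes A X :: "quat^'n^'n"
  assumes X: "lie A X = c *\<^sub>R X" and "c \<noteq> 0"
  shows "\<exists>k. mpow X k = 0"
proof (rule ccontr)
  assume *: "\<nexists>k. mpow X k = 0"
  have e: "lie A (mpow X k) = (c * real k) *\<^sub>R mpow X k" for k
  proof (induction k)
    case (Suc k)
    have "lie A (mpow X (Suc k)) = lie A X ** mpow X k + X ** lie A (mpow X k)"
      by (simp add: lie_def mpow_Suc qmult_diff_left qmult_diff_right matrix_mul_assoc)
    also have "\<dots> = (c * real (Suc k)) *\<^sub>R mpow X (Suc k)"
      unfolding X Suc by (simp add: mpow_Suc qmult_scaleR_left qmult_scaleR_right algebra_simps)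
    finally show ?case .
  qed (simp add: lie_def)
  obtain k :: nat where k: "2 * norm A / \<bar>c\<bar> < real k" using reals_Archimedean2 by blast
  have "\<bar>c * real k\<bar> * norm (mpow X k) = norm (lie A (mpow X k))" by (simp add: e)
  also have "\<dots> \<le> norm (A ** mpow X k) + norm (mpow X k ** A)" unfolding lie_def by (rule norm_triangle_ineq4)
  also have "\<dots> \<le> norm A * norm (mpow X k) + norm (mpow X k) * norm A" by (intro add_mono norm_qmult_le)
  finally have "\<bar>c\<bar> * real k * norm (mpow X k) \<le> (2 * norm A) * norm (mpow X k)" by (simp add: abs_mult)
  moreover have "norm (mpow X k) > 0" using * by auto
  ultimately have "\<bar>c\<bar> * real k \<le> 2 * norm A" by simp
  then show False using k assms(2) by (simp add: field_simps)
qed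

lemma mpow_zero_mono: "k \<le> l \<Longrightarrow> mpow X k = 0 \<Longrightarrow> mpow X l = 0"
  by (induction rule: dec_induct) (simp_all add: mpow_Suc)

locale sl2_matrices = sl2_rep "(*v) X" "(*v) H" "(*v) Y" m for X H Y :: "quat^'n^'n" and m
begin

lemma sl2_submodule_iff:
  "sl2_submodule X H Y W \<longleftrightarrow> subspace W \<and> (\<forall>w\<in>W. X *v w \<in> W \<and> H *v w \<in> W \<and> Y *v w \<in> W)"
  (is "_ \<longleftrightarrow> subspace W \<and> ?R")
proof -
  have "\<forall>A\<in>span {X, H, Y}. \<forall>w\<in>W. A *v w \<in> W" if W: "subspace W" ?R
  proof -
    have "subspace {A. \<forall>w\<in>W. A *v w \<in> W}"
      using W(1) by (intro subspaceI) (auto simp: subspace_def matrix_vector_mult_add_rdistrib qmv_scaleR_left)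
    then have "span {X, H, Y} \<subseteq> {A. \<forall>w\<in>W. A *v w \<in> W}" using W(2) by (intro span_minimal) auto
    then show ?thesis by blast
  qed
  then show ?thesis unfolding sl2_submodule_def using span_base[of _ "{X, H, Y}"] by blast
qed

section \<open>Irreducible submodules as strings\<close>

definition string :: "quat^'n \<Rightarrow> nat \<Rightarrow> (quat^'n) set" where
  "string v j = span ((\<lambda>l. ((*v) X ^^ l) v) ` {..j})"

lemma string_elem:
  assumes "x \<in> string v j" obtains a where "x = (\<Sum>l\<le>j. a l *\<^sub>R ((*v) X ^^ l) v)"
proof -
  let ?S = "{\<Sum>l\<le>j. a l *\<^sub>R ((*v) X ^^ l) v |a. True}"
  have "subspace ?S"
  proof (rule subspaceI)
    show "0 \<in> ?S" by (rule CollectI, rule exI[of _ "\<lambda>_. 0"]) simp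
    fix x y assume "x \<in> ?S" "y \<in> ?S"
    then obtain a b where "x = (\<Sum>l\<le>j. a l *\<^sub>R ((*v) X ^^ l) v)" "y = (\<Sum>l\<le>j. b l *\<^sub>R ((*v) X ^^ l) v)" by blast
    then have "x + y = (\<Sum>l\<le>j. (a l + b l) *\<^sub>R ((*v) X ^^ l) v)" by (simp add: sum.distrib scaleR_add_left)
    then show "x + y \<in> ?S" by (intro CollectI exI[of _ "\<lambda>l. a l + b l"] conjI TrueI)
  next
    fix x r assume "x \<in> ?S"
    then obtain a where "x = (\<Sum>l\<le>j. a l *\<^sub>R ((*v) X ^^ l) v)" by blast
    then have "r *\<^sub>R x = (\<Sum>l\<le>j. (r * a l) *\<^sub>R ((*v) X ^^ l) v)" by (simp add: scaleR_sum_right)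
    then show "r *\<^sub>R x \<in> ?S" by (intro CollectI exI[of _ "\<lambda>l. r * a l"] conjI TrueI)
  qed
  moreover have "(\<lambda>l. ((*v) X ^^ l) v) ` {..j} \<subseteq> ?S"
  proof (rule image_subsetI)
    fix k assume "k \<in> {..j}"
    then have "((*v) X ^^ k) v = (\<Sum>l\<le>j. (if l = k then 1 else 0) *\<^sub>R ((*v) X ^^ l) v)"
      by (simp add: if_distrib[where f="\<lambda>r. r *\<^sub>R _"] cong: if_cong)
    then show "((*v) X ^^ k) v \<in> ?S" by (intro CollectI exI conjI TrueI)
  qed
  ultimately have "string v j \<subseteq> ?S" unfolding string_def by (intro span_minimal)
  then show ?thesis using assms that by blast
qed

lemma string_base: "l \<le> j \<Longrightarrow> ((*v) X ^^ l) v \<in> string v j"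
  unfolding string_def by (intro span_base imageI) simp

lemma string_submodule:
  assumes v: "v \<in> E j" shows "sl2_submodule X H Y (string v j)"
proof -
  have sub: "subspace (string v j)" by (simp add: string_def)
  have gen: "f ` string v j \<subseteq> string v j"
    if f: "linear f" and g: "\<And>l. l \<le> j \<Longrightarrow> f (((*v) X ^^ l) v) \<in> string v j" for f
  proof -
    have "f ` string v j = span (f ` (\<lambda>l. ((*v) X ^^ l) v) ` {..j})"
      unfolding string_def by (rule linear_span_image[OF f, symmetric])
    also have "\<dots> \<subseteq> string v j" using g by (intro span_minimal sub) auto
    finally show ?thesis .
  qed
  have "X *v ((*v) X ^^ l) v \<in> string v j" if "l \<le> j" for l
  proof (cases "l = j")
    case True
    have "((*v) X ^^ Suc j) v = 0" by (rule X_E_zero[OF v]) simp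
    then show ?thesis using True sub by (simp add: subspace_0)
  next
    case False
    then show ?thesis using string_base[of "Suc l" j v] that by simp
  qed
  moreover have "H *v ((*v) X ^^ l) v \<in> string v j" if "l \<le> j" for l
    using string_base[OF that] sub unfolding HX_E[OF v] by (intro subspace_scale)
  moreover have "Y *v ((*v) X ^^ l) v \<in> string v j" if "l \<le> j" for l
  proof (cases l)
    case 0 then show ?thesis using v sub by (simp add: E_def subspace_0)
  next
    case (Suc k)
    then show ?thesis
      using string_base[of k j v] sub that YX_E[OF v, of k] by (simp add: subspace_scale del: funpow.simps)
  qed
  ultimately show ?thesis
    unfolding sl2_submodule_iff using sub gen[OF lin(1)] gen[OF lin(2)] gen[OF lin(3)] by blast
qed

lemma string_coeffs_zero:
  assumes v: "v \<in> E j" "v \<noteq> 0" and "(\<Sum>l\<le>j. a l *\<^sub>R ((*v) X ^^ l) v) = 0" "l \<le> j" shows "a l = 0"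
proof -
  have "(\<Sum>l\<le>j. ((*v) X ^^ l) (a l *\<^sub>R v)) = 0"
    using assms(3) by (simp only: linear_scale[OF linX])
  then have "a l *\<^sub>R v = 0"
    using string_sum_direct[of j "\<lambda>l. a l *\<^sub>R v" l] assms(4) subspace_scale[OF subspace_E v(1)] by blast
  then show ?thesis using v(2) by simp
qed

lemma dim_string: assumes v: "v \<in> E j" "v \<noteq> 0" shows "dim (string v j) = Suc j"
proof -
  let ?f = "\<lambda>l. ((*v) X ^^ l) v"
  have inj: "inj_on ?f {..j}"
  proof (rule inj_onI, rule ccontr)
    fix k l assume kl: "k \<in> {..j}" "l \<in> {..j}" "?f k = ?f l" "k \<noteq> l"
    have "(\<Sum>i\<le>j. ((if i = k then 1 else 0) - (if i = l then 1 else 0)) *\<^sub>R ?f i) =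
        (\<Sum>i\<le>j. (if i = k then ?f k else 0) - (if i = l then ?f l else 0))"
      by (rule sum.cong) auto
    also have "\<dots> = 0" using kl by (simp add: sum_subtractf)
    finally have "(if k = k then 1 else 0) - (if k = l then 1 else (0::real)) = 0"
      by (rule string_coeffs_zero[OF v]) (use kl in simp)
    then show False using kl by simp
  qed
  have "independent (?f ` {..j})"
  proof (rule independent_if_scalars_zero)
    fix g x assume "(\<Sum>x\<in>?f ` {..j}. g x *\<^sub>R x) = 0" "x \<in> ?f ` {..j}"
    then show "g x = 0" using string_coeffs_zero[OF v, of "\<lambda>l. g (?f l)"] by (auto simp: sum.reindex[OF inj])
  qed simp
  then show ?thesis unfolding string_def dim_span by (simp add: dim_eq_card_independent card_image[OF inj])
qed

text \<open>The last nonzero vector among the Y^i w lies in the intersection of W with ker Y, which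
  is stable under H, so \<open>kerY_eigenvector\<close> applies there.\<close>

lemma submodule_lowest_vector:
  assumes W: "sl2_submodule X H Y W" and "w \<in> W" "w \<noteq> 0"
  shows "\<exists>j. \<exists>u\<in>W. u \<noteq> 0 \<and> u \<in> E j"
proof -
  have W': "subspace W" "\<And>w. w \<in> W \<Longrightarrow> X *v w \<in> W" "\<And>w. w \<in> W \<Longrightarrow> H *v w \<in> W" "\<And>w. w \<in> W \<Longrightarrow> Y *v w \<in> W"
    using W by (auto simp: sl2_submodule_iff)
  have YW: "((*v) Y ^^ k) w \<in> W" for k by (induction k) (simp_all add: assms(2) W')
  define k where "k = (LEAST k. ((*v) Y ^^ k) w = 0)"
  have k: "((*v) Y ^^ k) w = 0" unfolding k_def using nilY by (rule LeastI)
  then obtain i where i: "k = Suc i" using assms(3) by (cases k) auto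
  have ne: "((*v) Y ^^ i) w \<noteq> 0" using not_less_Least[of i "\<lambda>k. ((*v) Y ^^ k) w = 0"] i unfolding k_def by simp
  have "\<exists>j. \<exists>u\<in>W \<inter> {v. Y *v v = 0}. u \<noteq> 0 \<and> u \<in> E j"
  proof (rule kerY_eigenvector)
    show "((*v) Y ^^ i) w \<in> W \<inter> {v. Y *v v = 0}" using k i YW by simp
    show "H *v v + c *\<^sub>R v \<in> W \<inter> {v. Y *v v = 0}" if "v \<in> W \<inter> {v. Y *v v = 0}" for v c
      using that W' by (auto simp: adds scales kerY_H subspace_add subspace_scale)
  qed (use ne in auto)
  then show ?thesis by blast
qed

lemma string_kerY:
  assumes v: "v \<in> E j" "v \<noteq> 0" and x: "x \<in> string v j" "Y *v x = 0" shows "\<exists>c. x = c *\<^sub>R v"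
proof -
  obtain a where a: "x = (\<Sum>l\<le>j. a l *\<^sub>R ((*v) X ^^ l) v)" using x(1) by (rule string_elem)
  have "(\<Sum>l\<le>j. a l *\<^sub>R (Y *v ((*v) X ^^ l) v)) = 0" using x(2) unfolding a by (simp add: qmv_sum qmv_scaleR)
  moreover have "(\<Sum>l\<le>j. a l *\<^sub>R (Y *v ((*v) X ^^ l) v)) =
      (\<Sum>l<j. a (Suc l) *\<^sub>R (Y *v ((*v) X ^^ Suc l) v))"
    using v(1) unfolding sum.atMost_shift by (simp add: E_def)
  also have "\<dots> = (\<Sum>l<j. (a (Suc l) * (real (Suc l) * (real j - real l))) *\<^sub>R ((*v) X ^^ l) v)"
    by (simp only: YX_E[OF v(1)] scaleR_scaleR)
  also have "\<dots> = (\<Sum>l\<le>j. (a (Suc l) * (real (Suc l) * (real j - real l))) *\<^sub>R ((*v) X ^^ l) v)"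
    by (simp add: lessThan_Suc_atMost[symmetric])
  ultimately have *: "(\<Sum>l\<le>j. (a (Suc l) * (real (Suc l) * (real j - real l))) *\<^sub>R ((*v) X ^^ l) v) = 0" by simp
  have "a (Suc l) = 0" if "l < j" for l
  proof -
    have "a (Suc l) * (real (Suc l) * (real j - real l)) = 0"
      by (rule string_coeffs_zero[OF v *]) (use that in simp)
    then show ?thesis using that by simp
  qed
  then have "x = a 0 *\<^sub>R v" unfolding a sum.atMost_shift by simp
  then show ?thesis by blast
qed

lemma string_irreducible:
  assumes v: "v \<in> E j" "v \<noteq> 0" shows "irreducible_submodule X H Y (string v j)"
  unfolding irreducible_submodule_def
proof (intro conjI allI impI)
  show "sl2_submodule X H Y (string v j)" by (rule string_submodule[OF v(1)])
  show "string v j \<noteq> {0}" using string_base[of 0 j v] v by auto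
  fix W assume W: "sl2_submodule X H Y W \<and> W \<subseteq> string v j"
  show "W = {0} \<or> W = string v j"
  proof (cases "W \<subseteq> {0}")
    case True
    then show ?thesis using W subspace_0 by (auto simp: sl2_submodule_def)
  next
    case False
    then obtain w where "w \<in> W" "w \<noteq> 0" by blast
    then obtain i u where u: "u \<in> W" "u \<noteq> 0" "u \<in> E i" using submodule_lowest_vector W by blast
    then obtain c where c: "u = c *\<^sub>R v" using string_kerY[OF v, of u] W by (auto simp: E_def)
    have sW: "subspace W" using W by (simp add: sl2_submodule_def)
    have "v = (1 / c) *\<^sub>R u" using c u(2) by simp
    then have vW: "v \<in> W" using subspace_scale[OF sW u(1)] by simp
    have "((*v) X ^^ l) v \<in> W" for l
      by (induction l) (use vW W in \<open>auto simp: sl2_submodule_iff\<close>)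
    then have "string v j \<subseteq> W" unfolding string_def by (intro span_minimal sW) auto
    then show ?thesis using W by blast
  qed
qed

lemma irreducible_string:
  assumes "irreducible_submodule X H Y W"
  obtains v where "v \<in> E (dim W - 1)" "v \<noteq> 0" "W = string v (dim W - 1)" "0 < dim W"
proof -
  have W: "sl2_submodule X H Y W" "W \<noteq> {0}" using assms by (auto simp: irreducible_submodule_def)
  have sW: "subspace W" using W by (simp add: sl2_submodule_def)
  then obtain w where "w \<in> W" "w \<noteq> 0" using W(2) subspace_0 by blast
  then obtain j v where v: "v \<in> W" "v \<noteq> 0" "v \<in> E j" using submodule_lowest_vector[OF W(1)] by blast
  have "((*v) X ^^ l) v \<in> W" for l
    by (induction l) (use v(1) W in \<open>auto simp: sl2_submodule_iff\<close>)
  then have "string v j \<subseteq> W" unfolding string_def by (intro span_minimal sW) auto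
  moreover have "string v j \<noteq> {0}" using string_base[of 0 j v] v by auto
  ultimately have "W = string v j"
    using assms string_submodule[OF v(3)] unfolding irreducible_submodule_def by blast
  then show ?thesis using that[of v] dim_string[OF v(3,2)] v by simp
qed

text \<open>M(d-1) consists of sums of X^l e_l with e_l in E (d-1), since irreducible submodules are
  strings. Y multiplies the terms with 0 < l < d by nonzero factors, so ker Y retains only e_0. The
  shift arises because \<open>E\<close> is indexed by the weight and \<open>lowest\<close> by the
  dimension.\<close>

lemma lowest_eq: assumes d: "1 \<le> d" shows "lowest X H Y d = E (d - 1)"
proof
  show "E (d - 1) \<subseteq> lowest X H Y d"
  proof
    fix v assume v: "v \<in> E (d - 1)"
    show "v \<in> lowest X H Y d"
    proof (cases "v = 0")
      case True then show ?thesis by (simp add: lowest_def isotypic_def span_zero)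
    next
      case False
      have "v \<in> string v (d - 1)" using string_base[of 0] by simp
      moreover have "dim (string v (d - 1)) = d" using dim_string[OF v False] d by simp
      ultimately have "v \<in> isotypic X H Y d"
        unfolding isotypic_def using string_irreducible[OF v False] by (intro span_base) blast
      then show ?thesis using v by (simp add: lowest_def E_def)
    qed
  qed
  show "lowest X H Y d \<subseteq> E (d - 1)"
  proof
    fix x assume x: "x \<in> lowest X H Y d"
    let ?j = "d - 1"
    let ?S = "{\<Sum>l\<le>?j. ((*v) X ^^ l) (e l) |e. \<forall>l. e l \<in> E ?j}"
    have "subspace ?S"
    proof (rule subspaceI)
      have "0 = (\<Sum>l\<le>?j. ((*v) X ^^ l) (0::quat^'n))" by (simp add: linear_0[OF linX])
      moreover have "\<forall>l::nat. (0::quat^'n) \<in> E ?j" using subspace_E subspace_0 by blast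
      ultimately show "0 \<in> ?S" by (intro CollectI exI[of _ "\<lambda>_. 0"] conjI)
      fix x y assume "x \<in> ?S" "y \<in> ?S"
      then obtain a b where ab: "x = (\<Sum>l\<le>?j. ((*v) X ^^ l) (a l))" "y = (\<Sum>l\<le>?j. ((*v) X ^^ l) (b l))"
        "\<forall>l. a l \<in> E ?j" "\<forall>l. b l \<in> E ?j" by blast
      then have "x + y = (\<Sum>l\<le>?j. ((*v) X ^^ l) (a l + b l))" by (simp only: sum.distrib linear_add[OF linX])
      moreover have "\<forall>l. a l + b l \<in> E ?j" using ab subspace_add[OF subspace_E] by blast
      ultimately show "x + y \<in> ?S" by (intro CollectI exI[of _ "\<lambda>l. a l + b l"] conjI)
    next
      fix x r assume "x \<in> ?S"
      then obtain a where a: "x = (\<Sum>l\<le>?j. ((*v) X ^^ l) (a l))" "\<forall>l. a l \<in> E ?j" by blast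
      then have "r *\<^sub>R x = (\<Sum>l\<le>?j. ((*v) X ^^ l) (r *\<^sub>R a l))" by (simp only: scaleR_sum_right linear_scale[OF linX])
      moreover have "\<forall>l. r *\<^sub>R a l \<in> E ?j" using a subspace_scale[OF subspace_E] by blast
      ultimately show "r *\<^sub>R x \<in> ?S" by (intro CollectI exI[of _ "\<lambda>l. r *\<^sub>R a l"] conjI)
    qed
    moreover have "W \<subseteq> ?S" if W: "irreducible_submodule X H Y W" "dim W = d" for W
    proof
      fix w assume w: "w \<in> W"
      obtain v where v: "v \<in> E ?j" "W = string v ?j" using irreducible_string[OF W(1)] W(2) by metis
      obtain a where "w = (\<Sum>l\<le>?j. a l *\<^sub>R ((*v) X ^^ l) v)" using w unfolding v(2) by (rule string_elem)
      then have "w = (\<Sum>l\<le>?j. ((*v) X ^^ l) (a l *\<^sub>R v))" by (simp only: linear_scale[OF linX])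
      moreover have "\<forall>l. a l *\<^sub>R v \<in> E ?j" using v(1) subspace_scale[OF subspace_E] by blast
      ultimately show "w \<in> ?S" by (intro CollectI exI[of _ "\<lambda>l. a l *\<^sub>R v"] conjI)
    qed
    ultimately have "isotypic X H Y d \<subseteq> ?S" unfolding isotypic_def by (intro span_minimal) auto
    then obtain e where e: "x = (\<Sum>l\<le>?j. ((*v) X ^^ l) (e l))" "\<And>l. e l \<in> E ?j"
      using x by (auto simp: lowest_def)
    have "Y *v x = 0" using x by (simp add: lowest_def)
    moreover have "Y *v x = (\<Sum>l<?j. Y *v ((*v) X ^^ Suc l) (e (Suc l)))"
      using e(2)[of 0] unfolding e(1) sum.atMost_shift by (simp add: E_def qmv_add qmv_sum)
    also have "\<dots> = (\<Sum>l<?j. ((*v) X ^^ l) ((real (Suc l) * (real ?j - real l)) *\<^sub>R e (Suc l)))"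
      by (simp only: YX_E[OF e(2)] linear_scale[OF linX])
    also have "\<dots> = (\<Sum>l\<le>?j. ((*v) X ^^ l) ((real (Suc l) * (real ?j - real l)) *\<^sub>R e (Suc l)))"
      by (simp add: lessThan_Suc_atMost[symmetric] linear_0[OF linX])
    ultimately have *: "(\<Sum>l\<le>?j. ((*v) X ^^ l) ((real (Suc l) * (real ?j - real l)) *\<^sub>R e (Suc l))) = 0" by simp
    have "e (Suc l) = 0" if "l < ?j" for l
    proof -
      have "(real (Suc l) * (real ?j - real l)) *\<^sub>R e (Suc l) = 0"
        by (rule string_sum_direct[OF _ *]) (use that e(2) subspace_scale[OF subspace_E] in auto)
      moreover have "real (Suc l) * (real ?j - real l) \<noteq> 0" using that by simp
      ultimately show ?thesis using scaleR_eq_0_iff by blast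
    qed
    then have "x = e 0" unfolding e(1) sum.atMost_shift 
      by (simp add: linear_0[OF linX] del: funpow.simps)
    then show "x \<in> E ?j" using e(2) by simp
  qed
qed

lemma hsubspace_E: "hsubspace (E j)"
  using subspace_E by (auto simp: hsubspace_def E_def qmv_rscale rscale_scaleR[symmetric] linear_neg[OF linear_rscale])

lemma set_parts: "set (parts X H Y) = {d. 1 \<le> d \<and> E (d - 1) \<noteq> {0}}"
  and distinct_parts: "distinct (parts X H Y)"
proof -
  have "0 < part_mult X H Y d \<longleftrightarrow> E (d - 1) \<noteq> {0}" if "1 \<le> d" for d
  proof -
    have "0 < part_mult X H Y d \<longleftrightarrow> 0 < dim (E (d - 1))"
      using hdim_dim[OF hsubspace_E, of "d - 1"] unfolding part_mult_def lowest_eq[OF that] by arith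
    also have "\<dots> \<longleftrightarrow> E (d - 1) \<noteq> {0}" using subspace_0[OF subspace_E] by (auto simp: dim_eq_0 neq0_conv[symmetric] simp del: neq0_conv)
    finally show ?thesis .
  qed
  then have eq: "{d. 1 \<le> d \<and> 0 < part_mult X H Y d} = {d. 1 \<le> d \<and> E (d - 1) \<noteq> {0}}" by blast
  \<comment> \<open>\<open>sorted_list_of_set\<close> needs a finite set; X^(d-1) does not vanish on
    E (d-1), so nilpotency bounds d.\<close>
  have "d \<le> m" if d: "1 \<le> d" "E (d - 1) \<noteq> {0}" for d
  proof (rule ccontr)
    assume "\<not> d \<le> m"
    obtain v where "v \<in> E (d - 1)" "v \<noteq> 0" using d(2) subspace_0[OF subspace_E] by blast
    then have "((*v) X ^^ (d - 1)) v \<noteq> 0" using X_E_nonzero by blast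
    then show False using \<open>\<not> d \<le> m\<close> X_pow_nil by simp
  qed
  then have "{d. 1 \<le> d \<and> E (d - 1) \<noteq> {0}} \<subseteq> {..m}" unfolding atMost_def by blast
  then have "finite {d. 1 \<le> d \<and> E (d - 1) \<noteq> {0}}" by (rule finite_subset) simp
  then show "set (parts X H Y) = {d. 1 \<le> d \<and> E (d - 1) \<noteq> {0}}" "distinct (parts X H Y)"
    unfolding parts_def eq by simp_all
qed

end

lemma sl2_triple_matrices:
  assumes "sl2_triple X H Y" obtains m where "sl2_matrices X H Y m"
proof -
  have l: "lie H X = 2 *\<^sub>R X" "lie H Y = (- 2) *\<^sub>R Y" "lie X Y = H" using assms by (auto simp: sl2_triple_def)
  obtain a where a: "mpow X a = 0" using ad_eigen_nilpotent[OF l(1)] by auto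
  obtain b where b: "mpow Y b = 0" using ad_eigen_nilpotent[OF l(2)] by auto
  have "sl2_matrices X H Y (max a b)"
    unfolding sl2_matrices_def
  proof (rule sl2_rep.intro)
    fix v
    have "H ** X = X ** H + 2 *\<^sub>R X" using l(1) by (simp add: lie_def algebra_simps)
    then show "H *v (X *v v) = X *v (H *v v) + 2 *\<^sub>R (X *v v)"
      by (simp add: matrix_vector_mul_assoc matrix_vector_mult_add_rdistrib qmv_scaleR_left)
    have "H ** Y = Y ** H - 2 *\<^sub>R Y" using l(2) by (simp add: lie_def algebra_simps)
    then show "H *v (Y *v v) = Y *v (H *v v) - 2 *\<^sub>R (Y *v v)"
      by (simp add: matrix_vector_mul_assoc matrix_vector_mult_diff_rdistrib qmv_scaleR_left)
    have "X ** Y = Y ** X + H" using l(3) by (simp add: lie_def algebra_simps)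
    then show "X *v (Y *v v) = Y *v (X *v v) + H *v v"
      by (simp add: matrix_vector_mul_assoc matrix_vector_mult_add_rdistrib)
    show "((*v) X ^^ max a b) v = 0" "((*v) Y ^^ max a b) v = 0"
      unfolding mpow_qmv[symmetric] using mpow_zero_mono[OF _ a, of "max a b"] mpow_zero_mono[OF _ b, of "max a b"] by simp_all
  qed (rule linear_qmv)+
  then show ?thesis by (rule that)
qed

subsection \<open>Frames and block matrices\<close>

lemma hcomb_append: "hcomb (vs @ ws) c = hcomb vs c + hcomb ws (\<lambda>i. c (i + length vs))"
proof -
  have "hcomb (vs @ ws) c = (\<Sum>i<length vs. rscale ((vs @ ws)!i) (c i)) +
      (\<Sum>i<length ws. rscale ((vs @ ws)!(i + length vs)) (c (i + length vs)))"
    unfolding hcomb_def length_append lessThan_atLeast0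
    using sum.atLeastLessThan_concat[of 0 "length vs" "length vs + length ws" "\<lambda>i. rscale ((vs @ ws)!i) (c i)"]
      sum.shift_bounds_nat_ivl[of "\<lambda>i. rscale ((vs @ ws)!i) (c i)" 0 "length vs" "length ws"]
    by (simp add: add.commute)
  then show ?thesis by (simp add: hcomb_def nth_append)
qed

lemma hbasis_append:
  assumes V: "hbasis V vs" and W: "hbasis W ws" and VW: "\<And>x y. x \<in> V \<Longrightarrow> y \<in> W \<Longrightarrow> x + y = 0 \<Longrightarrow> x = 0 \<and> y = 0"
  shows "hbasis {x + y |x y. x \<in> V \<and> y \<in> W} (vs @ ws)"
proof -
  have r: "hcomb vs c \<in> V" "hcomb ws d \<in> W" for c d using V W by (auto simp: hbasis_def)
  have "{x + y |x y. x \<in> V \<and> y \<in> W} \<subseteq> range (hcomb (vs @ ws))"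
  proof clarify
    fix x y assume "x \<in> V" "y \<in> W"
    then obtain c d where cd: "x = hcomb vs c" "y = hcomb ws d" using V W by (auto simp: hbasis_def)
    have "x + y = hcomb (vs @ ws) (\<lambda>i. if i < length vs then c i else d (i - length vs))"
      unfolding hcomb_append cd by (intro arg_cong2[where f="(+)"] hcomb_cong) auto
    then show "x + y \<in> range (hcomb (vs @ ws))" by (simp only: rangeI)
  qed
  moreover have "range (hcomb (vs @ ws)) \<subseteq> {x + y |x y. x \<in> V \<and> y \<in> W}"
    using r by (auto simp: hcomb_append)
  moreover have "c i = 0" if c: "hcomb (vs @ ws) c = 0" "i < length (vs @ ws)" for c i
  proof -
    have "hcomb vs c + hcomb ws (\<lambda>i. c (i + length vs)) = 0" using c(1) by (simp add: hcomb_append)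
    then have 0: "hcomb vs c = 0" "hcomb ws (\<lambda>i. c (i + length vs)) = 0" using VW r by blast+
    show ?thesis
    proof (cases "i < length vs")
      case True then show ?thesis using 0(1) V by (auto simp: hbasis_def)
    next
      case False
      then have "i - length vs < length ws" using c(2) by simp
      then have "c (i - length vs + length vs) = 0" using 0(2) W unfolding hbasis_def by blast
      then show ?thesis using False by simp
    qed
  qed
  ultimately show ?thesis unfolding hbasis_def by blast
qed

lemma hbasis_concat:
  fixes b :: "'p \<Rightarrow> (quat^'n) list"
  assumes "distinct ps" "\<And>p. p \<in> set ps \<Longrightarrow> hbasis (W p) (b p)"
    "\<And>x. (\<And>p. p \<in> set ps \<Longrightarrow> x p \<in> W p) \<Longrightarrow> (\<Sum>p\<in>set ps. x p) = 0 \<Longrightarrow> (\<forall>p\<in>set ps. x p = 0)"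
  shows "hbasis {\<Sum>p\<in>set ps. x p |x. \<forall>p\<in>set ps. x p \<in> W p} (concat (map b ps))"
  using assms
proof (induction ps)
  case Nil
  have "range (hcomb []) = {0 :: quat^'n}" by (auto simp: hcomb_def)
  then show ?case by (simp add: hbasis_def)
next
  case (Cons p ps)
  let ?V = "{\<Sum>p\<in>set ps. x p |x. \<forall>p\<in>set ps. x p \<in> W p}"
  have 0: "0 \<in> W p" using hbasis_hsubspace[OF Cons.prems(2)[of p]] by (simp add: hsubspace_def subspace_0)
  have IH: "hbasis ?V (concat (map b ps))"
  proof (rule Cons.IH)
    fix x assume x: "\<And>q. q \<in> set ps \<Longrightarrow> x q \<in> W q" "(\<Sum>q\<in>set ps. x q) = 0"
    have "(\<Sum>q\<in>set ps. (x(p := 0)) q) = (\<Sum>q\<in>set ps. x q)"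
      using Cons.prems(1) by (intro sum.cong) auto
    then have "\<forall>q\<in>set (p # ps). (x(p := 0)) q = 0"
      using x 0 Cons.prems(1) by (intro Cons.prems(3)) auto
    then show "\<forall>q\<in>set ps. x q = 0" using Cons.prems(1) by (auto split: if_splits)
  qed (use Cons.prems in auto)
  have "hbasis {x + y |x y. x \<in> W p \<and> y \<in> ?V} (b p @ concat (map b ps))"
  proof (rule hbasis_append[OF Cons.prems(2) IH])
    fix x y assume x: "x \<in> W p" and y: "y \<in> ?V" and s: "x + y = 0"
    then obtain z where z: "y = (\<Sum>q\<in>set ps. z q)" "\<And>q. q \<in> set ps \<Longrightarrow> z q \<in> W q" by blast
    have "(\<Sum>q\<in>set ps. (z(p := x)) q) = (\<Sum>q\<in>set ps. z q)"
      using Cons.prems(1) by (intro sum.cong) auto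
    then have "\<forall>q\<in>set (p # ps). (z(p := x)) q = 0"
      using x z s Cons.prems(1) by (intro Cons.prems(3)) auto
    then have "x = 0" by simp
    then show "x = 0 \<and> y = 0" using s by simp
  qed simp
  moreover have "{x + y |x y. x \<in> W p \<and> y \<in> ?V} = {\<Sum>q\<in>set (p # ps). x q |x. \<forall>q\<in>set (p # ps). x q \<in> W q}"
    (is "?A = ?B")
  proof
    show "?A \<subseteq> ?B"
    proof clarify
      fix x z assume x: "x \<in> W p" and z: "\<forall>q\<in>set ps. z q \<in> W q"
      have "(\<Sum>q\<in>set ps. (z(p := x)) q) = (\<Sum>q\<in>set ps. z q)"
        using Cons.prems(1) by (intro sum.cong) auto
      then have "x + (\<Sum>q\<in>set ps. z q) = (\<Sum>q\<in>set (p # ps). (z(p := x)) q)" using Cons.prems(1) by simp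
      moreover have "\<forall>q\<in>set (p # ps). (z(p := x)) q \<in> W q" using x z by simp
      ultimately show "\<exists>y. x + (\<Sum>q\<in>set ps. z q) = (\<Sum>q\<in>set (p # ps). y q) \<and> (\<forall>q\<in>set (p # ps). y q \<in> W q)"
        by blast
    qed
    show "?B \<subseteq> ?A" using Cons.prems(1) by auto
  qed
  ultimately show ?case by simp
qed

lemma hortho_append:
  "hortho (vs @ ws) \<longleftrightarrow> hortho vs \<and> hortho ws \<and> (\<forall>x\<in>set vs. \<forall>y\<in>set ws. hinner x y = 0)"
proof
  assume h: "hortho (vs @ ws)"
  have n: "(vs @ ws)!(length vs + i) = ws!i" for i by (simp add: nth_append)
  have "hinner (vs!i) (vs!j) = (if i = j then 1 else 0)" if "i < length vs" "j < length vs" for i j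
    using h that unfolding hortho_def by (metis length_append nth_append trans_less_add1)
  moreover have "hinner (ws!i) (ws!j) = (if i = j then 1 else 0)" if "i < length ws" "j < length ws" for i j
    using h[unfolded hortho_def, rule_format, of "length vs + i" "length vs + j"] that by (simp add: n)
  moreover have "hinner (vs!i) (ws!j) = 0" if "i < length vs" "j < length ws" for i j
    using h[unfolded hortho_def, rule_format, of i "length vs + j"] that by (simp add: n nth_append)
  ultimately show "hortho vs \<and> hortho ws \<and> (\<forall>x\<in>set vs. \<forall>y\<in>set ws. hinner x y = 0)"
    unfolding hortho_def by (auto simp: in_set_conv_nth)
next
  assume h: "hortho vs \<and> hortho ws \<and> (\<forall>x\<in>set vs. \<forall>y\<in>set ws. hinner x y = 0)"
  then have "hinner y x = 0" if "x \<in> set vs" "y \<in> set ws" for x y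
    using that hinner_cnj[of x y] by (metis quat_cnj_0)
  with h show "hortho (vs @ ws)"
    unfolding hortho_def by (auto simp: nth_append)
qed

lemma hortho_concat:
  assumes "distinct ps" "hortho (concat (map b ps))"
  shows "p \<in> set ps \<Longrightarrow> hortho (b p)"
    and "p \<in> set ps \<Longrightarrow> q \<in> set ps \<Longrightarrow> p \<noteq> q \<Longrightarrow> x \<in> set (b p) \<Longrightarrow> y \<in> set (b q) \<Longrightarrow> hinner x y = 0"
proof -
  have "(\<forall>p\<in>set ps. hortho (b p)) \<and>
    (\<forall>p\<in>set ps. \<forall>q\<in>set ps. p \<noteq> q \<longrightarrow> (\<forall>x\<in>set (b p). \<forall>y\<in>set (b q). hinner x y = 0))"
    using assms
  proof (induction ps)
    case (Cons p ps)
    then have h: "hortho (b p)" "hortho (concat (map b ps))"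
      "\<And>x y. x \<in> set (b p) \<Longrightarrow> y \<in> set (concat (map b ps)) \<Longrightarrow> hinner x y = 0"
      by (auto simp: hortho_append)
    have p: "hinner x y = 0 \<and> hinner y x = 0" if "x \<in> set (b p)" "q \<in> set ps" "y \<in> set (b q)" for x y q
    proof -
      have "y \<in> set (concat (map b ps))" using that by auto
      then show ?thesis using h(3) hinner_cnj[of x y] that(1) by (metis quat_cnj_0)
    qed
    have IH: "\<forall>p\<in>set ps. hortho (b p)"
      "\<And>q r x y. q \<in> set ps \<Longrightarrow> r \<in> set ps \<Longrightarrow> q \<noteq> r \<Longrightarrow> x \<in> set (b q) \<Longrightarrow> y \<in> set (b r) \<Longrightarrow> hinner x y = 0"
      using Cons h by auto
    have "hinner x y = 0" if "q \<in> set (p # ps)" "r \<in> set (p # ps)" "q \<noteq> r" "x \<in> set (b q)" "y \<in> set (b r)" for q r x y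
      using that p IH(2) by (metis set_ConsD)
    with h(1) IH(1) show ?case by auto
  qed simp
  then show "p \<in> set ps \<Longrightarrow> hortho (b p)"
    and "p \<in> set ps \<Longrightarrow> q \<in> set ps \<Longrightarrow> p \<noteq> q \<Longrightarrow> x \<in> set (b p) \<Longrightarrow> y \<in> set (b q) \<Longrightarrow> hinner x y = 0"
    by blast+
qed

text \<open>Flattens the double concatenation of \<open>total_basis\<close>, so that the blocks X^l
  L(d-1) form one indexed family in the order of the basis.\<close>

definition pairs :: "nat list \<Rightarrow> (nat \<times> nat) list" where
  "pairs ds = concat (map (\<lambda>d. map (Pair d) [0..<d]) ds)"

lemma set_pairs: "set (pairs ds) = {(d, l). d \<in> set ds \<and> l < d}"
  by (auto simp: pairs_def)

lemma distinct_pairs: "distinct ds \<Longrightarrow> distinct (pairs ds)"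
  by (induction ds) (auto simp: pairs_def distinct_map inj_on_def)

lemma sum_pairs: "(\<Sum>p\<in>set (pairs ds). f p) = (\<Sum>d\<in>set ds. \<Sum>l<d. f (d, l))"
proof -
  have "set (pairs ds) = Sigma (set ds) (\<lambda>d. {..<d})" by (auto simp: set_pairs)
  then show ?thesis by (simp add: sum.Sigma)
qed

text \<open>\<open>total_basis\<close> freed from the triple: the strings of an arbitrary matrix N
  from given starting vectors. It serves for X, for X in other coordinates and for every other point
  of the orbit.\<close>

definition frame :: "quat^'n^'n \<Rightarrow> nat list \<Rightarrow> (nat \<Rightarrow> (quat^'n) list) \<Rightarrow> (quat^'n) list" where
  "frame N ds w = concat (map (\<lambda>(d, l). map ((*v) (mpow N l)) (w d)) (pairs ds))"

lemma total_basis_frame: "total_basis X H Y v = frame X (parts X H Y) v"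
proof -
  have eq: "concat (map f (pairs ds)) = concat (map (\<lambda>d. concat (map (\<lambda>l. f (d, l)) [0..<d])) ds)" for ds and f :: "nat \<times> nat \<Rightarrow> 'b list"
    by (induction ds) (simp_all add: pairs_def o_def)
  show ?thesis unfolding frame_def eq total_basis_def funpow_qmv by simp
qed

lemma length_frame: "length (frame N ds w) = (\<Sum>(d, l)\<leftarrow>pairs ds. length (w d))"
  by (simp add: frame_def length_concat o_def case_prod_unfold)

lemma set_frame: "set (frame N ds w) = {mpow N l *v x |d l x. d \<in> set ds \<and> l < d \<and> x \<in> set (w d)}"
  unfolding frame_def using set_pairs[of ds] by fastforce

text \<open>The right side sees \<open>w d\<close> only through \<open>osum (w d)\<close>, so
  different orthonormal bases of the same generator space give the same h h*.\<close>

lemma osum_frame: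
  assumes "distinct ds"
  shows "osum (frame N ds w) = (\<Sum>d\<in>set ds. \<Sum>l<d. mpow N l ** osum (w d) ** adj (mpow N l))"
proof -
  let ?F = "\<lambda>(d, l). mpow N l ** osum (w d) ** adj (mpow N l)"
  have "osum (frame N ds w) = sum_list (map ?F (pairs ds))"
    unfolding frame_def osum_concat map_map by (rule arg_cong[where f=sum_list], rule map_cong) (auto simp: osum_map)
  also have "\<dots> = (\<Sum>p\<in>set (pairs ds). ?F p)"
    by (rule sum_list_distinct_conv_sum_set[OF distinct_pairs[OF assms]])
  finally show ?thesis by (simp add: sum_pairs)
qed

section \<open>Coordinates with respect to a list basis\<close>

lemma index_pos_bij: "bij_betw (index_pos :: 'n::{finite,linorder} \<Rightarrow> nat) UNIV {..<CARD('n)}"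
proof -
  have mono: "index_pos i < index_pos j" if "i < j" for i j :: 'n
    unfolding index_pos_def using that by (intro psubset_card_mono) (auto dest: less_trans)
  have inj: "inj (index_pos :: 'n \<Rightarrow> nat)"
    by (rule injI) (metis less_irrefl linorder_neqE mono)
  have "index_pos i < CARD('n)" for i :: 'n
    unfolding index_pos_def by (intro psubset_card_mono) auto
  then have "range (index_pos :: 'n \<Rightarrow> nat) \<subseteq> {..<CARD('n)}" by auto
  then have "range (index_pos :: 'n \<Rightarrow> nat) = {..<CARD('n)}"
    using inj by (intro card_subset_eq) (simp_all add: card_image)
  then show ?thesis using inj by (simp add: bij_betw_def)
qed

lemma sum_index_pos: "(\<Sum>i<CARD('n). f i) = (\<Sum>i\<in>UNIV. f (index_pos (i :: 'n::{finite,linorder})))"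
  by (rule sum.reindex_bij_betw[OF index_pos_bij, symmetric])

lemma index_pos_less: "index_pos (i :: 'n::{finite,linorder}) < CARD('n)"
  using index_pos_bij by (auto simp: bij_betw_def)

lemma index_pos_ex: "k < CARD('n) \<Longrightarrow> \<exists>i :: 'n::{finite,linorder}. k = index_pos i"
  using index_pos_bij[where 'n='n] by (auto simp: bij_betw_def)

definition basis_matrix :: "(quat^('n::{finite,linorder})) list \<Rightarrow> quat^('n::{finite,linorder})^('n::{finite,linorder})" where
  "basis_matrix B = (\<chi> i j. (B ! index_pos j) $ i)"

lemma column_basis_matrix: "column j (basis_matrix B) = B ! index_pos j"
  by (simp add: column_def basis_matrix_def Finite_Cartesian_Product.vec_eq_iff)

lemma hcomb_basis_matrix:
  fixes B :: "(quat^('n::{finite,linorder})) list"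
  assumes "length B = CARD('n)" shows "hcomb B c = basis_matrix B *v (\<chi> j. c (index_pos j))"
  by (simp add: hcomb_def assms sum_index_pos qmv_columns column_basis_matrix)

lemma basis_matrix_map:
  fixes B :: "(quat^('n::{finite,linorder})) list"
  assumes "length B = CARD('n)" shows "basis_matrix (map ((*v) A) B) = A ** basis_matrix B"
  by (simp add: matrix_eq_columns column_mult column_basis_matrix assms index_pos_less)

lemma range_hcomb_basis_matrix:
  fixes B :: "(quat^('n::{finite,linorder})) list"
  assumes "length B = CARD('n)" shows "range (hcomb B) = range ((*v) (basis_matrix B))"
proof
  show "range (hcomb B) \<subseteq> range ((*v) (basis_matrix B))"
    by (auto simp: hcomb_basis_matrix[OF assms])
  show "range ((*v) (basis_matrix B)) \<subseteq> range (hcomb B)"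
  proof clarify
    fix x :: "quat^('n::{finite,linorder})"
    have inj: "inj (index_pos :: 'n \<Rightarrow> nat)" using index_pos_bij by (auto simp: bij_betw_def)
    have "basis_matrix B *v x = hcomb B (\<lambda>k. x $ inv_into UNIV index_pos k)"
      by (simp add: hcomb_basis_matrix[OF assms] inv_f_f[OF inj])
    then show "basis_matrix B *v x \<in> range (hcomb B)" by simp
  qed
qed

lemma invertible_surj: "range ((*v) A) = UNIV \<Longrightarrow> invertible A" for A :: "quat^'n^'n"
  unfolding invertible_iff_ker
  using linear_surjective_imp_injective[OF linear_qmv _ refl, of A] linear_injective_0[OF linear_qmv, of A] by blast

lemma invertible_basis_matrix:
  fixes B :: "(quat^('n::{finite,linorder})) list"
  assumes "length B = CARD('n)" "range (hcomb B) = UNIV" shows "invertible (basis_matrix B)"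
  using assms by (intro invertible_surj) (simp add: range_hcomb_basis_matrix)

lemma dim_quat_vec: "dim (UNIV :: (quat^'n) set) = 4 * CARD('n)"
  by (simp add: DIM_quat)

lemma hbasis_UNIV_length: "hbasis UNIV (B :: (quat^'n) list) \<Longrightarrow> length B = CARD('n)"
  using hbasis_dim[of UNIV B] unfolding dim_quat_vec by simp

lemma hbasis_UNIV_invertible: "hbasis UNIV B \<Longrightarrow> invertible (basis_matrix B)"
  by (rule invertible_basis_matrix[OF hbasis_UNIV_length]) (auto simp: hbasis_def)

lemma hortho_UNIV:
  fixes B :: "(quat^'n) list"
  assumes "hortho B" "length B = CARD('n)" shows "hbasis UNIV B"
proof -
  have h: "hbasis (range (hcomb B)) B" by (rule hortho_hbasis[OF assms(1)])
  then have "dim (range (hcomb B)) = DIM(quat^'n)"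
    using hbasis_dim[OF h] dim_quat_vec[where 'n='n] assms(2) by simp
  then have "span (range (hcomb B)) = UNIV" by (simp only: dim_eq_full)
  moreover have "span (range (hcomb B)) = range (hcomb B)"
    using hbasis_hsubspace[OF h] unfolding hsubspace_def by (simp only: span_eq_iff)
  ultimately show ?thesis using h by simp
qed

text \<open>Column by column the defining equations say g b = b A for the basis matrix b, so the
  definite description has exactly the solution b^-1 g b.\<close>

lemma Lambda_eq:
  assumes "invertible (basis_matrix B)"
  shows "Lambda B g = matrix_inv (basis_matrix B) ** g ** basis_matrix B"
    and "g ** basis_matrix B = basis_matrix B ** A \<Longrightarrow> Lambda B g = A"
proof -
  let ?b = "basis_matrix B"
  have eq: "(\<forall>j. g *v (B ! index_pos j) = (\<Sum>i\<in>UNIV. rscale (B ! index_pos i) (A$i$j))) \<longleftrightarrow> g ** ?b = ?b ** A" for A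
    by (simp add: matrix_eq_columns column_mult column_basis_matrix qmv_columns[of ?b])
      (simp add: column_def)
  have u: "g ** ?b = ?b ** A \<longleftrightarrow> A = matrix_inv ?b ** g ** ?b" for A
    using matrix_inv_mult[OF assms] by (metis matrix_mul_assoc matrix_mul_lid)
  show L: "Lambda B g = matrix_inv ?b ** g ** ?b" unfolding Lambda_def eq u by simp
  show "g ** ?b = ?b ** A \<Longrightarrow> Lambda B g = A" unfolding L u by simp
qed

text \<open>A relation because it also asserts that g maps \<open>vs\<close> into its own right
  span; column j of A holds the right coordinates of the image of \<open>vs!j\<close>.\<close>

definition acts :: "quat^'n^'n \<Rightarrow> (quat^'n) list \<Rightarrow> quat mat \<Rightarrow> bool" where
  "acts g vs A \<longleftrightarrow> A \<in> carrier_mat (length vs) (length vs) \<and>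
     (\<forall>j<length vs. g *v (vs!j) = hcomb vs (\<lambda>i. A $$ (i, j)))"

lemma acts_append:
  assumes A: "acts g vs A" and B: "acts g ws B"
  shows "acts g (vs @ ws) (four_block_mat A (0\<^sub>m (dim_row A) (dim_col B)) (0\<^sub>m (dim_row B) (dim_col A)) B)"
    (is "acts g _ ?M")
  unfolding acts_def
proof (intro conjI allI impI)
  have dA: "dim_row A = length vs" "dim_col A = length vs" and dB: "dim_row B = length ws" "dim_col B = length ws"
    using A B by (auto simp: acts_def)
  show "?M \<in> carrier_mat (length (vs @ ws)) (length (vs @ ws))" using dA dB by auto
  fix j assume j: "j < length (vs @ ws)"
  show "g *v ((vs @ ws)!j) = hcomb (vs @ ws) (\<lambda>i. ?M $$ (i, j))"
  proof (cases "j < length vs")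
    case True
    have "hcomb vs (\<lambda>i. ?M $$ (i, j)) = g *v (vs!j)"
      using A True dA dB unfolding acts_def by (auto intro: hcomb_cong)
    moreover have "hcomb ws (\<lambda>i. ?M $$ (i + length vs, j)) = hcomb ws (\<lambda>i. 0)"
      by (rule hcomb_cong) (use True dA dB in simp)
    ultimately show ?thesis using True by (simp add: hcomb_append nth_append)
  next
    case False
    have "hcomb ws (\<lambda>i. ?M $$ (i + length vs, j)) = hcomb ws (\<lambda>i. B $$ (i, j - length vs))"
      by (rule hcomb_cong) (use False j dA dB in simp)
    also have "\<dots> = g *v (ws!(j - length vs))" using B False j unfolding acts_def by auto
    moreover have "hcomb vs (\<lambda>i. ?M $$ (i, j)) = hcomb vs (\<lambda>i. 0)"
      by (rule hcomb_cong) (use False j dA dB in simp)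
    ultimately show ?thesis using False by (simp add: hcomb_append nth_append)
  qed
qed

lemma acts_concat: "(\<And>p. p \<in> set ps \<Longrightarrow> acts g (b p) (A p)) \<Longrightarrow>
    acts g (concat (map b ps)) (diag_block_mat (map A ps))"
proof (induction ps)
  case Nil then show ?case by (simp add: acts_def)
next
  case (Cons p ps)
  then have "acts g (b p) (A p)" "acts g (concat (map b ps)) (diag_block_mat (map A ps))" by auto
  from acts_append[OF this] show ?case by (simp add: Let_def)
qed

lemma acts_map:
  assumes "acts g vs A" "N ** g = g ** N" shows "acts g (map ((*v) N) vs) A"
proof -
  have "g *v (N *v x) = N *v (g *v x)" for x by (simp add: matrix_vector_mul_assoc assms(2))
  then show ?thesis using assms(1) by (auto simp: acts_def hcomb_map)
qed

lemma mpow_commute: "N ** g = g ** N \<Longrightarrow> mpow N l ** g = g ** mpow N l"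
  by (induction l) (simp_all add: mpow_Suc, metis matrix_mul_assoc)

lemma block_D_pairs: "block_D ds A = typed_matrix (diag_block_mat (map (\<lambda>(d, l). A d) (pairs ds)))"
proof -
  have "concat (map (\<lambda>d. replicate d (A d)) ds) = map (\<lambda>(d, l). A d) (pairs ds)"
    by (induction ds) (auto simp: pairs_def map_replicate_const o_def)
  then show ?thesis by (simp add: block_D_def)
qed

text \<open>As g commutes with N, its matrix on \<open>w d\<close> reappears on every translate of
  \<open>w d\<close> by a power of N; this is the d-fold repetition of blocks in
  \<open>block_D\<close>.\<close>

lemma acts_frame:
  assumes "\<And>d. d \<in> set ds \<Longrightarrow> acts g (w d) (A d)" "N ** g = g ** N"
  shows "acts g (frame N ds w) (diag_block_mat (map (\<lambda>(d, l). A d) (pairs ds)))"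
  unfolding frame_def
proof (rule acts_concat)
  fix p assume "p \<in> set (pairs ds)"
  then show "acts g (case p of (d, l) \<Rightarrow> map ((*v) (mpow N l)) (w d)) (case p of (d, l) \<Rightarrow> A d)"
    using assms by (auto simp: set_pairs intro!: acts_map mpow_commute)
qed

lemma acts_Lambda:
  fixes B :: "(quat^('n::{finite,linorder})) list"
  assumes "acts g B M" "hbasis UNIV B" shows "Lambda B g = typed_matrix M"
proof (rule Lambda_eq(2)[OF hbasis_UNIV_invertible[OF assms(2)]])
  have l: "length B = CARD('n)" by (rule hbasis_UNIV_length[OF assms(2)])
  show "g ** basis_matrix B = basis_matrix B ** typed_matrix M"
    unfolding matrix_eq_columns column_mult column_basis_matrix
  proof
    fix j :: 'n
    have "g *v (B ! index_pos j) = hcomb B (\<lambda>i. M $$ (i, index_pos j))"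
      using assms(1) index_pos_less[of j] by (simp add: acts_def l)
    then show "g *v (B ! index_pos j) = basis_matrix B *v column j (typed_matrix M)"
      by (simp add: hcomb_basis_matrix l column_def typed_matrix_def)
  qed
qed

lemma Lambda_frame:
  assumes "hbasis UNIV (frame N ds w)" "\<And>d. d \<in> set ds \<Longrightarrow> acts g (w d) (A d)" "N ** g = g ** N"
  shows "Lambda (frame N ds w) g = block_D ds A"
  unfolding block_D_pairs by (intro acts_Lambda acts_frame assms)

subsection \<open>Nilpotent orbits\<close>

lemma mpow_add: "mpow N (k + l) = mpow N k ** mpow N l"
  by (induction k) (simp_all add: mpow_Suc matrix_mul_assoc)

lemma mpow_Suc_right: "mpow N (Suc k) = mpow N k ** N"
  using mpow_add[of N k 1] by (simp add: mpow_Suc)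

lemma mpow_conj: "N ** g = g ** N' \<Longrightarrow> mpow N k ** g = g ** mpow N' k"
  by (induction k) (simp_all add: mpow_Suc, metis matrix_mul_assoc)

lemma continuous_on_mpow [continuous_intros]:
  "continuous_on S f \<Longrightarrow> continuous_on S (\<lambda>x. mpow (f x) k)"
  by (induction k) (auto simp: mpow_Suc intro!: continuous_intros)

lemma tendsto_mpow: "(f \<longlongrightarrow> N) F \<Longrightarrow> ((\<lambda>x. mpow (f x) k) \<longlongrightarrow> mpow N k) F"
  by (induction k) (auto simp: mpow_Suc intro!: tendsto_qmult)

definition ker_pow :: "quat^'n^'n \<Rightarrow> nat \<Rightarrow> (quat^'n) set" where
  "ker_pow N k = {x. mpow N k *v x = 0}"

text \<open>The generators of the Jordan strings of length d, made canonical by means of the inner product.\<close>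

definition gens :: "quat^'n^'n \<Rightarrow> nat \<Rightarrow> (quat^'n) set" where
  "gens N d = {x \<in> ker_pow N d. (\<forall>y\<in>ker_pow N (d - 1). inner y x = 0) \<and>
     (\<forall>z\<in>ker_pow N (d + 1). inner (N *v z) x = 0)}"

lemma hsubspace_ker_pow: "hsubspace (ker_pow N k)"
  by (auto simp: hsubspace_def ker_pow_def qmv_rscale intro!: subspace_ker linear_qmv)

lemma ker_pow_mono: "k \<le> l \<Longrightarrow> ker_pow N k \<subseteq> ker_pow N l"
proof
  fix x assume "k \<le> l" "x \<in> ker_pow N k"
  then show "x \<in> ker_pow N l"
    using mpow_add[of N "l - k" k] by (simp add: ker_pow_def matrix_vector_mul_assoc[symmetric])
qed

lemma ker_pow_N: "z \<in> ker_pow N (Suc k) \<Longrightarrow> N *v z \<in> ker_pow N k"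
  by (simp add: ker_pow_def mpow_Suc_right matrix_vector_mul_assoc)

lemma hsubspace_gens: "hsubspace (gens N d)"
proof -
  have "subspace (gens N d)"
    using hsubspace_ker_pow[of N d] unfolding gens_def hsubspace_def
    by (intro subspaceI) (auto simp: subspace_def inner_add_right)
  moreover have "rscale x q \<in> gens N d" if x: "x \<in> gens N d" for x q
  proof -
    have "inner y (rscale x q) = inner (rscale y (quat_cnj q)) x" for y
      by (simp add: inner_rscale)
    moreover have "N *v rscale z q = rscale (N *v z) q" for z q by (rule qmv_rscale)
    ultimately show ?thesis
      using x hsubspace_ker_pow[of N d] hsubspace_ker_pow[of N "d - 1"] hsubspace_ker_pow[of N "d + 1"]
      unfolding gens_def hsubspace_def by (simp del: qmv_rscale) (metis qmv_rscale)
  qed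
  ultimately show ?thesis by (simp add: hsubspace_def)
qed

lemma subspace_gens_complement:
  "subspace {a + N *v b |a b. a \<in> ker_pow N (d - 1) \<and> b \<in> ker_pow N (d + 1)}"
proof -
  have "subspace ((*v) N ` ker_pow N (d + 1))"
    using hsubspace_ker_pow by (intro linear_subspace_image linear_qmv) (auto simp: hsubspace_def)
  then have "subspace {x + y |x y. x \<in> ker_pow N (d - 1) \<and> y \<in> (*v) N ` ker_pow N (d + 1)}"
    using hsubspace_ker_pow by (intro subspace_sums) (auto simp: hsubspace_def)
  moreover have "{x + y |x y. x \<in> ker_pow N (d - 1) \<and> y \<in> (*v) N ` ker_pow N (d + 1)} =
      {a + N *v b |a b. a \<in> ker_pow N (d - 1) \<and> b \<in> ker_pow N (d + 1)}" by blast
  ultimately show ?thesis by simp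
qed

lemma gens_complement_subset:
  assumes "1 \<le> d"
  shows "{a + N *v b |a b. a \<in> ker_pow N (d - 1) \<and> b \<in> ker_pow N (d + 1)} \<subseteq> ker_pow N d"
proof clarify
  fix a b assume "a \<in> ker_pow N (d - 1)" "b \<in> ker_pow N (d + 1)"
  then have "a \<in> ker_pow N d" "N *v b \<in> ker_pow N d"
    using ker_pow_mono[of "d - 1" d N] ker_pow_N[of b N d] by auto
  then show "a + N *v b \<in> ker_pow N d"
    using hsubspace_ker_pow[of N d] by (auto simp: hsubspace_def intro: subspace_add)
qed

text \<open>The two conditions become orthogonality to one subspace of ker N^d, the form to which
  the dimension formula and the orthogonal decomposition apply.\<close>

lemma gens_orthogonal:
  "gens N d = {y \<in> ker_pow N d. \<forall>x\<in>{a + N *v b |a b. a \<in> ker_pow N (d - 1) \<and> b \<in> ker_pow N (d + 1)}.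
      real_inner_class.orthogonal x y}" (is "_ = ?R")
proof
  show "gens N d \<subseteq> ?R"
    by (auto simp: gens_def real_inner_class.orthogonal_def inner_add_left)
  have 0: "0 \<in> ker_pow N k" for k by (simp add: ker_pow_def)
  show "?R \<subseteq> gens N d"
  proof
    fix y assume y: "y \<in> ?R"
    then have *: "inner (a + N *v b) y = 0" if "a \<in> ker_pow N (d - 1)" "b \<in> ker_pow N (d + 1)" for a b
      using that by (auto simp: real_inner_class.orthogonal_def)
    show "y \<in> gens N d" using y *[OF _ 0] *[OF 0] by (simp add: gens_def)
  qed
qed

lemma dim_image_invertible: "invertible g \<Longrightarrow> dim ((*v) g ` W) = dim W" for g :: "quat^'n^'n"
  by (rule dim_image_eq[OF linear_qmv])
    (metis inj_onI linear_injective_0[OF linear_qmv] injD invertible_iff_ker)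

lemma ker_pow_conj:
  fixes g :: "quat^'n^'n"
  assumes "invertible g" "N ** g = g ** N'" shows "ker_pow N k = (*v) g ` ker_pow N' k"
proof -
  have gg: "g *v (matrix_inv g *v x) = x" for x
    by (simp add: matrix_vector_mul_assoc matrix_inv_mult assms(1))
  have "mpow N k *v (g *v x) = 0 \<longleftrightarrow> mpow N' k *v x = 0" for x
    using assms(1) unfolding matrix_vector_mul_assoc mpow_conj[OF assms(2)]
    by (metis invertible_iff_ker matrix_vector_mul_assoc matrix_vector_mult_0_right)
  then show ?thesis unfolding ker_pow_def using gg by (auto simp: image_iff) metis
qed

text \<open>Conjugation need not carry \<open>gens\<close> to \<open>gens\<close>, as g need not
  preserve orthogonality. It does carry the kernels and the subspace being complemented, so the
  dimension is still invariant.\<close>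

lemma dim_gens_conj:
  fixes g :: "quat^'n^'n"
  assumes g: "invertible g" "N ** g = g ** N'" and d: "1 \<le> d"
  shows "dim (gens N d) = dim (gens N' d)"
proof -
  let ?F = "\<lambda>N. {a + N *v b |a b. a \<in> ker_pow N (d - 1) \<and> b \<in> ker_pow N (d + 1)}"
  have dim: "dim (gens N d) + dim (?F N) = dim (ker_pow N d)" for N :: "quat^'n^'n"
    unfolding gens_orthogonal
    using hsubspace_ker_pow[of N d]
    by (intro dim_subspace_orthogonal_to_vectors subspace_gens_complement gens_complement_subset[OF d])
      (simp add: hsubspace_def)
  have Ng: "N *v (g *v x) = g *v (N' *v x)" for x by (simp add: matrix_vector_mul_assoc g(2))
  have "?F N = (*v) g ` ?F N'"
    unfolding ker_pow_conj[OF g]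
  proof (intro equalityI subsetI)
    fix x assume "x \<in> {a + N *v b |a b. a \<in> (*v) g ` ker_pow N' (d - 1) \<and> b \<in> (*v) g ` ker_pow N' (d + 1)}"
    then obtain a b where "x = g *v a + N *v (g *v b)" "a \<in> ker_pow N' (d - 1)" "b \<in> ker_pow N' (d + 1)" by blast
    then show "x \<in> (*v) g ` ?F N'" unfolding Ng qmv_add[symmetric] by blast
  next
    fix x assume "x \<in> (*v) g ` ?F N'"
    then obtain a b where "x = g *v (a + N' *v b)" "a \<in> ker_pow N' (d - 1)" "b \<in> ker_pow N' (d + 1)" by blast
    then show "x \<in> {a + N *v b |a b. a \<in> (*v) g ` ker_pow N' (d - 1) \<and> b \<in> (*v) g ` ker_pow N' (d + 1)}"
      unfolding qmv_add Ng[symmetric] by blast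
  qed
  then have "dim (?F N) = dim (?F N')" by (simp add: dim_image_invertible g)
  moreover have "dim (ker_pow N d) = dim (ker_pow N' d)"
    by (simp add: ker_pow_conj[OF g] dim_image_invertible g)
  ultimately show ?thesis using dim[of N] dim[of N'] by simp
qed

text \<open>Equal to \<open>orbit\<close> by scaling (\<open>orbit_eq_gl_orbit\<close>); this form
  admits Jordan bases without normalising their reduced norms.\<close>

definition gl_orbit :: "quat^'n^'n \<Rightarrow> (quat^'n^'n) set" where
  "gl_orbit X = {g ** X ** matrix_inv g |g. invertible g}"

lemma gl_orbit_iff: "N \<in> gl_orbit X \<longleftrightarrow> (\<exists>g. invertible g \<and> N ** g = g ** X)" for X :: "quat^'n^'n"
proof -
  have "N = g ** X ** matrix_inv g \<longleftrightarrow> N ** g = g ** X" if "invertible g" for g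
    using matrix_inv_mult[OF that] by (metis matrix_mul_assoc matrix_mul_rid)
  then show ?thesis by (auto simp: gl_orbit_def)
qed

lemma continuous_on_proj_ker_pow: "continuous_on (gl_orbit X) (\<lambda>N. proj (ker_pow N k))" for X :: "quat^'n^'n"
proof (rule continuous_on_proj)
  show "dim (ker_pow N k) = dim (ker_pow X k)" if N: "N \<in> gl_orbit X" for N
  proof -
    obtain g where g: "invertible g" "N ** g = g ** X" using N by (auto simp: gl_orbit_iff)
    show ?thesis unfolding ker_pow_conj[OF g] by (rule dim_image_invertible[OF g(1)])
  qed
  fix N s x z assume *: "N \<in> gl_orbit X" "s \<longlonglongrightarrow> N" "\<And>n. x n \<in> ker_pow (s n) k" "x \<longlonglongrightarrow> (z :: quat^'n)"
  have "(\<lambda>n. mpow (s n) k *v x n) \<longlonglongrightarrow> mpow N k *v z" by (intro tendsto_qmv tendsto_mpow *)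
  then show "z \<in> ker_pow N k" using *(3) by (simp add: ker_pow_def LIMSEQ_const_iff)
qed (rule hsubspace_ker_pow)

text \<open>Orthogonality passes to the limit because each test vector y in a kernel of N is the
  limit of its projections to the corresponding kernels of the approximating matrices.\<close>

lemma continuous_on_proj_gens:
  fixes X :: "quat^'n^'n"
  assumes d: "1 \<le> d" shows "continuous_on (gl_orbit X) (\<lambda>N. proj (gens N d))"
proof (rule continuous_on_proj)
  show "dim (gens N d) = dim (gens X d)" if "N \<in> gl_orbit X" for N
    using that dim_gens_conj[OF _ _ d] by (auto simp: gl_orbit_iff)
  fix N s x z
  assume N: "N \<in> gl_orbit X" and s: "\<And>n. s n \<in> gl_orbit X" "s \<longlonglongrightarrow> N"
    and x: "\<And>n. x n \<in> gens (s n) d" "x \<longlonglongrightarrow> (z :: quat^'n)"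
  have P: "(\<lambda>n. proj (ker_pow (s n) k)) \<longlonglongrightarrow> proj (ker_pow N k)" for k
    using continuous_on_proj_ker_pow[of X k] N s unfolding continuous_on_sequentially by (auto simp: o_def)
  have mem: "proj (ker_pow M k) *v y \<in> ker_pow M k" for M :: "quat^'n^'n" and k y
    by (rule proj_in[OF hsubspace_ker_pow])
  have "(\<lambda>n. mpow (s n) d *v x n) \<longlonglongrightarrow> mpow N d *v z" by (intro tendsto_qmv tendsto_mpow s x)
  then have "z \<in> ker_pow N d" using x(1) by (simp add: gens_def ker_pow_def LIMSEQ_const_iff)
  moreover have "inner y z = 0" if y: "y \<in> ker_pow N (d - 1)" for y
  proof -
    have "(\<lambda>n. inner (proj (ker_pow (s n) (d - 1)) *v y) (x n)) \<longlonglongrightarrow> inner (proj (ker_pow N (d - 1)) *v y) z"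
      by (intro tendsto_inner tendsto_qmv tendsto_const P x)
    moreover have "inner (proj (ker_pow (s n) (d - 1)) *v y) (x n) = 0" for n
      using x(1)[of n] mem by (simp add: gens_def)
    ultimately show ?thesis unfolding proj_id[OF hsubspace_ker_pow y] by (simp add: LIMSEQ_const_iff)
  qed
  moreover have "inner (N *v y) z = 0" if y: "y \<in> ker_pow N (d + 1)" for y
  proof -
    have "(\<lambda>n. inner (s n *v (proj (ker_pow (s n) (d + 1)) *v y)) (x n)) \<longlonglongrightarrow>
        inner (N *v (proj (ker_pow N (d + 1)) *v y)) z"
      by (intro tendsto_inner tendsto_qmv tendsto_const P x s)
    moreover have "inner (s n *v (proj (ker_pow (s n) (d + 1)) *v y)) (x n) = 0" for n
      using x(1)[of n] mem by (simp add: gens_def)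
    ultimately show ?thesis unfolding proj_id[OF hsubspace_ker_pow y] by (simp add: LIMSEQ_const_iff)
  qed
  ultimately show "z \<in> gens N d" by (simp add: gens_def)
qed (rule hsubspace_gens)

text \<open>The strings generated by orthonormal bases of the spaces \<open>gens N d\<close> form a Jordan basis of N;
  \<open>jform N\<close> is h h* for the matrix h of any such basis.\<close>

definition jform :: "nat list \<Rightarrow> quat^'n^'n \<Rightarrow> quat^'n^'n" where
  "jform ds N = (\<Sum>d\<in>set ds. \<Sum>l<d. mpow N l ** proj (gens N d) ** adj (mpow N l))"

lemma continuous_on_jform:
  fixes X :: "quat^'n^'n"
  assumes "0 \<notin> set ds" shows "continuous_on (gl_orbit X) (jform ds)"
  unfolding jform_def
  by (intro continuous_intros continuous_on_proj_gens) (use assms in \<open>auto simp: Suc_le_eq intro: gr0I\<close>)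

lemma jform_frame:
  assumes "distinct ds" "\<And>d. d \<in> set ds \<Longrightarrow> hortho (ws d) \<and> gens N d = range (hcomb (ws d))"
  shows "jform ds N = osum (frame N ds ws)"
proof -
  have "proj (gens N d) = osum (ws d)" if "d \<in> set ds" for d using assms(2)[OF that] proj_osum by blast
  then show ?thesis unfolding osum_frame[OF assms(1)] jform_def by simp
qed

section \<open>Orthonormal Jordan frames\<close>

lemma hinner_hcomb_hcomb:
  "hinner (hcomb vs c) (hcomb ws d) = (\<Sum>i<length vs. \<Sum>j<length ws. quat_cnj (c i) * hinner (vs!i) (ws!j) * d j)"
proof -
  have 1: "hinner (hcomb vs c) y = (\<Sum>i<length vs. quat_cnj (c i) * hinner (vs!i) y)" for y
  proof -
    have "hinner y (hcomb vs c) = (\<Sum>i<length vs. hinner y (vs!i) * c i)"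
      by (simp add: hcomb_def hinner_sum_right hinner_rscale_right)
    then have "quat_cnj (hinner y (hcomb vs c)) = quat_cnj (\<Sum>i<length vs. hinner y (vs!i) * c i)" by simp
    then show ?thesis by (simp add: hinner_cnj quat_cnj_sum quat_cnj_mult)
  qed
  have 2: "hinner x (hcomb ws d) = (\<Sum>j<length ws. hinner x (ws!j) * d j)" for x
    by (simp add: hcomb_def hinner_sum_right hinner_rscale_right)
  show ?thesis by (simp only: 1) (simp only: 2 sum_distrib_left mult.assoc)
qed

lemma hinner_hcomb_hortho:
  assumes "hortho vs" shows "hinner (hcomb vs c) (hcomb vs d) = (\<Sum>i<length vs. quat_cnj (c i) * d i)"
proof -
  have "hinner (hcomb vs c) (hcomb vs d) = (\<Sum>i<length vs. \<Sum>j<length vs. if i = j then quat_cnj (c i) * d j else 0)"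
    unfolding hinner_hcomb_hcomb using assms by (intro sum.cong) (auto simp: hortho_def)
  then show ?thesis by simp
qed

text \<open>The base point of the orbit in coordinates where its Jordan basis is orthonormal, so
  that N0 shifts orthonormal strings. \<open>top\<close> makes the strings end after d steps, and
  \<open>len\<close> makes the frame a basis.\<close>

locale jordan_frame =
  fixes N0 :: "quat^('n::{finite,linorder})^('n::{finite,linorder})"
    and ds :: "nat list" and w :: "nat \<Rightarrow> (quat^('n::{finite,linorder})) list"
  assumes dist: "distinct ds" and pos: "0 \<notin> set ds"
    and top: "\<And>d x. d \<in> set ds \<Longrightarrow> x \<in> set (w d) \<Longrightarrow> mpow N0 d *v x = 0"
    and ortho: "hortho (frame N0 ds w)" and len: "length (frame N0 ds w) = CARD('n)"
begin

lemma ds_pos: "d \<in> set ds \<Longrightarrow> 0 < d"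
  using pos by (metis gr0I)

text \<open>The value {0} outside \<open>ds\<close> lets the following facts range over all d, as
  \<open>gens\<close> does.\<close>

definition L :: "nat \<Rightarrow> (quat^('n::{finite,linorder})) set" where
  "L d = (if d \<in> set ds then range (hcomb (w d)) else {0})"

lemma hsubspace_L: "hsubspace (L d)"
  by (auto simp: L_def hsubspace_range_hcomb) (auto simp: hsubspace_def)

lemma L_top: "x \<in> L d \<Longrightarrow> d \<le> k \<Longrightarrow> mpow N0 k *v x = 0"
proof -
  assume x: "x \<in> L d" and k: "d \<le> k"
  have "mpow N0 d *v x = 0"
    using x top unfolding L_def by (auto split: if_splits simp: hcomb_def qmv_sum qmv_rscale)
  then show ?thesis using ker_pow_mono[OF k, of N0] by (auto simp: ker_pow_def)
qed

lemma block_hortho: "d \<in> set ds \<Longrightarrow> l < d \<Longrightarrow> hortho (map ((*v) (mpow N0 l)) (w d))"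
  using hortho_concat(1)[OF distinct_pairs[OF dist] ortho[unfolded frame_def], of "(d, l)"]
  by (simp add: set_pairs)

lemma w_hortho: "d \<in> set ds \<Longrightarrow> hortho (w d)"
  using block_hortho[of d 0] ds_pos by (simp add: map_idI)

lemma inner_same: "x \<in> L d \<Longrightarrow> y \<in> L d \<Longrightarrow> l < d \<Longrightarrow> inner (mpow N0 l *v x) (mpow N0 l *v y) = inner x y"
proof (cases "d \<in> set ds")
  case True
  assume x: "x \<in> L d" and y: "y \<in> L d" and l: "l < d"
  obtain a b where ab: "x = hcomb (w d) a" "y = hcomb (w d) b" using x y True by (auto simp: L_def)
  show ?thesis
    unfolding q1_hinner[symmetric] ab hcomb_map[symmetric]
      hinner_hcomb_hortho[OF block_hortho[OF True l]] hinner_hcomb_hortho[OF w_hortho[OF True]] by simp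
qed (simp add: L_def)

lemma inner_diff:
  assumes "x \<in> L d" "y \<in> L e" "l < d" "k < e" "(d, l) \<noteq> (e, k)"
  shows "inner (mpow N0 l *v x) (mpow N0 k *v y) = 0"
proof (cases "d \<in> set ds \<and> e \<in> set ds")
  case True
  obtain a b where ab: "x = hcomb (w d) a" "y = hcomb (w e) b" using assms True by (auto simp: L_def)
  have "hinner (map ((*v) (mpow N0 l)) (w d) ! i) (map ((*v) (mpow N0 k)) (w e) ! j) = 0"
    if "i < length (w d)" "j < length (w e)" for i j
    using hortho_concat(2)[OF distinct_pairs[OF dist] ortho[unfolded frame_def], of "(d, l)" "(e, k)"] assms True that
    by (simp add: set_pairs)
  then have "hinner (hcomb (map ((*v) (mpow N0 l)) (w d)) a) (hcomb (map ((*v) (mpow N0 k)) (w e)) b) = 0"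
    unfolding hinner_hcomb_hcomb by (simp del: nth_map)
  then show ?thesis unfolding q1_hinner[symmetric] ab hcomb_map[symmetric] by simp
qed (use assms in \<open>auto simp: L_def\<close>)

lemma frame_hbasis: "hbasis UNIV (frame N0 ds w)"
  by (rule hortho_UNIV[OF ortho len])

definition strings :: "(quat^('n::{finite,linorder})) set" where
  "strings = {mpow N0 l *v x |d l x. x \<in> L d \<and> l < d}"

lemma span_strings: "z \<in> span strings"
proof -
  have "z \<in> range (hcomb (frame N0 ds w))" using frame_hbasis unfolding hbasis_def by (metis UNIV_I)
  then obtain c where z: "z = hcomb (frame N0 ds w) c" by blast
  have "rscale (frame N0 ds w ! i) q \<in> strings" if "i < length (frame N0 ds w)" for i q
  proof -
    have "frame N0 ds w ! i \<in> set (frame N0 ds w)" using that by simp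
    then obtain d l x where x: "frame N0 ds w ! i = mpow N0 l *v x" "d \<in> set ds" "l < d" "x \<in> set (w d)"
      unfolding set_frame by blast
    have "x \<in> L d" using x set_subset_range_hcomb[of "w d"] by (auto simp: L_def)
    then have "rscale x q \<in> L d" using hsubspace_L by (auto simp: hsubspace_def)
    then show ?thesis unfolding strings_def x(1) qmv_rscale[symmetric] using x(3) by blast
  qed
  then show ?thesis unfolding z hcomb_def by (intro span_sum span_base) auto
qed

lemma inner_ext:
  assumes "\<And>d l y. y \<in> L d \<Longrightarrow> l < d \<Longrightarrow> inner a (A *v (mpow N0 l *v y)) = inner b (B *v (mpow N0 l *v y))"
  shows "inner a (A *v z) = inner b (B *v z)"
proof (rule linear_eq_on_span[OF _ _ _ span_strings])
  show "linear (\<lambda>z. inner a (A *v z))" "linear (\<lambda>z. inner b (B *v z))"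
    by (rule linearI; simp add: qmv_add qmv_scaleR inner_add_right)+
qed (use assms in \<open>auto simp: strings_def\<close>)

text \<open>N0 is isometric along each string below its end, and a string vector z that is shifted
  to 0 is already orthogonal to N0^l x, since l + m < d.\<close>

lemma inner_shift:
  assumes x: "x \<in> L d" "l + m < d" shows "inner (mpow N0 (l + m) *v x) (mpow N0 m *v z) = inner (mpow N0 l *v x) z"
proof -
  have "inner (mpow N0 (l + m) *v x) (mpow N0 m *v z) = inner (mpow N0 l *v x) (mat 1 *v z)"
  proof (rule inner_ext)
    fix e k y assume y: "y \<in> L e" "k < e"
    have *: "mpow N0 m *v (mpow N0 k *v y) = mpow N0 (m + k) *v y" by (simp add: matrix_vector_mul_assoc mpow_add)
    show "inner (mpow N0 (l + m) *v x) (mpow N0 m *v (mpow N0 k *v y)) = inner (mpow N0 l *v x) (mat 1 *v (mpow N0 k *v y))"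
    proof (cases "(d, l) = (e, k)")
      case True
      then show ?thesis unfolding * using x y inner_same[of x d y "l + m"] inner_same[of x d y l]
        by (simp add: add.commute)
    next
      case False
      then have "inner (mpow N0 l *v x) (mpow N0 k *v y) = 0" using x y by (intro inner_diff) auto
      moreover have "inner (mpow N0 (l + m) *v x) (mpow N0 (m + k) *v y) = 0"
      proof (cases "m + k < e")
        case True
        then show ?thesis using False x y by (intro inner_diff) auto
      next
        case False
        then show ?thesis using L_top[OF y(1), of "m + k"] by simp
      qed
      ultimately show ?thesis unfolding * by simp
    qed
  qed
  then show ?thesis by simp
qed

lemma L_orthogonal_range: assumes x: "x \<in> L d" shows "inner x (N0 *v z) = 0"
proof -
  have "inner x (N0 *v z) = inner x (0 *v z)"
  proof (rule inner_ext)
    fix e k y assume y: "y \<in> L e" "k < e"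
    have *: "N0 *v (mpow N0 k *v y) = mpow N0 (Suc k) *v y" by (simp add: matrix_vector_mul_assoc mpow_Suc)
    have "inner x (mpow N0 (Suc k) *v y) = 0"
    proof (cases "d \<in> set ds \<and> Suc k < e")
      case True
      then show ?thesis using inner_diff[OF x y(1), of 0 "Suc k"] ds_pos by simp
    next
      case False
      then show ?thesis using L_top[OF y(1), of "Suc k"] x by (auto simp: L_def)
    qed
    then show "inner x (N0 *v (mpow N0 k *v y)) = inner x (0 *v (mpow N0 k *v y))" unfolding * by simp
  qed
  then show ?thesis by simp
qed

lemma L_subset_gens: assumes x: "x \<in> L d" shows "x \<in> gens N0 d"
proof -
  have "inner y x = 0" if y: "y \<in> ker_pow N0 (d - 1)" for y
  proof (cases "d \<in> set ds")
    case True
    then show ?thesis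
      using inner_shift[OF x, of 0 "d - 1" y] y ds_pos[OF True] by (simp add: ker_pow_def inner_commute)
  qed (use x in \<open>simp add: L_def\<close>)
  then show ?thesis
    using L_top[OF x] L_orthogonal_range[OF x] by (simp add: gens_def ker_pow_def inner_commute)
qed

lemma gens_eq_L: assumes d: "1 \<le> d" shows "gens N0 d = L d"
proof
  show "L d \<subseteq> gens N0 d" using L_subset_gens by blast
  show "gens N0 d \<subseteq> L d"
  proof
    fix x assume x: "x \<in> gens N0 d"
    let ?y = "proj (L d) *v x"
    have y: "?y \<in> L d" by (rule proj_in[OF hsubspace_L])
    have x': "x - ?y \<in> gens N0 d"
      using x L_subset_gens[OF y] hsubspace_gens[of N0 d] by (auto simp: hsubspace_def intro: subspace_diff)
    then have k: "mpow N0 d *v (x - ?y) = 0" by (simp add: gens_def ker_pow_def)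
    have "inner (x - ?y) (mat 1 *v (x - ?y)) = inner 0 (mat 1 *v (x - ?y))"
    proof (rule inner_ext)
      fix e k z assume z: "z \<in> L e" "k < e"
      \<comment> \<open>Three cases. Far from the end of its string (k + d < e), the vector is
        handled by N0^d (x - y) = 0. Otherwise for k > 0 it is N0 applied to an element of ker
        N0^(d+1). For k = 0 it lies in L d or in ker N0^(d-1).\<close>
      have "inner (mpow N0 k *v z) (x - ?y) = 0"
      proof (cases "k + d < e")
        case True
        then show ?thesis using inner_shift[OF z(1) True, of "x - ?y"] k by simp
      next
        case ke: False
        show ?thesis
        proof (cases k)
          case 0
          show ?thesis
          proof (cases "e = d")
            case True
            then show ?thesis using proj_ortho[OF hsubspace_L, of z d x] z 0 by simp
          next
            case False
            then have "z \<in> ker_pow N0 (d - 1)" using L_top[OF z(1), of "d - 1"] ke 0 by (simp add: ker_pow_def)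
            then show ?thesis using x' 0 by (simp add: gens_def)
          qed
        next
          case (Suc i)
          have "mpow N0 (d + 1) *v (mpow N0 i *v z) = mpow N0 (d + 1 + i) *v z"
            by (simp only: matrix_vector_mul_assoc mpow_add)
          also have "\<dots> = 0" by (rule L_top[OF z(1)]) (use ke Suc in simp)
          finally have "inner (N0 *v (mpow N0 i *v z)) (x - ?y) = 0" using x' by (simp add: gens_def ker_pow_def)
          then show ?thesis by (simp add: Suc mpow_Suc matrix_vector_mul_assoc)
        qed
      qed
      then show "inner (x - ?y) (mat 1 *v (mpow N0 k *v z)) = inner 0 (mat 1 *v (mpow N0 k *v z))"
        by (simp add: inner_commute)
    qed
    then have "x = ?y" by simp
    then show "x \<in> L d" using y by simp
  qed
qed

lemma nilpotent: "\<exists>k. mpow N0 k = 0"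
proof -
  define k where "k = Max (insert 0 (set ds))"
  have "mpow N0 k *v z = 0" for z
  proof -
    have "inner (mpow N0 k *v z) (mpow N0 k *v z) = inner (mpow N0 k *v z) (0 *v z)"
    proof (rule inner_ext)
      fix d l y assume y: "y \<in> L d" "l < d"
      have "mpow N0 k *v (mpow N0 l *v y) = mpow N0 (k + l) *v y" by (simp only: matrix_vector_mul_assoc mpow_add)
      also have "\<dots> = 0"
      proof (cases "d \<in> set ds")
        case True
        then have "d \<le> k" by (simp add: k_def)
        then show ?thesis using L_top[OF y(1), of "k + l"] by simp
      qed (use y in \<open>simp add: L_def\<close>)
      finally show "inner (mpow N0 k *v z) (mpow N0 k *v (mpow N0 l *v y)) = inner (mpow N0 k *v z) (0 *v (mpow N0 l *v y))"
        by simp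
    qed
    then show ?thesis by simp
  qed
  then have "mpow N0 k = 0" by (simp add: matrix_eq)
  then show ?thesis ..
qed

end

section \<open>Unitary matrices and intertwiners\<close>

definition unitary :: "quat^'n^'n \<Rightarrow> bool" where
  "unitary u \<longleftrightarrow> adj u ** u = mat 1"

lemma unitaryD:
  assumes "unitary u"
  shows "adj u ** u = mat 1" "u ** adj u = mat 1" "invertible u" "matrix_inv u = adj u" "unitary (adj u)"
proof -
  show u: "adj u ** u = mat 1" using assms by (simp only: unitary_def)
  show "u ** adj u = mat 1" "invertible u" by (rule left_inverse_imp_invertible[OF u])+
  then show "unitary (adj u)" by (simp only: unitary_def adj_adj)
  show "matrix_inv u = adj u" by (rule matrix_inv_unique[OF u])
qed

lemma unitary_mult: "unitary u \<Longrightarrow> unitary v \<Longrightarrow> unitary (u ** v)"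
proof -
  assume u: "unitary u" and v: "unitary v"
  have "adj (u ** v) ** (u ** v) = adj v ** (adj u ** u) ** v" by (simp only: adj_mult matrix_mul_assoc)
  also have "\<dots> = mat 1" using u v by (simp add: unitary_def)
  finally show ?thesis by (simp only: unitary_def)
qed

lemma unitary_one: "unitary (mat 1)"
  by (simp add: unitary_def)

lemma unitary_hinner: "unitary u \<Longrightarrow> hinner (u *v x) (u *v y) = hinner x y"
  by (simp add: hinner_qmv matrix_vector_mul_assoc unitary_def)

lemma unitary_inner: "unitary u \<Longrightarrow> inner (u *v x) (u *v y) = inner x y"
  by (simp add: q1_hinner[symmetric] unitary_hinner)

lemma compact_unitary: "compact (Collect unitary :: (quat^'n^'n) set)"
proof (rule compact_eq_bounded_closed[THEN iffD2], intro conjI)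
  have "norm u = sqrt (rtrace (mat 1 :: quat^'n^'n))" if "unitary u" for u :: "quat^'n^'n"
    using that by (simp add: norm_eq_sqrt_inner inner_matrix_rtrace unitary_def)
  then show "bounded (Collect unitary :: (quat^'n^'n) set)" by (auto simp: bounded_iff)
  show "closed (Collect unitary :: (quat^'n^'n) set)"
    unfolding unitary_def by (intro closed_Collect_eq continuous_intros)
qed

text \<open>Unlike a general conjugation, a unitary one preserves orthogonality and so carries the
  canonical generators along.\<close>

lemma gens_unitary:
  fixes u :: "quat^'n^'n"
  assumes u: "unitary u" "N ** u = u ** N'" shows "gens N d = (*v) u ` gens N' d"
proof -
  have k: "ker_pow N k = (*v) u ` ker_pow N' k" for k by (rule ker_pow_conj[OF unitaryD(3)[OF u(1)] u(2)])
  have Nu: "N *v (u *v z) = u *v (N' *v z)" for z by (simp add: matrix_vector_mul_assoc u(2))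
  show ?thesis unfolding gens_def k by (auto simp: Nu unitary_inner[OF u(1)])
qed

lemma frame_map_commute:
  assumes "N' ** h = h ** N"
  shows "frame N' ds (\<lambda>d. map ((*v) h) (w d)) = map ((*v) h) (frame N ds w)"
  unfolding frame_def map_concat map_map
  by (intro arg_cong[where f=concat] map_cong refl) (auto simp: matrix_vector_mul_assoc mpow_conj[OF assms])

lemma frame_cong: "(\<And>d. d \<in> set ds \<Longrightarrow> w d = w' d) \<Longrightarrow> frame N ds w = frame N ds w'"
  unfolding frame_def by (intro arg_cong[where f=concat] map_cong refl) (auto simp: set_pairs)

text \<open>The prescribed images of the generators extend along the strings; the extension
  intertwines N and N' because strings of length d end in 0 on both sides. The vectors
  \<open>w'\<close> may be dependent, so invertibility of h is derived separately where spanning is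
  known.\<close>

lemma frame_map_exists:
  fixes N N' :: "quat^('n::{finite,linorder})^('n::{finite,linorder})"
  assumes basis: "hbasis UNIV (frame N ds w)" and pos: "0 \<notin> set ds"
    and l: "\<And>d. d \<in> set ds \<Longrightarrow> length (w' d) = length (w d)"
    and top: "\<And>d x. d \<in> set ds \<Longrightarrow> x \<in> set (w d) \<Longrightarrow> mpow N d *v x = 0"
    and top': "\<And>d x. d \<in> set ds \<Longrightarrow> x \<in> set (w' d) \<Longrightarrow> mpow N' d *v x = 0"
  obtains h where "N' ** h = h ** N" "\<And>d. d \<in> set ds \<Longrightarrow> map ((*v) h) (w d) = w' d"
proof -
  let ?F = "frame N ds w" and ?F' = "frame N' ds w'"
  have len: "length ?F = CARD('n)" by (rule hbasis_UNIV_length[OF basis])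
  have "map (\<lambda>(d, l). length (w' d)) (pairs ds) = map (\<lambda>(d, l). length (w d)) (pairs ds)"
    by (rule map_cong) (auto simp: set_pairs l)
  then have len': "length ?F' = CARD('n)" using len unfolding length_frame by (simp only:)
  let ?b = "basis_matrix ?F" and ?b' = "basis_matrix ?F'"
  have inv: "invertible ?b" by (rule hbasis_UNIV_invertible[OF basis])
  define h where "h = ?b' ** matrix_inv ?b"
  have hb: "h ** ?b = ?b'" by (simp add: h_def matrix_mul_assoc[symmetric] matrix_inv_mult inv)
  have "h *v (?F ! i) = ?F' ! i" if i: "i < CARD('n)" for i
  proof -
    obtain j :: 'n where j: "i = index_pos j" using index_pos_ex[OF i] by blast
    show ?thesis unfolding j column_basis_matrix[symmetric] column_mult[symmetric] hb ..
  qed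
  then have "map ((*v) h) ?F = ?F'" by (intro nth_equalityI) (simp_all add: len len')
  then have "concat (map (\<lambda>(d, l). map ((*v) h) (map ((*v) (mpow N l)) (w d))) (pairs ds)) =
      concat (map (\<lambda>(d, l). map ((*v) (mpow N' l)) (w' d)) (pairs ds))"
    unfolding frame_def map_concat map_map by (simp add: o_def case_prod_unfold)
  then have "map (\<lambda>(d, l). map ((*v) h) (map ((*v) (mpow N l)) (w d))) (pairs ds) =
      map (\<lambda>(d, l). map ((*v) (mpow N' l)) (w' d)) (pairs ds)"
    by (rule concat_injective) (auto simp: zip_map1 zip_map2 zip_same_conv_map set_pairs l)
  then have block: "map ((*v) h) (map ((*v) (mpow N l)) (w d)) = map ((*v) (mpow N' l)) (w' d)"
    if "d \<in> set ds" "l < d" for d l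
    using that by (auto simp: set_pairs)
  have hw: "h *v (mpow N l *v (w d ! i)) = mpow N' l *v (w' d ! i)" if "d \<in> set ds" "l < d" "i < length (w d)" for d l i
    using arg_cong[OF block[OF that(1,2)], of "\<lambda>xs. xs ! i"] that l by simp
  have "N' *v (h *v y) = h *v (N *v y)" if y: "y \<in> set ?F" for y
  proof -
    obtain d l x where x: "y = mpow N l *v x" "d \<in> set ds" "l < d" "x \<in> set (w d)" using y unfolding set_frame by blast
    obtain i where i: "i < length (w d)" "x = w d ! i" using x(4) by (auto simp: in_set_conv_nth)
    have 1: "N' *v (h *v y) = mpow N' (Suc l) *v (w' d ! i)"
      unfolding x(1) i(2) hw[OF x(2,3) i(1)] by (simp add: mpow_Suc matrix_vector_mul_assoc)
    have 2: "N *v y = mpow N (Suc l) *v (w d ! i)" by (simp add: x(1) i(2) mpow_Suc matrix_vector_mul_assoc)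
    show ?thesis
    proof (cases "Suc l < d")
      case True
      show ?thesis unfolding 1 2 hw[OF x(2) True i(1)] ..
    next
      case False
      then have d: "Suc l = d" using x(3) by simp
      have "w' d ! i \<in> set (w' d)" using i(1) l[OF x(2)] by simp
      then show ?thesis unfolding 1 2 d using top[OF x(2,4)] top'[OF x(2)] i(2) by simp
    qed
  qed
  then have "(N' ** h) *v (?F ! i) = (h ** N) *v (?F ! i)" if "i < length ?F" for i
    using that by (simp add: matrix_vector_mul_assoc[symmetric])
  then have "N' ** h ** ?b = h ** N ** ?b"
    unfolding matrix_eq_columns column_mult column_basis_matrix by (simp add: len index_pos_less)
  then have "N' ** h ** (?b ** matrix_inv ?b) = h ** N ** (?b ** matrix_inv ?b)" by (simp add: matrix_mul_assoc)
  then have "N' ** h = h ** N" by (simp add: matrix_inv_mult inv)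
  moreover have "map ((*v) h) (w d) = w' d" if d: "d \<in> set ds" for d
    using block[OF d, of 0] d pos by (simp add: map_idI) (metis gr0I)
  ultimately show ?thesis by (rule that)
qed

context jordan_frame
begin

lemma osum_frame_one: "osum (frame N0 ds w) = mat 1"
proof -
  have U: "range (hcomb (frame N0 ds w)) = UNIV" using frame_hbasis by (simp add: hbasis_def)
  have "osum (frame N0 ds w) = proj UNIV" using proj_osum[OF ortho refl] by (simp only: U)
  moreover have "proj UNIV *v x = x" for x :: "quat^('n::{finite,linorder})"
    by (rule proj_id) (simp_all add: hsubspace_def)
  ultimately show ?thesis by (simp add: matrix_eq)
qed

text \<open>On the unitary orbit the canonical Jordan basis is orthonormal, which makes the
  retraction fix that orbit pointwise.\<close>

lemma jform_unitary:
  assumes u: "unitary u" "N ** u = u ** N0" shows "jform ds N = mat 1"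
proof -
  have "hortho (map ((*v) u) (w d)) \<and> gens N d = range (hcomb (map ((*v) u) (w d)))" if d: "d \<in> set ds" for d
  proof
    show "hortho (map ((*v) u) (w d))"
      using w_hortho[OF d] by (simp add: hortho_def unitary_hinner u(1))
    have "gens N d = (*v) u ` range (hcomb (w d))"
      using gens_unitary[OF u, of d] gens_eq_L[of d] ds_pos[OF d] d by (simp add: L_def)
    then show "gens N d = range (hcomb (map ((*v) u) (w d)))" by (simp add: hcomb_map image_image)
  qed
  then have "jform ds N = osum (frame N ds (\<lambda>d. map ((*v) u) (w d)))" by (rule jform_frame[OF dist])
  also have "frame N ds (\<lambda>d. map ((*v) u) (w d)) = map ((*v) u) (frame N0 ds w)"
    by (rule frame_map_commute[OF u(2)])
  finally show ?thesis by (simp add: osum_map osum_frame_one unitaryD[OF u(1)])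
qed

text \<open>Let U be the span of the strings. By induction ker N^d lies in U + range N, because ker
  N^(d+1) is the orthogonal sum of \<open>gens N (d + 1)\<close> and ker N^d + N ker N^(d+2). For
  large d this gives V = U + N V, and iteration with N U inside U and N nilpotent yields V =
  U.\<close>

lemma jordan_basis:
  assumes N: "N \<in> gl_orbit N0" and ws: "\<And>d. d \<in> set ds \<Longrightarrow> gens N d = range (hcomb (ws d))"
  shows "range (hcomb (frame N ds ws)) = UNIV"
proof -
  obtain g where g: "invertible g" "N ** g = g ** N0" using N by (auto simp: gl_orbit_iff)
  let ?U = "range (hcomb (frame N ds ws))"
  have hU: "hsubspace ?U" by (rule hsubspace_range_hcomb)
  then have sU: "subspace ?U" by (simp add: hsubspace_def)
  have mem: "mpow N l *v x \<in> ?U" if d: "d \<in> set ds" "l < d" "x \<in> gens N d" for d l x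
  proof -
    obtain c where "x = hcomb (ws d) c" using d ws by auto
    then have "mpow N l *v x = hcomb (map ((*v) (mpow N l)) (ws d)) c" by (simp add: hcomb_map)
    moreover have "set (map ((*v) (mpow N l)) (ws d)) \<subseteq> set (frame N ds ws)"
      unfolding set_frame using d by auto
    then have "set (map ((*v) (mpow N l)) (ws d)) \<subseteq> ?U" using set_subset_range_hcomb by blast
    ultimately show ?thesis using hsubspace_hcomb[OF hU] by simp
  qed
  have NU: "N *v x \<in> ?U" if x: "x \<in> ?U" for x
  proof -
    obtain c where c: "x = hcomb (frame N ds ws) c" using x by blast
    have "set (map ((*v) N) (frame N ds ws)) \<subseteq> ?U"
    proof
      fix y assume "y \<in> set (map ((*v) N) (frame N ds ws))"
      then obtain d l z where z: "y = N *v (mpow N l *v z)" "d \<in> set ds" "l < d" "z \<in> set (ws d)"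
        unfolding set_map set_frame by blast
      have zg: "z \<in> gens N d" using z ws set_subset_range_hcomb[of "ws d"] by blast
      have y: "y = mpow N (Suc l) *v z" by (simp add: z mpow_Suc matrix_vector_mul_assoc)
      show "y \<in> ?U"
      proof (cases "Suc l < d")
        case True then show ?thesis unfolding y by (rule mem[OF z(2) _ zg])
      next
        case False
        then have "Suc l = d" using z by simp
        then have "y = 0" using zg unfolding y by (simp add: gens_def ker_pow_def)
        then show ?thesis using sU by (simp add: subspace_0)
      qed
    qed
    then show ?thesis using hsubspace_hcomb[OF hU] by (simp add: c hcomb_map[symmetric])
  qed
  have ker: "x \<in> ker_pow N d \<Longrightarrow> \<exists>u\<in>?U. \<exists>z. x = u + N *v z" for d x
  proof (induction d arbitrary: x)
    case 0
    then show ?case using sU by (intro bexI[of _ 0] exI[of _ 0]) (auto simp: ker_pow_def subspace_0)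
  next
    case (Suc d)
    let ?F = "{a + N *v b |a b. a \<in> ker_pow N (Suc d - 1) \<and> b \<in> ker_pow N (Suc d + 1)}"
    have sF: "span ?F = ?F" using subspace_gens_complement[of N "Suc d"] by (simp only: span_eq_iff)
    obtain f p where fp: "f \<in> span ?F" "\<And>z. z \<in> span ?F \<Longrightarrow> real_inner_class.orthogonal p z" "x = f + p"
      by (rule orthogonal_subspace_decomp_exists[of ?F x]) blast
    have "f \<in> ker_pow N (Suc d)" using fp(1) gens_complement_subset[of "Suc d" N] unfolding sF by auto
    then have "x - f \<in> ker_pow N (Suc d)"
      using Suc.prems hsubspace_ker_pow[of N "Suc d"] unfolding hsubspace_def by (blast intro: subspace_diff)
    then have "p \<in> gens N (Suc d)"
      using fp(2,3) unfolding gens_orthogonal sF by (simp add: orthogonal_commute)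
    then have p: "p \<in> ?U"
    proof (cases "Suc d \<in> set ds")
      case True
      then show ?thesis using mem[OF True, of 0 p] \<open>p \<in> gens N (Suc d)\<close> by simp
    next
      case False
      \<comment> \<open>Lengths outside \<open>ds\<close> have no generators: the dimension agrees
        with that for N0, where it is 0.\<close>
      have "dim (gens N (Suc d)) = 0" using dim_gens_conj[OF g, of "Suc d"] gens_eq_L[of "Suc d"] False by (simp add: L_def)
      then have "p = 0" using \<open>p \<in> gens N (Suc d)\<close> by (auto simp: dim_eq_0)
      then show ?thesis using sU by (simp add: subspace_0)
    qed
    obtain a b where ab: "f = a + N *v b" "a \<in> ker_pow N d" using fp(1) unfolding sF by auto
    obtain u z where uz: "u \<in> ?U" "a = u + N *v z" using Suc.IH[OF ab(2)] by blast
    have "x = (u + p) + N *v (z + b)" by (simp add: fp(3) ab(1) uz(2) qmv_add)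
    then show ?case using subspace_add[OF sU uz(1) p] by blast
  qed
  obtain k where k: "mpow N0 k = 0" using nilpotent by blast
  have "mpow N k ** g = 0" using mpow_conj[OF g(2), of k] by (simp add: k)
  then have "mpow N k ** g ** matrix_inv g = 0" by simp
  then have Nk: "mpow N k = 0" by (simp add: matrix_mul_assoc[symmetric] matrix_inv_mult g(1))
  have "\<exists>u\<in>?U. \<exists>z. x = u + mpow N j *v z" for j x
  proof (induction j)
    case 0 then show ?case using sU by (intro bexI[of _ 0] exI[of _ x]) (auto simp: subspace_0)
  next
    case (Suc j)
    then obtain u z where u: "u \<in> ?U" "x = u + mpow N j *v z" by blast
    have "z \<in> ker_pow N k" by (simp add: ker_pow_def Nk)
    then obtain u' z' where u': "u' \<in> ?U" "z = u' + N *v z'" using ker by blast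
    have "mpow N j *v u' \<in> ?U" using u'(1) by (induction j) (simp_all add: mpow_Suc matrix_vector_mul_assoc[symmetric] NU)
    moreover have "x = (u + mpow N j *v u') + mpow N (Suc j) *v z'"
      by (simp add: u(2) u'(2) qmv_add mpow_Suc_right matrix_vector_mul_assoc)
    ultimately show ?case using subspace_add[OF sU u(1)] by blast
  qed
  from this[of _ k] show ?thesis by (auto simp: Nk)
qed

text \<open>h carries the orthonormal frame of N0, whose \<open>osum\<close> is 1, to a canonical
  Jordan basis of N, whose \<open>osum\<close> is therefore h h*. The generator lists match in
  length by conjugation invariance of the dimensions.\<close>

lemma frame_conj:
  assumes N: "N \<in> gl_orbit N0"
  obtains h where "invertible h" "N ** h = h ** N0" "jform ds N = h ** adj h"
proof -
  obtain g where g: "invertible g" "N ** g = g ** N0" using N by (auto simp: gl_orbit_iff)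
  have "\<forall>d\<in>set ds. \<exists>v. hortho v \<and> gens N d = range (hcomb v)"
    using hortho_basis_exists[OF hsubspace_gens] by metis
  then obtain ws where ws: "\<And>d. d \<in> set ds \<Longrightarrow> hortho (ws d) \<and> gens N d = range (hcomb (ws d))" by metis
  have l: "length (ws d) = length (w d)" if d: "d \<in> set ds" for d
  proof -
    have "dim (gens N d) = dim (L d)"
      using dim_gens_conj[OF g, of d] gens_eq_L[of d] ds_pos[OF d] by simp
    moreover have "dim (gens N d) = 4 * length (ws d)" 
      using hbasis_dim[OF hortho_hbasis[OF ws[OF d, THEN conjunct1]]] ws[OF d] by simp
    moreover have "dim (L d) = 4 * length (w d)" using hbasis_dim[OF hortho_hbasis[OF w_hortho[OF d]]] d by (simp add: L_def)
    ultimately show ?thesis by simp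
  qed
  have "mpow N d *v x = 0" if "d \<in> set ds" "x \<in> set (ws d)" for d x
    using ws[OF that(1)] set_subset_range_hcomb[of "ws d"] that(2) by (auto simp: gens_def ker_pow_def)
  then obtain h where h: "N ** h = h ** N0" "\<And>d. d \<in> set ds \<Longrightarrow> map ((*v) h) (w d) = ws d"
    using frame_map_exists[OF frame_hbasis pos, of ws N] l top by metis
  have F: "frame N ds ws = map ((*v) h) (frame N0 ds w)"
    unfolding frame_map_commute[OF h(1), symmetric] by (rule frame_cong) (simp add: h(2))
  have "jform ds N = osum (frame N ds ws)" by (rule jform_frame[OF dist ws])
  then have "jform ds N = h ** adj h" by (simp add: F osum_map osum_frame_one)
  moreover have "UNIV = range (hcomb (frame N ds ws))" using jordan_basis[OF N] ws by blast
  then have "range ((*v) h) = UNIV" unfolding F hcomb_map by blast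
  then have "invertible h" by (rule invertible_surj)
  ultimately show ?thesis using that h(1) by blast
qed

section \<open>The deformation retraction\<close>

definition unitary_orbit :: "(quat^('n::{finite,linorder})^('n::{finite,linorder})) set" where
  "unitary_orbit = (\<lambda>u. u ** N0 ** adj u) ` Collect unitary"

text \<open>Deforming the matrix h of a Jordan basis to its unitary part moves N = h N0 h^-1 along
  q_t^-1 N q_t, where q is the square root of h h* and q_t = (1 - t) + t q.\<close>

lemma gl_orbit_homotopy_equivalent:
  "top_of_set (gl_orbit N0) homotopy_equivalent_space top_of_set unitary_orbit"
proof -
  let ?O = "gl_orbit N0"
  define p where "p = (\<lambda>N :: quat^('n::{finite,linorder})^('n::{finite,linorder}). psqrt (jform ds N))"
  define q where "q = (\<lambda>(t::real) N. (1 - t) *\<^sub>R mat 1 + t *\<^sub>R p N)"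
  define H where "H = (\<lambda>(t, N). matrix_inv (q t N) ** N ** q t N)"
  have jpos: "posdef (jform ds N)" if N: "N \<in> ?O" for N
  proof -
    obtain h where "invertible h" "N ** h = h ** N0" "jform ds N = h ** adj h" by (rule frame_conj[OF N])
    then show ?thesis by (simp add: posdef_mult_adj)
  qed
  have ppos: "posdef (p N)" "p N ** p N = jform ds N" if "N \<in> ?O" for N
    unfolding p_def using psqrt[OF jpos[OF that]] by simp_all
  have qpos: "posdef (q t N)" if "N \<in> ?O" "t \<in> {0..1}" for t N
    using convexD_alt[OF convex_posdef, of "mat 1" "p N" t] posdef_one ppos[OF that(1)] that(2) by (simp add: q_def)
  have contp: "continuous_on ?O p"
    unfolding p_def
    by (rule continuous_on_compose2[OF continuous_on_psqrt continuous_on_jform[OF pos]]) (use jpos in auto)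
  have cp: "continuous_on ({0..1} \<times> ?O) (\<lambda>x. p (snd x))"
    by (rule continuous_on_compose2[OF contp continuous_on_snd[OF continuous_on_id]]) auto
  have cq: "continuous_on ({0..1} \<times> ?O) (\<lambda>x. q (fst x) (snd x))"
    unfolding q_def by (intro continuous_intros cp)
  have cH: "continuous_on ({0..1} \<times> ?O) H"
    unfolding H_def case_prod_unfold
    by (intro continuous_intros cq) (auto intro!: posdef_invertible qpos)
  have HO: "H (t, N) \<in> ?O" if N: "N \<in> ?O" and t: "t \<in> {0..1}" for t N
  proof -
    obtain g where g: "invertible g" "N ** g = g ** N0" using N by (auto simp: gl_orbit_iff)
    have iq: "invertible (q t N)" by (rule posdef_invertible[OF qpos[OF N t]])
    have "H (t, N) ** (matrix_inv (q t N) ** g) = matrix_inv (q t N) ** N ** (q t N ** matrix_inv (q t N)) ** g"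
      by (simp add: H_def matrix_mul_assoc)
    also have "\<dots> = matrix_inv (q t N) ** (N ** g)" by (simp add: matrix_inv_mult[OF iq] matrix_mul_assoc)
    also have "\<dots> = (matrix_inv (q t N) ** g) ** N0" by (simp add: g(2) matrix_mul_assoc)
    finally show ?thesis
      unfolding gl_orbit_iff using invertible_mult[OF invertible_matrix_inv[OF iq] g(1)] by blast
  qed
  have H0: "H (0, N) = N" for N by (simp add: H_def q_def)
  have H1: "H (1, N) \<in> unitary_orbit" if N: "N \<in> ?O" for N
  proof -
    obtain h where h: "invertible h" "N ** h = h ** N0" "jform ds N = h ** adj h" using frame_conj[OF N] .
    let ?p = "p N"
    have p: "invertible ?p" "adj ?p = ?p" "?p ** ?p = h ** adj h"
      using ppos[OF N] posdef_invertible h(3) by (auto simp: posdef_def)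
    have ap: "adj (matrix_inv ?p) = matrix_inv ?p"
      by (rule matrix_inv_unique[symmetric]) (metis adj_mult adj_one matrix_inv_mult(1) p(1,2))
    \<comment> \<open>Polar decomposition h = p u, with p the square root of h h*; the end point of
      the path is then u N0 u*.\<close>
    define u where "u = matrix_inv ?p ** h"
    have "u ** adj u = matrix_inv ?p ** (h ** adj h) ** matrix_inv ?p" by (simp add: u_def adj_mult ap matrix_mul_assoc)
    also have "\<dots> = (matrix_inv ?p ** ?p) ** (?p ** matrix_inv ?p)" unfolding p(3)[symmetric] by (simp add: matrix_mul_assoc)
    also have "\<dots> = mat 1" by (simp add: matrix_inv_mult p(1))
    finally have uu: "u ** adj u = mat 1" .
    then have u: "unitary u" unfolding unitary_def by (rule left_inverse_imp_invertible(2))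
    have hu: "h = ?p ** u" by (simp add: u_def matrix_mul_assoc matrix_inv_mult p(1))
    have "N ** ?p = N ** (?p ** u) ** adj u" by (simp add: matrix_mul_assoc[symmetric] uu)
    also have "\<dots> = ?p ** u ** N0 ** adj u" using h(2) by (simp add: hu)
    finally have "matrix_inv ?p ** (N ** ?p) = (matrix_inv ?p ** ?p) ** (u ** N0 ** adj u)" by (simp add: matrix_mul_assoc)
    then have "H (1, N) = u ** N0 ** adj u" by (simp add: H_def q_def matrix_inv_mult p(1) matrix_mul_assoc)
    then show ?thesis using u by (auto simp: unitary_orbit_def)
  qed
  have S: "N \<in> ?O \<and> H (1, N) = N" if N: "N \<in> unitary_orbit" for N
  proof -
    obtain u where u: "unitary u" "N = u ** N0 ** adj u" using N by (auto simp: unitary_orbit_def)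
    have Nu: "N ** u = u ** N0" by (simp add: u(2) matrix_mul_assoc[symmetric] unitaryD[OF u(1)])
    then have "jform ds N = mat 1" by (rule jform_unitary[OF u(1)])
    then have "p N = mat 1" unfolding p_def using psqrt_square[OF posdef_one] by simp
    then have "H (1, N) = N" by (simp add: H_def q_def)
    then show ?thesis using Nu unitaryD(3)[OF u(1)] by (auto simp: gl_orbit_iff)
  qed
  let ?r = "\<lambda>N. H (1, N)"
  have cr: "continuous_on ?O ?r"
    by (rule continuous_on_compose2[OF cH]) (auto intro!: continuous_intros)
  have "homotopic_with (\<lambda>x. True) (top_of_set ?O) (top_of_set ?O) id ?r"
    unfolding homotopic_with_def
  proof (intro exI[of _ H] conjI)
    have "prod_topology (top_of_set {0..1}) (top_of_set ?O) = top_of_set ({0..1::real} \<times> ?O)"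
      by (simp add: prod_topology_subtopology_eu)
    then show "continuous_map (prod_topology (top_of_set {0..1}) (top_of_set ?O)) (top_of_set ?O) H"
      using cH HO by auto
  qed (simp_all add: H0)
  then have "homotopic_with (\<lambda>x. True) (top_of_set ?O) (top_of_set ?O) ?r id" by (rule homotopic_with_symD)
  moreover have "retraction_maps (top_of_set ?O) (top_of_set unitary_orbit) ?r id"
    unfolding retraction_maps_def using cr H1 S by auto
  ultimately show ?thesis by (rule deformation_retract_imp_homotopy_equivalent_space)
qed

end

section \<open>The unitary orbit as a coset space\<close>

lemma quotient_maps_homeomorphic:
  assumes f: "quotient_map X Y f" and g: "quotient_map X Z g"
    and fg: "\<And>x y. x \<in> topspace X \<Longrightarrow> y \<in> topspace X \<Longrightarrow> f x = f y \<longleftrightarrow> g x = g y"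
  shows "Y homeomorphic_space Z"
proof -
  obtain a where a: "continuous_map Y Z a" "\<And>x. x \<in> topspace X \<Longrightarrow> a (f x) = g x"
    using quotient_map_lift_exists[OF f quotient_imp_continuous_map[OF g]] fg by metis
  obtain b where b: "continuous_map Z Y b" "\<And>x. x \<in> topspace X \<Longrightarrow> b (g x) = f x"
    using quotient_map_lift_exists[OF g quotient_imp_continuous_map[OF f]] fg by metis
  have "topspace Y = f ` topspace X" "topspace Z = g ` topspace X"
    using f g quotient_imp_surjective_map by blast+
  then have "homeomorphic_maps Y Z a b" using a b unfolding homeomorphic_maps_def by auto
  then show ?thesis unfolding homeomorphic_space_def by blast
qed

text \<open>The orbit map is continuous from a compact space onto a Hausdorff one, hence a quotient
  map, and its fibres are the left cosets of the stabilizer.\<close>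

lemma coset_space_unitary_orbit:
  fixes X :: "quat^'n^'n"
  shows "coset_space (Collect unitary) {u. unitary u \<and> u ** X = X ** u} homeomorphic_space
    top_of_set ((\<lambda>u. u ** X ** adj u) ` Collect unitary)"
proof -
  let ?G = "Collect unitary :: (quat^'n^'n) set" and ?K = "{u. unitary u \<and> u ** X = X ** u}"
  let ?F = "\<lambda>u. u ** X ** adj u"
  have coset: "u <#\<^bsub>matrix_group ?G\<^esub> ?K = (**) u ` ?K" for u
    by (auto simp: l_coset_def matrix_group_def)
  have "quotient_map (top_of_set ?G) (coset_space ?G ?K) (\<lambda>u. u <#\<^bsub>matrix_group ?G\<^esub> ?K)"
    unfolding coset_space_def by (rule quotient_map_quotient_topology)
  moreover have "quotient_map (top_of_set ?G) (top_of_set (?F ` ?G)) ?F"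
  proof (rule continuous_imp_quotient_map)
    show "continuous_map (top_of_set ?G) (top_of_set (?F ` ?G)) ?F"
      by (auto intro!: continuous_intros)
    show "compact_space (top_of_set ?G)" using compact_unitary by (intro compact_space_subtopology) (simp add: compactin_euclidean_iff)
    show "Hausdorff_space (top_of_set (?F ` ?G))" by (simp add: Hausdorff_space_subtopology)
  qed auto
  moreover have "(u <#\<^bsub>matrix_group ?G\<^esub> ?K = v <#\<^bsub>matrix_group ?G\<^esub> ?K) = (?F u = ?F v)"
    if "u \<in> topspace (top_of_set ?G)" "v \<in> topspace (top_of_set ?G)" for u v
  proof -
    have uv: "unitary u" "unitary v" using that by auto
    note U = unitaryD[OF uv(1)] and V = unitaryD[OF uv(2)]
    show ?thesis
    proof
      assume "u <#\<^bsub>matrix_group ?G\<^esub> ?K = v <#\<^bsub>matrix_group ?G\<^esub> ?K"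
      moreover have "u \<in> (**) u ` ?K" by (rule image_eqI[of _ _ "mat 1"]) (simp_all add: unitary_one)
      ultimately obtain k where k: "unitary k" "k ** X = X ** k" "u = v ** k" unfolding coset by blast
      have "?F u = v ** (k ** X ** adj k) ** adj v" by (simp add: k(3) adj_mult matrix_mul_assoc)
      also have "k ** X ** adj k = X" by (simp add: k(2) matrix_mul_assoc[symmetric] unitaryD[OF k(1)])
      finally show "?F u = ?F v" .
    next
      assume F: "?F u = ?F v"
      define k where "k = adj v ** u"
      have k: "unitary k" unfolding k_def by (intro unitary_mult V(5) uv(1))
      have "adj v ** ?F u ** u = adj v ** ?F v ** u" using F by simp
      then have "(adj v ** u) ** X ** (adj u ** u) = (adj v ** v) ** X ** (adj v ** u)"
        by (simp add: matrix_mul_assoc)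
      then have kX: "k ** X = X ** k" by (simp add: k_def U V matrix_mul_assoc)
      have uk: "u = v ** k" by (simp add: k_def matrix_mul_assoc V)
      have kinv: "adj k ** X = X ** adj k"
        using arg_cong[OF kX, of "\<lambda>A. adj k ** A ** adj k"] unitaryD[OF k]
        by (simp add: matrix_mul_assoc) (metis matrix_mul_assoc matrix_mul_lid matrix_mul_rid)
      have "(**) u ` ?K \<subseteq> (**) v ` ?K"
      proof (rule image_subsetI)
        fix c assume c: "c \<in> ?K"
        have "unitary (k ** c)" using k c unitary_mult by blast
        moreover have "k ** c ** X = X ** (k ** c)" using c kX by (metis (mono_tags, lifting) matrix_mul_assoc mem_Collect_eq)
        ultimately show "u ** c \<in> (**) v ` ?K" by (intro image_eqI[of _ _ "k ** c"]) (simp_all add: uk matrix_mul_assoc)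
      qed
      moreover have "(**) v ` ?K \<subseteq> (**) u ` ?K"
      proof (rule image_subsetI)
        fix c assume c: "c \<in> ?K"
        have "unitary (adj k ** c)" using unitaryD(5)[OF k] c unitary_mult by blast
        moreover have "adj k ** c ** X = X ** (adj k ** c)" using c kinv by (metis (mono_tags, lifting) matrix_mul_assoc mem_Collect_eq)
        moreover have "v ** c = u ** (adj k ** c)"
          using unitaryD(2)[OF k] by (simp add: uk matrix_mul_assoc[symmetric]) (simp add: matrix_mul_assoc)
        ultimately show "v ** c \<in> (**) u ` ?K" by (intro image_eqI[of _ _ "adj k ** c"]) simp_all
      qed
      ultimately show "u <#\<^bsub>matrix_group ?G\<^esub> ?K = v <#\<^bsub>matrix_group ?G\<^esub> ?K" unfolding coset by blast
    qed
  qed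
  ultimately show ?thesis by (rule quotient_maps_homeomorphic)
qed

subsection \<open>Compact subgroups of the centralizer\<close>

lemma typed_matrix_nth: "typed_matrix A $ i $ j = A $$ (index_pos i, index_pos j)"
  by (simp add: typed_matrix_def)

lemma typed_matrix_mult:
  fixes A :: "quat mat"
  assumes "A \<in> carrier_mat CARD('n) CARD('n)" "B \<in> carrier_mat CARD('n) CARD('n)"
  shows "(typed_matrix (A * B) :: quat^('n::{finite,linorder})^('n::{finite,linorder})) = typed_matrix A ** typed_matrix B"
proof -
  have "(A * B) $$ (index_pos i, index_pos j) =
      (\<Sum>k\<in>UNIV. A $$ (index_pos i, index_pos (k::'n)) * B $$ (index_pos k, index_pos j))" for i j :: 'n
    using assms index_pos_less[of i] index_pos_less[of j]
    by (simp add: scalar_prod_def atLeast0LessThan sum_index_pos)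
  then show ?thesis
    by (simp add: Finite_Cartesian_Product.vec_eq_iff typed_matrix_nth matrix_matrix_mult_def)
qed

lemma typed_matrix_one: "(typed_matrix (1\<^sub>m CARD('n)) :: quat^('n::{finite,linorder})^('n::{finite,linorder})) = mat 1"
proof -
  have "inj (index_pos :: 'n \<Rightarrow> nat)" using index_pos_bij by (auto simp: bij_betw_def)
  then show ?thesis
    by (auto simp: Finite_Cartesian_Product.vec_eq_iff typed_matrix_nth Finite_Cartesian_Product.mat_def
        index_pos_less inj_eq)
qed

lemma typed_matrix_adj:
  assumes "A \<in> carrier_mat CARD('n) CARD('n)"
  shows "typed_matrix (transpose_mat (map_mat quat_cnj A)) = adj (typed_matrix A :: quat^('n::{finite,linorder})^('n::{finite,linorder}))"
  using assms index_pos_less[where 'n='n]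
  by (auto simp: Finite_Cartesian_Product.vec_eq_iff typed_matrix_nth adj_nth)

lemma typed_matrix_inj:
  assumes "A \<in> carrier_mat CARD('n) CARD('n)" "B \<in> carrier_mat CARD('n) CARD('n)"
    "typed_matrix A = (typed_matrix B :: quat^('n::{finite,linorder})^('n::{finite,linorder}))"
  shows "A = B"
proof (rule eq_matI)
  fix i j assume "i < dim_row B" "j < dim_col B"
  then have "i < CARD('n)" "j < CARD('n)" using assms by auto
  then obtain a b :: 'n where "i = index_pos a" "j = index_pos b" using index_pos_ex by metis
  then show "A $$ (i, j) = B $$ (i, j)" using assms(3) by (metis typed_matrix_nth)
qed (use assms in auto)

lemma typed_matrix_ex:
  fixes u :: "quat^('n::{finite,linorder})^('n::{finite,linorder})"
  obtains A where "A \<in> carrier_mat CARD('n) CARD('n)" "typed_matrix A = u"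
proof (rule that[of "Matrix.mat CARD('n) CARD('n) (\<lambda>(i, j). u $ inv_into UNIV index_pos i $ inv_into UNIV index_pos j)"])
  have inj: "inj (index_pos :: 'n \<Rightarrow> nat)" using index_pos_bij by (auto simp: bij_betw_def)
  show "typed_matrix (Matrix.mat CARD('n) CARD('n)
      (\<lambda>(i, j). u $ inv_into UNIV index_pos i $ inv_into UNIV index_pos j)) = u"
    by (simp add: Finite_Cartesian_Product.vec_eq_iff typed_matrix_nth index_pos_less inv_f_f[OF inj])
qed simp

lemma Sp_typed_unitary: "(Sp_typed :: (quat^('n::{finite,linorder})^('n::{finite,linorder})) set) = Collect unitary"
proof
  show "(Sp_typed :: (quat^('n::{finite,linorder})^('n::{finite,linorder})) set) \<subseteq> Collect unitary"
  proof
    fix u :: "quat^('n::{finite,linorder})^('n::{finite,linorder})" assume "u \<in> Sp_typed"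
    then obtain A where A: "A \<in> carrier_mat CARD('n) CARD('n)"
      "transpose_mat (map_mat quat_cnj A) * A = 1\<^sub>m CARD('n)" "u = typed_matrix A"
      by (auto simp: Sp_typed_def Sp_def)
    have "adj u ** u = typed_matrix (transpose_mat (map_mat quat_cnj A) * A)"
      unfolding A(3) typed_matrix_adj[OF A(1), symmetric] by (rule typed_matrix_mult[symmetric]) (use A(1) in auto)
    then show "u \<in> Collect unitary" by (simp add: A(2) typed_matrix_one unitary_def)
  qed
  show "Collect unitary \<subseteq> (Sp_typed :: (quat^('n::{finite,linorder})^('n::{finite,linorder})) set)"
  proof
    fix u :: "quat^('n::{finite,linorder})^('n::{finite,linorder})" assume "u \<in> Collect unitary"
    then have u: "unitary u" by simp
    obtain A where A: "A \<in> carrier_mat CARD('n) CARD('n)" "typed_matrix A = u" by (rule typed_matrix_ex)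
    let ?B = "transpose_mat (map_mat quat_cnj A)"
    have B: "?B \<in> carrier_mat CARD('n) CARD('n)" using A(1) by auto
    have "typed_matrix (?B * A) = (typed_matrix (1\<^sub>m CARD('n)) :: quat^('n::{finite,linorder})^('n::{finite,linorder}))"
      unfolding typed_matrix_mult[OF B A(1)] typed_matrix_adj[OF A(1)] typed_matrix_one A(2) by (rule unitaryD(1)[OF u])
    then have BA: "?B * A = 1\<^sub>m CARD('n)" by (rule typed_matrix_inj[rotated 2]) (use A B in auto)
    have "typed_matrix (A * ?B) = (typed_matrix (1\<^sub>m CARD('n)) :: quat^('n::{finite,linorder})^('n::{finite,linorder}))"
      unfolding typed_matrix_mult[OF A(1) B] typed_matrix_adj[OF A(1)] typed_matrix_one A(2) by (rule unitaryD(2)[OF u])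
    then have AB: "A * ?B = 1\<^sub>m CARD('n)" by (rule typed_matrix_inj[rotated 2]) (use A B in auto)
    have "invertible_mat A"
      unfolding invertible_mat_def inverts_mat_def using A(1) B AB BA by (intro conjI exI[of _ ?B]) auto
    then show "u \<in> Sp_typed" using A BA by (auto simp: Sp_typed_def Sp_def)
  qed
qed

section \<open>Matrices on invariant blocks\<close>

lemma acts_exists:
  assumes "hbasis W vs" "\<And>x. x \<in> W \<Longrightarrow> g *v x \<in> W" obtains A where "acts g vs A"
proof -
  have "\<exists>c. g *v (vs!j) = hcomb vs c" if "j < length vs" for j
  proof -
    have "vs!j \<in> W" using assms(1) set_subset_range_hcomb[of vs] that by (auto simp: hbasis_def)
    then show ?thesis using assms by (auto simp: hbasis_def)
  qed
  then obtain c where c: "\<And>j. j < length vs \<Longrightarrow> g *v (vs!j) = hcomb vs (c j)" by metis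
  have "acts g vs (Matrix.mat (length vs) (length vs) (\<lambda>(i, j). c j i))"
    unfolding acts_def using c by (auto intro: hcomb_cong)
  then show ?thesis by (rule that)
qed

lemma acts_unique:
  assumes "hbasis W vs" "acts g vs A" "acts g vs B" shows "A = B"
proof (rule eq_matI)
  fix i j assume "i < dim_row B" "j < dim_col B"
  then have ij: "i < length vs" "j < length vs" using assms(3) by (auto simp: acts_def)
  have "hcomb vs (\<lambda>i. A $$ (i, j)) = hcomb vs (\<lambda>i. B $$ (i, j))" using assms(2,3) ij by (simp add: acts_def)
  then show "A $$ (i, j) = B $$ (i, j)" using hbasis_coords_unique[OF assms(1)] ij(1) by metis
qed (use assms in \<open>auto simp: acts_def\<close>)

lemma acts_mult:
  assumes A: "acts g vs A" and B: "acts h vs B" shows "acts (g ** h) vs (A * B)"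
proof -
  have d: "A \<in> carrier_mat (length vs) (length vs)" "B \<in> carrier_mat (length vs) (length vs)"
    using A B by (auto simp: acts_def)
  have "(g ** h) *v (vs!j) = hcomb vs (\<lambda>i. (A * B) $$ (i, j))" if j: "j < length vs" for j
  proof -
    have "(g ** h) *v (vs!j) = g *v hcomb vs (\<lambda>i. B $$ (i, j))"
      using B j by (simp add: acts_def matrix_vector_mul_assoc[symmetric])
    also have "\<dots> = (\<Sum>k<length vs. rscale (hcomb vs (\<lambda>i. A $$ (i, k))) (B $$ (k, j)))"
      unfolding hcomb_def[of vs "\<lambda>i. B $$ (i, j)"] qmv_sum qmv_rscale using A by (intro sum.cong) (auto simp: acts_def)
    also have "\<dots> = (\<Sum>i<length vs. \<Sum>k<length vs. rscale (vs!i) (A $$ (i, k) * B $$ (k, j)))"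
      unfolding hcomb_def rscale_sum rscale_rscale by (rule sum.swap)
    also have "\<dots> = hcomb vs (\<lambda>i. (A * B) $$ (i, j))"
      unfolding hcomb_def rscale_sum_right[symmetric]
      using d j by (intro sum.cong) (auto simp: scalar_prod_def atLeast0LessThan)
    finally show ?thesis .
  qed
  then show ?thesis using d by (auto simp: acts_def)
qed

lemma acts_one: "acts (mat 1) vs (1\<^sub>m (length vs))"
proof -
  have "hcomb vs (\<lambda>i. 1\<^sub>m (length vs) $$ (i, j)) = vs!j" if "j < length vs" for j
  proof -
    have "hcomb vs (\<lambda>i. 1\<^sub>m (length vs) $$ (i, j)) = hcomb vs (\<lambda>i. if i = j then 1 else 0)"
      using that by (intro hcomb_cong) simp
    then show ?thesis using that by (simp add: hcomb_single)
  qed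
  then show ?thesis by (simp add: acts_def)
qed

lemma acts_conj:
  assumes "acts g vs A" "g' ** p = p ** g" shows "acts g' (map ((*v) p) vs) A"
proof -
  have "g' *v (p *v x) = p *v (g *v x)" for x by (simp add: matrix_vector_mul_assoc assms(2))
  then show ?thesis using assms(1) by (auto simp: acts_def hcomb_map)
qed

text \<open>Orthonormality of \<open>vs\<close> and of its image gives A* A = 1; invariance under
  \<open>adj u\<close> supplies the inverse matrix that \<open>invertible_mat\<close> asks
  for.\<close>

lemma acts_Sp:
  assumes u: "unitary u" and vs: "hortho vs" and A: "acts u vs A"
    and adj: "\<And>x. x \<in> range (hcomb vs) \<Longrightarrow> adj u *v x \<in> range (hcomb vs)"
  shows "A \<in> Sp (length vs)"
proof -
  have b: "hbasis (range (hcomb vs)) vs" by (rule hortho_hbasis[OF vs])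
  obtain B where B: "acts (adj u) vs B" using acts_exists[OF b adj] by blast
  have dA: "A \<in> carrier_mat (length vs) (length vs)" and dB: "B \<in> carrier_mat (length vs) (length vs)"
    using A B by (auto simp: acts_def)
  have AB: "A * B = 1\<^sub>m (length vs)"
    using acts_unique[OF b acts_mult[OF A B]] acts_one[of vs] unitaryD[OF u] by simp
  have BA: "B * A = 1\<^sub>m (length vs)"
    using acts_unique[OF b acts_mult[OF B A]] acts_one[of vs] unitaryD[OF u] by simp
  have "invertible_mat A"
    unfolding invertible_mat_def inverts_mat_def using dA dB AB BA by (intro conjI exI[of _ B]) auto
  moreover have "transpose_mat (map_mat quat_cnj A) * A = 1\<^sub>m (length vs)"
  proof (rule eq_matI)
    fix i j assume "i < dim_row (1\<^sub>m (length vs) :: quat mat)" "j < dim_col (1\<^sub>m (length vs) :: quat mat)"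
    then have ij: "i < length vs" "j < length vs" by auto
    have "(transpose_mat (map_mat quat_cnj A) * A) $$ (i, j) = (\<Sum>k<length vs. quat_cnj (A $$ (k, i)) * A $$ (k, j))"
      using dA ij by (simp add: scalar_prod_def atLeast0LessThan)
    also have "\<dots> = hinner (u *v (vs!i)) (u *v (vs!j))"
      using A ij by (simp add: acts_def hinner_hcomb_hortho[OF vs])
    also have "\<dots> = 1\<^sub>m (length vs) $$ (i, j)" using vs ij by (simp add: unitary_hinner[OF u] hortho_def)
    finally show "(transpose_mat (map_mat quat_cnj A) * A) $$ (i, j) = 1\<^sub>m (length vs) $$ (i, j)" .
  qed (use dA in auto)
  ultimately show ?thesis using dA by (simp add: Sp_def)
qed

text \<open>\<open>invertible_mat\<close> provides a right inverse B, and the left inverse formed by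
  the conjugate transpose must equal it.\<close>

lemma Sp_right_inverse:
  assumes "A \<in> Sp m" shows "A * transpose_mat (map_mat quat_cnj A) = 1\<^sub>m m"
proof -
  let ?A = "transpose_mat (map_mat quat_cnj A)"
  have A: "A \<in> carrier_mat m m" "?A * A = 1\<^sub>m m" "?A \<in> carrier_mat m m" using assms by (auto simp: Sp_def)
  obtain B where B: "A * B = 1\<^sub>m m" "B * A = 1\<^sub>m (dim_row B)"
    using assms A(1) by (auto simp: Sp_def invertible_mat_def inverts_mat_def)
  have "dim_col B = m" using arg_cong[OF B(1), of dim_col] by (simp only: index_mult_mat(3) index_one_mat(3))
  moreover have "dim_row B = m"
    using arg_cong[OF B(2), of dim_col] carrier_matD(2)[OF A(1)] by (simp only: index_mult_mat(3) index_one_mat(3))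
  ultimately have dB: "B \<in> carrier_mat m m" by (intro carrier_matI)
  have "?A = ?A * (A * B)" using A(3) by (simp add: B(1))
  also have "\<dots> = B" using A dB by (simp add: assoc_mult_mat[of ?A m m A m B m, symmetric])
  finally show ?thesis using B(1) by simp
qed

text \<open>The coefficient of the pair (i, k) in the new sum is the entry (i, k) of A A* = 1.
  \<open>vs\<close> is an arbitrary list here.\<close>

lemma osum_acts_Sp:
  assumes A: "acts g vs A" "A \<in> Sp (length vs)" shows "osum (map ((*v) g) vs) = osum vs"
proof -
  let ?m = "length vs"
  have dA: "A \<in> carrier_mat ?m ?m" using A by (auto simp: acts_def)
  have outer_hcomb: "outer (hcomb vs c) (hcomb vs c) = (\<Sum>i<?m. \<Sum>k<?m. outer (rscale (vs!i) (c i * quat_cnj (c k))) (vs!k))" for c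
  proof -
    have 1: "outer (sum f S) y = (\<Sum>i\<in>S. outer (f i) y)" "outer y (sum f S) = (\<Sum>i\<in>S. outer y (f i))"
      for f :: "nat \<Rightarrow> quat^'a" and S and y :: "quat^'a"
      by (simp_all add: outer_def Finite_Cartesian_Product.vec_eq_iff sum_distrib_right sum_distrib_left quat_cnj_sum)
    have 2: "outer (rscale x p) (rscale y q) = outer (rscale x (p * quat_cnj q)) y" for x y :: "quat^'a" and p q
      by (simp add: outer_def Finite_Cartesian_Product.vec_eq_iff quat_cnj_mult mult.assoc)
    show ?thesis unfolding hcomb_def 1 2 by (rule sum.swap)
  qed
  have "osum (map ((*v) g) vs) = (\<Sum>j<?m. \<Sum>i<?m. \<Sum>k<?m. outer (rscale (vs!i) (A $$ (i, j) * quat_cnj (A $$ (k, j)))) (vs!k))"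
    unfolding osum_conv_sum length_map using A(1) by (intro sum.cong) (auto simp: acts_def outer_hcomb)
  also have "\<dots> = (\<Sum>i<?m. \<Sum>j<?m. \<Sum>k<?m. outer (rscale (vs!i) (A $$ (i, j) * quat_cnj (A $$ (k, j)))) (vs!k))"
    by (rule sum.swap)
  also have "\<dots> = (\<Sum>i<?m. \<Sum>k<?m. \<Sum>j<?m. outer (rscale (vs!i) (A $$ (i, j) * quat_cnj (A $$ (k, j)))) (vs!k))"
    by (intro sum.cong refl sum.swap)
  also have "\<dots> = (\<Sum>i<?m. \<Sum>k<?m. if i = k then outer (vs!i) (vs!i) else 0)"
  proof (intro sum.cong refl)
    fix i k assume ik: "i \<in> {..<?m}" "k \<in> {..<?m}"
    have "(\<Sum>j<?m. outer (rscale (vs!i) (A $$ (i, j) * quat_cnj (A $$ (k, j)))) (vs!k)) =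
        outer (rscale (vs!i) (\<Sum>j<?m. A $$ (i, j) * quat_cnj (A $$ (k, j)))) (vs!k)"
      by (simp add: outer_def Finite_Cartesian_Product.vec_eq_iff sum_distrib_left sum_distrib_right mult.assoc)
    also have "(\<Sum>j<?m. A $$ (i, j) * quat_cnj (A $$ (k, j))) = (A * transpose_mat (map_mat quat_cnj A)) $$ (i, k)"
      using dA ik by (simp add: scalar_prod_def atLeast0LessThan)
    also have "\<dots> = (if i = k then 1 else 0)" using Sp_right_inverse[OF A(2)] ik by simp
    finally show "(\<Sum>j<?m. outer (rscale (vs!i) (A $$ (i, j) * quat_cnj (A $$ (k, j)))) (vs!k)) =
        (if i = k then outer (vs!i) (vs!i) else 0)"
      by (auto simp: outer_def Finite_Cartesian_Product.vec_eq_iff)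
  qed
  also have "\<dots> = osum vs" by (simp add: osum_conv_sum)
  finally show ?thesis .
qed

lemma block_D_cong: "(\<And>d. d \<in> set ds \<Longrightarrow> A d = B d) \<Longrightarrow> block_D ds A = block_D ds B"
  unfolding block_D_pairs by (intro arg_cong[where f="\<lambda>xs. typed_matrix (diag_block_mat xs)"] map_cong refl)
    (auto simp: set_pairs)

lemma block_Sp_I:
  assumes "\<And>d. d \<in> set ds \<Longrightarrow> A d \<in> Sp (t d)" shows "block_D ds A \<in> block_Sp ds t"
proof -
  have "block_D ds A = block_D ds (restrict A (set ds))" by (rule block_D_cong) simp
  then show ?thesis unfolding block_Sp_def using assms by (intro CollectI exI[of _ "restrict A (set ds)"] conjI) auto
qed

context jordan_frame
begin

lemma unitary_commuting_L:
  assumes u: "unitary u" "u ** N0 = N0 ** u" and d: "d \<in> set ds" and x: "x \<in> range (hcomb (w d))"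
  shows "u *v x \<in> range (hcomb (w d))"
proof -
  have "gens N0 d = (*v) u ` gens N0 d" by (rule gens_unitary[OF u(1)]) (simp add: u(2))
  moreover have "gens N0 d = range (hcomb (w d))" using gens_eq_L[of d] ds_pos[OF d] d by (simp add: L_def)
  ultimately show ?thesis using x by blast
qed

lemma adj_commute: "unitary u \<Longrightarrow> u ** N0 = N0 ** u \<Longrightarrow> adj u ** N0 = N0 ** adj u"
  by (metis matrix_mul_assoc matrix_mul_lid matrix_mul_rid unitaryD(1,2))

text \<open>With the identity as basis matrix, \<open>Lambda\<close> is the identity. A unitary
  matrix commuting with N0 preserves its canonical generators, which gives the blocks. Conversely,
  symplectic blocks keep \<open>osum\<close> of each \<open>w d\<close>, hence that of the whole
  frame, and this forces unitarity.\<close>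

lemma unitary_centralizer:
  assumes b: "basis_matrix (frame N0 ds w) = mat 1"
  shows "{u. unitary u \<and> u ** N0 = N0 ** u} = block_Sp ds (\<lambda>d. length (w d))"
proof
  have L: "Lambda (frame N0 ds w) u = u" for u by (subst Lambda_eq(1)) (simp_all add: b)
  show "{u. unitary u \<and> u ** N0 = N0 ** u} \<subseteq> block_Sp ds (\<lambda>d. length (w d))"
  proof clarify
    fix u assume u: "unitary u" "u ** N0 = N0 ** u"
    have "\<exists>A. acts u (w d) A \<and> A \<in> Sp (length (w d))" if d: "d \<in> set ds" for d
    proof -
      obtain A where A: "acts u (w d) A"
        using acts_exists[OF hortho_hbasis[OF w_hortho[OF d]]] unitary_commuting_L[OF u d] by blast
      have "A \<in> Sp (length (w d))"
        by (rule acts_Sp[OF u(1) w_hortho[OF d] A unitary_commuting_L[OF unitaryD(5)[OF u(1)] adj_commute[OF u] d]])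
      then show ?thesis using A by blast
    qed
    then obtain A where A: "\<And>d. d \<in> set ds \<Longrightarrow> acts u (w d) (A d) \<and> A d \<in> Sp (length (w d))" by metis
    have "u = block_D ds A" using Lambda_frame[OF frame_hbasis _ u(2)[symmetric], of A] A L by metis
    then show "u \<in> block_Sp ds (\<lambda>d. length (w d))" using A block_Sp_I by metis
  qed
  show "block_Sp ds (\<lambda>d. length (w d)) \<subseteq> {u. unitary u \<and> u ** N0 = N0 ** u}"
  proof
    fix u :: "quat^('n::{finite,linorder})^('n::{finite,linorder})"
    assume "u \<in> block_Sp ds (\<lambda>d. length (w d))"
    then obtain A where A: "u = block_D ds A" "\<And>d. d \<in> set ds \<Longrightarrow> A d \<in> Sp (length (w d))"
      by (auto simp: block_Sp_def PiE_iff)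
    \<comment> \<open>The images of the generators prescribed by the columns of the blocks;
      \<open>frame_map_exists\<close> extends them to a matrix commuting with N0.\<close>
    define w' where "w' = (\<lambda>d. map (\<lambda>j. hcomb (w d) (\<lambda>i. A d $$ (i, j))) [0..<length (w d)])"
    have "mpow N0 d *v x = 0" if "d \<in> set ds" "x \<in> set (w' d)" for d x
      using L_top[of x d d] that by (auto simp: L_def w'_def)
    then obtain h where h: "N0 ** h = h ** N0" "\<And>d. d \<in> set ds \<Longrightarrow> map ((*v) h) (w d) = w' d"
      using frame_map_exists[OF frame_hbasis pos, of w' N0] top by (metis (mono_tags, lifting) w'_def length_map map_nth)
    have acts: "acts h (w d) (A d)" if d: "d \<in> set ds" for d
    proof -
      have "h *v (w d ! j) = hcomb (w d) (\<lambda>i. A d $$ (i, j))" if "j < length (w d)" for j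
        using arg_cong[OF h(2)[OF d], of "\<lambda>xs. xs ! j"] that by (simp add: w'_def)
      then show ?thesis using A(2)[OF d] by (auto simp: acts_def Sp_def)
    qed
    have hu: "h = u" using Lambda_frame[OF frame_hbasis acts h(1)] L A(1) by simp
    have "frame N0 ds (\<lambda>d. map ((*v) h) (w d)) = map ((*v) h) (frame N0 ds w)" by (rule frame_map_commute[OF h(1)])
    then have "h ** osum (frame N0 ds w) ** adj h = osum (frame N0 ds (\<lambda>d. map ((*v) h) (w d)))" by (simp add: osum_map)
    also have "\<dots> = osum (frame N0 ds w)"
      unfolding osum_frame[OF dist] using osum_acts_Sp[OF acts A(2)] by simp
    finally have "h ** adj h = mat 1" by (simp add: osum_frame_one)
    then have "unitary h" unfolding unitary_def by (rule left_inverse_imp_invertible(2))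
    then show "u \<in> {u. unitary u \<and> u ** N0 = N0 ** u}" using h(1) hu by simp
  qed
qed

end

section \<open>Bases adapted to the triple\<close>

lemma hbasis_map:
  assumes "hbasis W vs" "\<And>x. x \<in> W \<Longrightarrow> A *v x = 0 \<Longrightarrow> x = 0"
  shows "hbasis ((*v) A ` W) (map ((*v) A) vs)"
  using assms unfolding hbasis_def by (auto simp: hcomb_map image_iff)

lemma hsubspace_image: "hsubspace W \<Longrightarrow> hsubspace ((*v) A ` W)"
  unfolding hsubspace_def by (auto simp: qmv_rscale[symmetric] intro!: linear_subspace_image linear_qmv)

context sl2_matrices
begin

lemma ordered_bases_iff: "ordered_bases X H Y v \<longleftrightarrow> (\<forall>d\<in>set (parts X H Y). hbasis (E (d - 1)) (v d))"
  using lowest_eq by (auto simp: ordered_bases_def set_parts)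

lemma parts_pos: "d \<in> set (parts X H Y) \<Longrightarrow> 1 \<le> d" and zero_notin_parts: "0 \<notin> set (parts X H Y)"
  by (auto simp: set_parts)

lemma ordered_bases_length:
  "ordered_bases X H Y v \<Longrightarrow> d \<in> set (parts X H Y) \<Longrightarrow> length (v d) = part_mult X H Y d"
  unfolding ordered_bases_def part_mult_def using hdim_eq by metis

lemma E_in_parts: "e \<in> E j \<Longrightarrow> e \<noteq> 0 \<Longrightarrow> Suc j \<in> set (parts X H Y)"
  by (auto simp: set_parts)

lemma mpow_E_zero: "x \<in> E (d - 1) \<Longrightarrow> 1 \<le> d \<Longrightarrow> mpow X d *v x = 0"
  unfolding mpow_qmv by (rule X_E_zero) auto

text \<open>Each block is an injective image of E (d-1) under X^l; independence of the blocks is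
  \<open>sum_direct\<close>, and spanning is \<open>complete_reducibility\<close>.\<close>

lemma frame_basis:
  assumes v: "ordered_bases X H Y v" shows "hbasis UNIV (frame X (parts X H Y) v)"
proof -
  let ?ds = "parts X H Y"
  define W where "W = (\<lambda>(d, l). (*v) (mpow X l) ` E (d - 1))"
  define b where "b = (\<lambda>(d, l). map ((*v) (mpow X l)) (v d))"
  let ?R = "{\<Sum>p\<in>set (pairs ?ds). x p |x. \<forall>p\<in>set (pairs ?ds). x p \<in> W p}"
  have hb: "hbasis (W p) (b p)" if p: "p \<in> set (pairs ?ds)" for p
  proof -
    obtain d l where dl: "p = (d, l)" "d \<in> set ?ds" "l < d" using p by (auto simp: set_pairs)
    have "hbasis (E (d - 1)) (v d)" using v dl(2) by (simp add: ordered_bases_iff)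
    moreover have "x = 0" if "x \<in> E (d - 1)" "mpow X l *v x = 0" for x
    proof (rule ccontr)
      assume "x \<noteq> 0"
      moreover have "l \<le> d - 1" using dl(3) by simp
      ultimately have "((*v) X ^^ l) x \<noteq> 0" by (rule X_E_nonzero[OF that(1)])
      then show False using that(2) by (simp add: mpow_qmv)
    qed
    ultimately show ?thesis unfolding W_def b_def dl(1) by (auto intro: hbasis_map)
  qed
  have R: "hbasis ?R (concat (map b (pairs ?ds)))"
  proof (rule hbasis_concat[OF distinct_pairs[OF distinct_parts] hb])
    fix x assume x: "\<And>p. p \<in> set (pairs ?ds) \<Longrightarrow> x p \<in> W p" and s: "(\<Sum>p\<in>set (pairs ?ds). x p) = 0"
    have "\<forall>p\<in>set (pairs ?ds). \<exists>e\<in>E (fst p - 1). x p = mpow X (snd p) *v e"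
      using x by (fastforce simp: W_def case_prod_unfold)
    then obtain e where e: "\<And>p. p \<in> set (pairs ?ds) \<Longrightarrow> e p \<in> E (fst p - 1) \<and> x p = mpow X (snd p) *v e p" by metis
    \<comment> \<open>\<open>sum_direct\<close> is indexed by j = d - 1 and \<open>parts\<close> by
      d; the shift is injective because all parts are positive.\<close>
    let ?D = "(\<lambda>d. d - 1) ` set ?ds"
    have inj: "inj_on (\<lambda>d. d - 1) (set ?ds)" using parts_pos by (intro inj_onI) (metis diff_add_inverse le_Suc_ex plus_1_eq_Suc add.commute)
    have mem: "(Suc j, l) \<in> set (pairs ?ds)" if "j \<in> ?D" "l \<le> j" for j l
      using that parts_pos by (fastforce simp: set_pairs)
    have "(\<Sum>j\<in>?D. \<Sum>l\<le>j. ((*v) X ^^ l) (e (Suc j, l))) = (\<Sum>d\<in>set ?ds. \<Sum>l\<le>d - 1. ((*v) X ^^ l) (e (Suc (d - 1), l)))"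
      unfolding sum.reindex[OF inj] o_def ..
    also have "\<dots> = (\<Sum>d\<in>set ?ds. \<Sum>l<d. x (d, l))"
    proof (rule sum.cong[OF refl])
      fix d assume d: "d \<in> set ?ds"
      then have "{..d - 1} = {..<d}" using parts_pos[OF d] by auto
      then show "(\<Sum>l\<le>d - 1. ((*v) X ^^ l) (e (Suc (d - 1), l))) = (\<Sum>l<d. x (d, l))"
        using e d parts_pos[OF d] by (auto simp: set_pairs mpow_qmv[symmetric] intro!: sum.cong)
    qed
    also have "\<dots> = 0" using s by (simp add: sum_pairs)
    finally have 0: "(\<Sum>j\<in>?D. \<Sum>l\<le>j. ((*v) X ^^ l) (e (Suc j, l))) = 0" .
    show "\<forall>p\<in>set (pairs ?ds). x p = 0"
    proof
      fix p assume p: "p \<in> set (pairs ?ds)"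
      obtain d l where dl: "p = (d, l)" "d \<in> set ?ds" "l < d" using p by (auto simp: set_pairs)
      have "e (Suc (d - 1), l) = 0"
      proof (rule sum_direct[OF _ _ 0])
        show "e (Suc j, l) \<in> E j" if "j \<in> ?D" "l \<le> j" for j l using e[OF mem[OF that]] by simp
      qed (use dl in auto)
      then show "x p = 0" using e[OF p] dl parts_pos[OF dl(2)] by simp
    qed
  qed
  have sR: "subspace ?R" using hbasis_hsubspace[OF R] by (simp add: hsubspace_def)
  have "{((*v) X ^^ l) e |l j e. e \<in> E j \<and> l \<le> j} \<subseteq> ?R"
  proof clarify
    fix l j e assume e: "e \<in> E j" "l \<le> j"
    have "((*v) X ^^ l) e \<in> ?R"
    proof (cases "e = 0")
      case True
      then show ?thesis using subspace_0[OF sR] by (simp add: linear_0[OF linX])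
    next
      case False
      let ?p = "(Suc j, l)"
      have p: "?p \<in> set (pairs ?ds)" using E_in_parts[OF e(1) False] e(2) by (auto simp: set_pairs)
      let ?x = "\<lambda>p. if p = ?p then ((*v) X ^^ l) e else 0"
      have "((*v) X ^^ l) e = (\<Sum>p\<in>set (pairs ?ds). ?x p)" using p by simp
      moreover have "?x p \<in> W p" if "p \<in> set (pairs ?ds)" for p
        using e(1) subspace_0 hbasis_hsubspace[OF hb[OF that]] by (auto simp: hsubspace_def W_def mpow_qmv[symmetric])
      ultimately show ?thesis by (intro CollectI exI[of _ ?x] conjI ballI)
    qed
    then show "\<exists>x. ((*v) X ^^ l) e = (\<Sum>p\<in>set (pairs ?ds). x p) \<and> (\<forall>p\<in>set (pairs ?ds). x p \<in> W p)" by blast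
  qed
  then have "span {((*v) X ^^ l) e |l j e. e \<in> E j \<and> l \<le> j} \<subseteq> ?R" by (rule span_minimal[OF _ sR])
  then have "?R = UNIV" using complete_reducibility by blast
  then show ?thesis using R by (simp add: frame_def b_def)
qed

text \<open>On X^l E j, H is the scalar 2 l - j, and Y is a scalar times the step back to X^(l-1). A
  matrix commuting with X and preserving every E j thus commutes with both on all strings, which
  span.\<close>

lemma commute_HY:
  assumes gX: "g ** X = X ** g" and gE: "\<And>d x. d \<in> set (parts X H Y) \<Longrightarrow> x \<in> E (d - 1) \<Longrightarrow> g *v x \<in> E (d - 1)"
  shows "g ** H = H ** g" "g ** Y = Y ** g"
proof -
  have gE': "g *v e \<in> E j" if "e \<in> E j" for e j
  proof (cases "e = 0")
    case True
    then show ?thesis using subspace_0[OF subspace_E] by simp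
  next
    case False
    then show ?thesis using gE[OF E_in_parts[OF that False]] that by simp
  qed
  have gpow: "g *v ((*v) X ^^ l) e = ((*v) X ^^ l) (g *v e)" for l e
    unfolding mpow_qmv[symmetric] matrix_vector_mul_assoc using mpow_commute[OF gX[symmetric]] by simp
  have eq: "g ** A = A ** g"
    if "\<And>e j l. e \<in> E j \<Longrightarrow> l \<le> j \<Longrightarrow> g *v (A *v ((*v) X ^^ l) e) = A *v (g *v ((*v) X ^^ l) e)" for A
    unfolding matrix_eq
  proof
    fix x
    show "(g ** A) *v x = (A ** g) *v x"
      by (rule linear_eq_on_span[OF linear_qmv linear_qmv _ complete_reducibility])
        (use that in \<open>auto simp: matrix_vector_mul_assoc[symmetric]\<close>)
  qed
  show "g ** H = H ** g"
  proof (rule eq)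
    fix e j l assume e: "e \<in> E j"
    show "g *v (H *v ((*v) X ^^ l) e) = H *v (g *v ((*v) X ^^ l) e)"
      unfolding gpow HX_E[OF e] HX_E[OF gE'[OF e]] qmv_scaleR ..
  qed
  show "g ** Y = Y ** g"
  proof (rule eq)
    fix e j l assume e: "e \<in> E j"
    show "g *v (Y *v ((*v) X ^^ l) e) = Y *v (g *v ((*v) X ^^ l) e)"
    proof (cases l)
      case 0
      then show ?thesis using e gE'[OF e] by (simp add: E_def)
    next
      case (Suc k)
      show ?thesis unfolding Suc gpow YX_E[OF e] YX_E[OF gE'[OF e]] qmv_scaleR ..
    qed
  qed
qed

lemma commuting_E:
  assumes "g ** H = H ** g" "g ** Y = Y ** g" "x \<in> E j" shows "g *v x \<in> E j"
proof -
  have "Y *v (g *v x) = g *v (Y *v x)" "H *v (g *v x) = g *v (H *v x)"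
    by (simp_all add: matrix_vector_mul_assoc assms(1,2))
  then show ?thesis using assms(3) by (simp add: E_def qmv_scaleR qmv_neg)
qed

end

section \<open>The centralizer as a matrix group\<close>

lemma centralizer_iff:
  "g \<in> centralizer X H Y \<longleftrightarrow> g \<in> SLH \<and> g ** X = X ** g \<and> g ** H = H ** g \<and> g ** Y = Y ** g"
proof -
  have "Ad g A = A \<longleftrightarrow> g ** A = A ** g" if "g \<in> SLH" for A
    using matrix_inv_mult[of g] that unfolding Ad_def SLH_def
    by (metis (mono_tags, lifting) matrix_mul_assoc matrix_mul_rid mem_Collect_eq)
  then show ?thesis by (auto simp: centralizer_def)
qed

lemma commute_inv:
  fixes g :: "quat^'n^'n"
  assumes "invertible g" "g ** A = A ** g" shows "matrix_inv g ** A = A ** matrix_inv g"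
proof -
  have "matrix_inv g ** (A ** g) ** matrix_inv g = matrix_inv g ** (g ** A) ** matrix_inv g" by (simp add: assms(2))
  then have "matrix_inv g ** A ** (g ** matrix_inv g) = (matrix_inv g ** g) ** A ** matrix_inv g"
    by (simp add: matrix_mul_assoc)
  then show ?thesis by (simp add: matrix_inv_mult assms(1))
qed

text \<open>The inverse in \<open>matrix_group\<close> is a definite description over the carrier;
  once it is identified with \<open>matrix_inv\<close>, only statements about matrices
  remain.\<close>

lemma subgroup_centralizerI:
  fixes X H Y :: "quat^'n^'n"
  assumes G: "G \<subseteq> centralizer X H Y" "mat 1 \<in> G" "\<And>g h. g \<in> G \<Longrightarrow> h \<in> G \<Longrightarrow> g ** h \<in> G"
    "\<And>g. g \<in> G \<Longrightarrow> matrix_inv g \<in> G"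
  shows "subgroup G (matrix_group (centralizer X H Y))"
proof
  fix g assume g: "g \<in> G"
  then have gi: "invertible g" using G(1) by (auto simp: centralizer_iff SLH_def)
  have "inv\<^bsub>matrix_group (centralizer X H Y)\<^esub> g = matrix_inv g"
    unfolding m_inv_def
  proof (rule the_equality)
    show "matrix_inv g \<in> carrier (matrix_group (centralizer X H Y)) \<and>
      g \<otimes>\<^bsub>matrix_group (centralizer X H Y)\<^esub> matrix_inv g = \<one>\<^bsub>matrix_group (centralizer X H Y)\<^esub> \<and>
      matrix_inv g \<otimes>\<^bsub>matrix_group (centralizer X H Y)\<^esub> g = \<one>\<^bsub>matrix_group (centralizer X H Y)\<^esub>"
      using G(1) G(4)[OF g] matrix_inv_mult[OF gi] by (auto simp: matrix_group_def)
    fix h assume "h \<in> carrier (matrix_group (centralizer X H Y)) \<and>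
      g \<otimes>\<^bsub>matrix_group (centralizer X H Y)\<^esub> h = \<one>\<^bsub>matrix_group (centralizer X H Y)\<^esub> \<and>
      h \<otimes>\<^bsub>matrix_group (centralizer X H Y)\<^esub> g = \<one>\<^bsub>matrix_group (centralizer X H Y)\<^esub>"
    then show "h = matrix_inv g" using matrix_inv_unique[of h g] by (simp add: matrix_group_def)
  qed
  then show "inv\<^bsub>matrix_group (centralizer X H Y)\<^esub> g \<in> G" using G(4)[OF g] by simp
qed (use G in \<open>auto simp: matrix_group_def\<close>)

text \<open>A nonzero real factor cancels in \<open>Ad\<close>, and \<open>SLH_scaling\<close> finds
  one that brings g to reduced norm 1.\<close>

lemma orbit_eq_gl_orbit: "orbit X = gl_orbit X" for X :: "quat^'n^'n"
proof
  show "orbit X \<subseteq> gl_orbit X" by (auto simp: orbit_def gl_orbit_def Ad_def SLH_def)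
  show "gl_orbit X \<subseteq> orbit X"
  proof
    fix N assume "N \<in> gl_orbit X"
    then obtain g where g: "invertible g" "N ** g = g ** X" by (auto simp: gl_orbit_iff)
    obtain r where r: "r *\<^sub>R g \<in> SLH" using SLH_scaling[OF g(1)] by metis
    then have i: "invertible (r *\<^sub>R g)" by (simp add: SLH_def)
    have "(r *\<^sub>R g) ** X = N ** (r *\<^sub>R g)" by (simp add: qmult_scaleR_left qmult_scaleR_right g(2))
    then have "Ad (r *\<^sub>R g) X = N ** ((r *\<^sub>R g) ** matrix_inv (r *\<^sub>R g))" by (simp add: Ad_def matrix_mul_assoc)
    then have "N = Ad (r *\<^sub>R g) X" by (simp add: matrix_inv_mult(1)[OF i])
    then show "N \<in> orbit X" using r by (auto simp: orbit_def)
  qed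
qed

lemma hortho_basis_matrix:
  fixes B :: "(quat^('n::{finite,linorder})) list"
  assumes l: "length B = CARD('n)" and u: "unitary (basis_matrix B)" shows "hortho B"
  unfolding hortho_def
proof (intro allI impI)
  fix i j assume "i < length B" "j < length B"
  then obtain a b :: 'n where ab: "i = index_pos a" "j = index_pos b" using index_pos_ex l by metis
  have inj: "inj (index_pos :: 'n \<Rightarrow> nat)" using index_pos_bij by (auto simp: bij_betw_def)
  have "hinner (B ! i) (B ! j) = (adj (basis_matrix B) ** basis_matrix B) $ a $ b"
    by (simp add: ab hinner_def matrix_matrix_mult_def adj_def basis_matrix_def)
  also have "\<dots> = (if i = j then 1 else 0)"
    using unitaryD(1)[OF u] by (simp add: ab inj_eq[OF inj] Finite_Cartesian_Product.mat_def)
  finally show "hinner (B ! i) (B ! j) = (if i = j then 1 else 0)" .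
qed

lemma block_Sp_cong: "(\<And>d. d \<in> set ds \<Longrightarrow> t d = t' d) \<Longrightarrow> block_Sp ds t = block_Sp ds t'"
  unfolding block_Sp_def by (metis (mono_tags, lifting) PiE_cong)

text \<open>G is the stabilizer of X among the matrices unitary for the form in which the basis is
  orthonormal. It already centralizes the whole triple, so it is a candidate for K and at the same
  time the stabilizer that describes the orbit.\<close>

lemma unitary_centralizer_basis:
  fixes X H Y :: "quat^('n::{finite,linorder})^('n::{finite,linorder})"
  assumes rep: "sl2_matrices X H Y m" and v: "ordered_bases X H Y v"
  defines "b \<equiv> basis_matrix (frame X (parts X H Y) v)"
  defines "G \<equiv> {g. unitary (matrix_inv b ** g ** b) \<and> g ** X = X ** g}"
  shows "compact_subgroup G (centralizer X H Y)"
    and "Lambda (total_basis X H Y v) ` G = block_Sp (parts X H Y) (part_mult X H Y)"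
    and "top_of_set (orbit X) homotopy_equivalent_space
      coset_space Sp_typed (block_Sp (parts X H Y) (part_mult X H Y) :: (quat^('n::{finite,linorder})^('n::{finite,linorder})) set)"
proof -
  interpret sl2_matrices X H Y m by (rule rep)
  let ?ds = "parts X H Y" and ?B = "frame X (parts X H Y) v" and ?c = "matrix_inv b"
  have B: "hbasis UNIV ?B" by (rule frame_basis[OF v])
  have len: "length ?B = CARD('n)" by (rule hbasis_UNIV_length[OF B])
  have b: "invertible b" unfolding b_def by (rule hbasis_UNIV_invertible[OF B])
  note bc = matrix_inv_mult[OF b]
  \<comment> \<open>X in the coordinates where its Jordan basis is the standard basis and hence
    orthonormal, as \<open>jordan_frame\<close> requires.\<close>
  define N where "N = ?c ** X ** b"
  define w where "w = (\<lambda>d. map ((*v) ?c) (v d))"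
  have Nc: "N ** ?c = ?c ** X" by (simp add: N_def matrix_mul_assoc[symmetric] bc)
  have bN: "b ** N = X ** b" by (simp add: N_def matrix_mul_assoc bc)
  have F: "frame N ?ds w = map ((*v) ?c) ?B" unfolding w_def by (rule frame_map_commute[OF Nc])
  have bm: "basis_matrix (frame N ?ds w) = mat 1"
    unfolding F basis_matrix_map[OF len] b_def[symmetric] by (rule bc)
  have vE: "hbasis (E (d - 1)) (v d)" if "d \<in> set ?ds" for d using v that by (simp add: ordered_bases_iff)
  interpret J: jordan_frame N ?ds w
  proof
    show "distinct ?ds" "0 \<notin> set ?ds" by (rule distinct_parts, rule zero_notin_parts)
    show "length (frame N ?ds w) = CARD('n)" by (simp add: F len)
    then show "hortho (frame N ?ds w)" by (rule hortho_basis_matrix) (simp add: bm unitary_one)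
    fix d x assume d: "d \<in> set ?ds" "x \<in> set (w d)"
    then obtain y where y: "x = ?c *v y" "y \<in> set (v d)" by (auto simp: w_def)
    have "y \<in> E (d - 1)" using vE[OF d(1)] y(2) set_subset_range_hcomb[of "v d"] by (auto simp: hbasis_def)
    then have "mpow X d *v y = 0" using mpow_E_zero parts_pos[OF d(1)] by blast
    then show "mpow N d *v x = 0"
      by (simp add: y(1) matrix_vector_mul_assoc mpow_conj[OF Nc]) (simp add: matrix_vector_mul_assoc[symmetric])
  qed
  let ?U = "{u. unitary u \<and> u ** N = N ** u}"
  have U: "?U = block_Sp ?ds (part_mult X H Y)"
    unfolding J.unitary_centralizer[OF bm]
    by (rule block_Sp_cong) (simp add: w_def ordered_bases_length[OF v])
  have conj: "g ** X = X ** g \<longleftrightarrow> (?c ** g ** b) ** N = N ** (?c ** g ** b)" for g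
  proof -
    have 1: "(?c ** g ** b) ** N = ?c ** (g ** X) ** b"
      using bN by (metis matrix_mul_assoc)
    have 2: "N ** (?c ** g ** b) = ?c ** (X ** g) ** b"
      using Nc by (metis matrix_mul_assoc)
    have "?c ** P ** b = ?c ** Q ** b \<longleftrightarrow> P = Q" for P Q :: "quat^('n::{finite,linorder})^('n::{finite,linorder})"
    proof
      assume "?c ** P ** b = ?c ** Q ** b"
      then have "b ** (?c ** P ** b) ** ?c = b ** (?c ** Q ** b) ** ?c" by simp
      then have "(b ** ?c) ** P ** (b ** ?c) = (b ** ?c) ** Q ** (b ** ?c)" by (simp only: matrix_mul_assoc)
      then show "P = Q" by (simp add: bc)
    qed simp
    then show ?thesis unfolding 1 2 by blast
  qed
  have Lam: "Lambda (total_basis X H Y v) g = ?c ** g ** b" for g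
    unfolding total_basis_frame b_def by (rule Lambda_eq(1)[OF hbasis_UNIV_invertible[OF B]])
  have GU: "G = (\<lambda>u. b ** u ** ?c) ` ?U"
  proof
    show "G \<subseteq> (\<lambda>u. b ** u ** ?c) ` ?U"
    proof
      fix g assume g: "g \<in> G"
      have "g = (b ** ?c) ** g ** (b ** ?c)" by (simp add: bc)
      then have "g = b ** (?c ** g ** b) ** ?c" by (simp only: matrix_mul_assoc)
      then show "g \<in> (\<lambda>u. b ** u ** ?c) ` ?U" using g conj[of g] unfolding G_def by blast
    qed
    show "(\<lambda>u. b ** u ** ?c) ` ?U \<subseteq> G"
    proof clarify
      fix u assume u: "unitary u" "u ** N = N ** u"
      have "?c ** (b ** u ** ?c) ** b = (?c ** b) ** u ** (?c ** b)" by (simp only: matrix_mul_assoc)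
      then have "?c ** (b ** u ** ?c) ** b = u" by (simp add: bc)
      then show "b ** u ** ?c \<in> G" unfolding G_def using u conj[of "b ** u ** ?c"] by simp
    qed
  qed
  have cbu: "?c ** (b ** u ** ?c) ** b = u" for u
  proof -
    have "?c ** (b ** u ** ?c) ** b = (?c ** b) ** u ** (?c ** b)" by (simp only: matrix_mul_assoc)
    then show ?thesis by (simp add: bc)
  qed
  show "Lambda (total_basis X H Y v) ` G = block_Sp ?ds (part_mult X H Y)"
    unfolding U[symmetric] GU image_image Lam cbu by simp
  \<comment> \<open>The conjugate u of g is unitary, so g has reduced norm 1. As u preserves the
    canonical generators of N, g preserves every E (d-1), and \<open>commute_HY\<close>
    applies.\<close>
  have "G \<subseteq> centralizer X H Y"
  proof
    fix g assume g: "g \<in> G"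
    then obtain u where u: "unitary u" "u ** N = N ** u" "g = b ** u ** ?c" unfolding GU by blast
    have "reduced_norm b * reduced_norm ?c = 1" unfolding reduced_norm_mult[symmetric] by (simp add: bc)
    moreover have "u \<in> SLH" using u(1) by (intro unitary_SLH) (simp add: unitary_def)
    moreover have "reduced_norm g = (reduced_norm b * reduced_norm ?c) * reduced_norm u"
      by (simp add: u(3) reduced_norm_mult)
    ultimately have "g \<in> SLH"
      unfolding SLH_def using u(3) by (auto intro!: invertible_mult b invertible_matrix_inv)
    moreover have gX: "g ** X = X ** g" using g by (simp add: G_def)
    moreover have "g *v x \<in> E (d - 1)" if d: "d \<in> set ?ds" and x: "x \<in> E (d - 1)" for d x
    proof -
      obtain a where a: "x = hcomb (v d) a" using vE[OF d] x by (auto simp: hbasis_def)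
      have "?c *v x \<in> range (hcomb (w d))" by (simp add: a w_def hcomb_map)
      then have "u *v (?c *v x) \<in> range (hcomb (w d))" by (rule J.unitary_commuting_L[OF u(1,2) d])
      then obtain a' where "u *v (?c *v x) = ?c *v hcomb (v d) a'" by (auto simp: w_def hcomb_map)
      then have "g *v x = hcomb (v d) a'"
        by (simp add: u(3) matrix_vector_mul_assoc[symmetric]) (simp add: matrix_vector_mul_assoc bc)
      then show ?thesis using vE[OF d] by (auto simp: hbasis_def)
    qed
    ultimately show "g \<in> centralizer X H Y" unfolding centralizer_iff using commute_HY by blast
  qed
  moreover have "compact G"
  proof -
    have "closed {u. u ** N = N ** u}" by (intro closed_Collect_eq continuous_intros)
    then have "compact (Collect unitary \<inter> {u. u ** N = N ** u})" by (rule compact_Int_closed[OF compact_unitary])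
    moreover have "Collect unitary \<inter> {u. u ** N = N ** u} = ?U" by blast
    ultimately have "compact ?U" by (simp only:)
    then show ?thesis unfolding GU by (intro compact_continuous_image continuous_intros)
  qed
  moreover have "mat 1 \<in> G" by (simp add: G_def bc unitary_one)
  moreover have "g ** h \<in> G" if "g \<in> G" "h \<in> G" for g h
  proof -
    have "?c ** (g ** h) ** b = ?c ** g ** (b ** ?c) ** h ** b" by (simp add: bc matrix_mul_assoc)
    then have "?c ** (g ** h) ** b = (?c ** g ** b) ** (?c ** h ** b)" by (simp only: matrix_mul_assoc)
    moreover have "g ** h ** X = X ** (g ** h)" using that unfolding G_def by (metis (mono_tags, lifting) matrix_mul_assoc mem_Collect_eq)
    moreover have "unitary ((?c ** g ** b) ** (?c ** h ** b))"
      by (rule unitary_mult) (use that in \<open>simp_all add: G_def\<close>)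
    ultimately show ?thesis unfolding G_def by simp
  qed
  moreover have "matrix_inv g \<in> G" if g: "g \<in> G" for g
  proof -
    have gi: "invertible g" using g \<open>G \<subseteq> centralizer X H Y\<close> by (auto simp: centralizer_iff SLH_def)
    let ?u = "?c ** g ** b"
    have u: "unitary ?u" using g by (simp add: G_def)
    have "?c ** matrix_inv g ** b ** ?u = ?c ** (matrix_inv g ** (b ** ?c) ** g) ** b" by (simp only: matrix_mul_assoc)
    also have "\<dots> = mat 1" by (simp add: bc matrix_inv_mult[OF gi])
    finally have "matrix_inv ?u = ?c ** matrix_inv g ** b" by (rule matrix_inv_unique)
    then have "unitary (?c ** matrix_inv g ** b)" using unitaryD(4,5)[OF u] by simp
    then show ?thesis using g commute_inv[OF gi] by (simp add: G_def)
  qed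
  ultimately show "compact_subgroup G (centralizer X H Y)"
    unfolding compact_subgroup_def using subgroup_centralizerI by blast
  have "gl_orbit N = gl_orbit X"
  proof -
    have "M \<in> gl_orbit N \<longleftrightarrow> M \<in> gl_orbit X" for M
    proof
      assume "M \<in> gl_orbit N"
      then obtain g where g: "invertible g" "M ** g = g ** N" by (auto simp: gl_orbit_iff)
      have "M ** (g ** ?c) = (g ** ?c) ** X" by (metis g(2) Nc matrix_mul_assoc)
      then show "M \<in> gl_orbit X" unfolding gl_orbit_iff using invertible_mult[OF g(1) invertible_matrix_inv[OF b]] by blast
    next
      assume "M \<in> gl_orbit X"
      then obtain g where g: "invertible g" "M ** g = g ** X" by (auto simp: gl_orbit_iff)
      have "M ** (g ** b) = (g ** b) ** N" by (metis g(2) bN matrix_mul_assoc)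
      then show "M \<in> gl_orbit N" unfolding gl_orbit_iff using invertible_mult[OF g(1) b] by blast
    qed
    then show ?thesis by blast
  qed
  then have "top_of_set (orbit X) homotopy_equivalent_space top_of_set J.unitary_orbit"
    using J.gl_orbit_homotopy_equivalent by (simp add: orbit_eq_gl_orbit)
  moreover have "coset_space Sp_typed (block_Sp ?ds (part_mult X H Y) :: (quat^('n::{finite,linorder})^('n::{finite,linorder})) set) homeomorphic_space top_of_set J.unitary_orbit"
    unfolding Sp_typed_unitary U[symmetric] J.unitary_orbit_def by (rule coset_space_unitary_orbit)
  ultimately show "top_of_set (orbit X) homotopy_equivalent_space
      coset_space Sp_typed (block_Sp ?ds (part_mult X H Y) :: (quat^('n::{finite,linorder})^('n::{finite,linorder})) set)"
    by (meson homeomorphic_imp_homotopy_equivalent_space homeomorphic_space_sym homotopy_eqv_trans)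
qed

text \<open>Bases that are orthonormal for a form invariant under the compact group K.\<close>

lemma invariant_bases_exist:
  fixes X H Y :: "quat^('n::{finite,linorder})^('n::{finite,linorder})"
  assumes rep: "sl2_matrices X H Y m" and K: "compact_subgroup K (centralizer X H Y)"
  obtains v where "ordered_bases X H Y v"
    "\<And>k. k \<in> K \<Longrightarrow> Lambda (total_basis X H Y v) k \<in> block_Sp (parts X H Y) (part_mult X H Y)"
proof -
  interpret sl2_matrices X H Y m by (rule rep)
  let ?ds = "parts X H Y"
  have sub: "subgroup K (matrix_group (centralizer X H Y))" and cK: "compact K"
    using K by (simp_all add: compact_subgroup_def)
  have KZ: "k \<in> centralizer X H Y" if "k \<in> K" for k
    using subgroup.subset[OF sub] that by (auto simp: matrix_group_def)
  have Kinv: "invertible k" if "k \<in> K" for k using KZ[OF that] by (simp add: centralizer_iff SLH_def)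
  have K1: "mat 1 \<in> K" using subgroup.one_closed[OF sub] by (simp add: matrix_group_def)
  have Km: "k ** l \<in> K" if "k \<in> K" "l \<in> K" for k l
    using subgroup.m_closed[OF sub that] by (simp add: matrix_group_def)
  obtain M where M: "posdef M" "\<And>k. k \<in> K \<Longrightarrow> adj k ** M ** k = M"
    using invariant_form_exists[OF cK K1 Kinv Km] by blast
  \<comment> \<open>p carries the form M to the standard one, so p k p^-1 is unitary for k in K.
    Bases orthonormal for M are obtained by applying p^-1 to orthonormal bases of the images of the
    E (d-1).\<close>
  define p where "p = psqrt M"
  have p: "posdef p" "p ** p = M" using psqrt[OF M(1)] by (simp_all add: p_def)
  have pi: "invertible p" and ap: "adj p = p" using p(1) posdef_invertible by (auto simp: posdef_def)
  note pc = matrix_inv_mult[OF pi]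
  let ?c = "matrix_inv p"
  have ac: "adj ?c = ?c"
    by (rule matrix_inv_unique[symmetric]) (metis adj_mult adj_one ap pc(1))
  have "\<exists>ws. hortho ws \<and> (*v) p ` E (d - 1) = range (hcomb ws)" for d
    using hortho_basis_exists[OF hsubspace_image[OF hsubspace_E]] by metis
  then obtain ws where ws: "\<And>d. hortho (ws d) \<and> (*v) p ` E (d - 1) = range (hcomb (ws d))" by metis
  define v where "v = (\<lambda>d. map ((*v) ?c) (ws d))"
  have pv: "map ((*v) p) (v d) = ws d" for d by (simp add: v_def o_def matrix_vector_mul_assoc pc)
  have vb: "hbasis (E (d - 1)) (v d)" for d
  proof -
    have "hbasis ((*v) ?c ` (*v) p ` E (d - 1)) (v d)"
      unfolding v_def using ws[of d] hortho_hbasis[of "ws d"]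
      by (intro hbasis_map) (auto simp: invertible_matrix_inv[OF pi, unfolded invertible_iff_ker])
    then show ?thesis by (simp add: image_image matrix_vector_mul_assoc pc)
  qed
  have v: "ordered_bases X H Y v" unfolding ordered_bases_iff using vb by blast
  have "Lambda (total_basis X H Y v) k \<in> block_Sp ?ds (part_mult X H Y)" if k: "k \<in> K" for k
  proof -
    note ki = Kinv[OF k]
    have kZ: "k ** X = X ** k" "k ** H = H ** k" "k ** Y = Y ** k" using KZ[OF k] by (simp_all add: centralizer_iff)
    define u where "u = p ** k ** ?c"
    have up: "u ** p = p ** k" by (simp add: u_def matrix_mul_assoc[symmetric] pc)
    have "adj u ** u = ?c ** (adj k ** (p ** p) ** k) ** ?c"
      by (simp add: u_def adj_mult ac ap matrix_mul_assoc)
    also have "adj k ** (p ** p) ** k = p ** p" unfolding p(2) by (rule M(2)[OF k])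
    also have "?c ** (p ** p) ** ?c = (?c ** p) ** (p ** ?c)" by (simp only: matrix_mul_assoc)
    finally have u: "unitary u" by (simp add: unitary_def pc)
    have "u ** (p ** matrix_inv k ** ?c) = p ** (k ** matrix_inv k) ** ?c"
      by (simp only: matrix_mul_assoc up)
    then have "u ** (p ** matrix_inv k ** ?c) = mat 1" by (simp add: matrix_inv_mult[OF ki] pc)
    then have au: "adj u = p ** matrix_inv k ** ?c"
      using unitaryD(1)[OF u] by (metis matrix_mul_assoc matrix_mul_lid matrix_mul_rid)
    have aup: "adj u ** p = p ** matrix_inv k" by (simp add: au matrix_mul_assoc[symmetric] pc)
    have "\<exists>A. acts k (v d) A \<and> A \<in> Sp (length (v d))" for d
    proof -
      obtain A where A: "acts k (v d) A" using acts_exists[OF vb] commuting_E[OF kZ(2,3)] by metis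
      then have uA: "acts u (ws d) A" using acts_conj[OF A up] by (simp add: pv)
      have "adj u *v x \<in> range (hcomb (ws d))" if x: "x \<in> range (hcomb (ws d))" for x
      proof -
        obtain y where y: "x = p *v y" "y \<in> E (d - 1)" using x ws[of d] by blast
        have "matrix_inv k *v y \<in> E (d - 1)"
          by (rule commuting_E[OF commute_inv[OF ki kZ(2)] commute_inv[OF ki kZ(3)] y(2)])
        then have "p *v (matrix_inv k *v y) \<in> range (hcomb (ws d))" using ws[of d] by blast
        then show ?thesis by (simp add: y(1) matrix_vector_mul_assoc aup)
      qed
      then have "A \<in> Sp (length (ws d))" using acts_Sp[OF u _ uA] ws[of d] by blast
      then show ?thesis using A by (auto simp: v_def)
    qed
    then obtain A where A: "\<And>d. acts k (v d) (A d) \<and> A d \<in> Sp (length (v d))" by metis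
    have "Lambda (total_basis X H Y v) k = block_D ?ds A"
      unfolding total_basis_frame by (rule Lambda_frame[OF frame_basis[OF v]]) (use A kZ(1) in simp_all)
    also have "\<dots> \<in> block_Sp ?ds (part_mult X H Y)"
      using A ordered_bases_length[OF v] by (intro block_Sp_I) metis
    finally show ?thesis .
  qed
  with v show ?thesis by (rule that)
qed

text \<open>Everything is first proved for bases \<open>v'\<close> adapted to K, for which
  maximality identifies K with the group G of \<open>unitary_centralizer_basis\<close>. The given
  bases are then reached by an element of the centralizer that carries \<open>v'\<close> to
  \<open>v\<close>.\<close>

theorem theorem3p6:
  fixes X H Y :: "quat^('n::{finite,linorder})^('n::{finite,linorder})"
    and K :: "(quat^('n::{finite,linorder})^('n::{finite,linorder})) set"
    and v :: "nat \<Rightarrow> (quat^('n::{finite,linorder})) list"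
  assumes "X \<in> slH" and "nilpotent_matrix X" and "X \<noteq> 0"
    and "sl2_triple X H Y"
    and "maximal_compact_subgroup K (centralizer X H Y)"
    and "ordered_bases X H Y v"
  shows
    "(\<exists>z\<in>centralizer X H Y.
        Lambda (total_basis X H Y v) ` (Ad z ` K) = block_Sp (parts X H Y) (part_mult X H Y) \<and>
        top_of_set (orbit X) homotopy_equivalent_space
          coset_space Sp_typed (Lambda (total_basis X H Y v) ` (Ad z ` K))) \<and>
     (\<exists>v'. ordered_bases X H Y v' \<and>
        Lambda (total_basis X H Y v') ` K = block_Sp (parts X H Y) (part_mult X H Y) \<and>
        top_of_set (orbit X) homotopy_equivalent_space
          coset_space Sp_typed (Lambda (total_basis X H Y v') ` K))"
proof -
  obtain m where rep: "sl2_matrices X H Y m" using sl2_triple_matrices[OF assms(4)] .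
  interpret sl2_matrices X H Y m by (rule rep)
  let ?ds = "parts X H Y" and ?Z = "centralizer X H Y"
  have K: "compact_subgroup K ?Z" "\<And>K'. compact_subgroup K' ?Z \<Longrightarrow> K \<subseteq> K' \<Longrightarrow> K' = K"
    using assms(5) by (auto simp: maximal_compact_subgroup_def)
  then have KZ: "K \<subseteq> ?Z" using subgroup.subset[of K "matrix_group ?Z"] by (simp add: compact_subgroup_def matrix_group_def)
  obtain v' where v': "ordered_bases X H Y v'"
    "\<And>k. k \<in> K \<Longrightarrow> Lambda (total_basis X H Y v') k \<in> block_Sp ?ds (part_mult X H Y)"
    using invariant_bases_exist[OF rep K(1)] by blast
  let ?B = "frame X ?ds v" and ?B' = "frame X ?ds v'"
  define b' where "b' = basis_matrix ?B'"
  define G where "G = {g. unitary (matrix_inv b' ** g ** b') \<and> g ** X = X ** g}"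
  note G = unitary_centralizer_basis[OF rep v'(1), folded b'_def, folded G_def]
  have B': "hbasis UNIV ?B'" by (rule frame_basis[OF v'(1)])
  have inv: "invertible b'" unfolding b'_def by (rule hbasis_UNIV_invertible[OF B'])
  have Lam: "Lambda (total_basis X H Y v') g = matrix_inv b' ** g ** b'" for g
    unfolding total_basis_frame b'_def by (rule Lambda_eq(1)[OF hbasis_UNIV_invertible[OF B']])
  have "K \<subseteq> G"
  proof
    fix k assume k: "k \<in> K"
    have "Lambda (total_basis X H Y v') k \<in> Lambda (total_basis X H Y v') ` G" unfolding G(2) by (rule v'(2)[OF k])
    then obtain g where "g \<in> G" "matrix_inv b' ** k ** b' = matrix_inv b' ** g ** b'" unfolding Lam by blast
    then have "unitary (matrix_inv b' ** k ** b')" by (simp add: G_def)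
    then show "k \<in> G" using KZ k by (auto simp: G_def centralizer_iff)
  qed
  then have "G = K" by (rule K(2)[OF G(1)])
  then have LK: "Lambda (total_basis X H Y v') ` K = block_Sp ?ds (part_mult X H Y)" using G(2) by simp
  have vE: "hbasis (E (d - 1)) (v d)" "hbasis (E (d - 1)) (v' d)" if "d \<in> set ?ds" for d
    using assms(6) v'(1) that by (simp_all add: ordered_bases_iff)
  have top: "mpow X d *v x = 0" if "hbasis (E (d - 1)) vs" "d \<in> set ?ds" "x \<in> set vs" for d x vs
    using that set_subset_range_hcomb[of vs] by (intro mpow_E_zero parts_pos) (auto simp: hbasis_def)
  have "length (v d) = length (v' d)" if "d \<in> set ?ds" for d
    using ordered_bases_length[OF assms(6) that] ordered_bases_length[OF v'(1) that] by simp
  \<comment> \<open>h maps the adapted bases to the given ones along the strings. It preserves every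
    E (d-1) and so commutes with the triple; scaled to reduced norm 1 it becomes z.\<close>
  then obtain h where h: "X ** h = h ** X" "\<And>d. d \<in> set ?ds \<Longrightarrow> map ((*v) h) (v' d) = v d"
    using frame_map_exists[OF B' zero_notin_parts, of v X] top vE by metis
  have BB': "?B = map ((*v) h) ?B'"
    unfolding frame_map_commute[OF h(1), symmetric] by (rule frame_cong) (simp add: h(2))
  have B: "hbasis UNIV ?B" by (rule frame_basis[OF assms(6)])
  have "UNIV = range (hcomb ?B)" using B by (simp add: hbasis_def)
  then have "range ((*v) h) = UNIV" unfolding BB' hcomb_map by blast
  then have hi: "invertible h" by (rule invertible_surj)
  have "h *v x \<in> E (d - 1)" if d: "d \<in> set ?ds" and x: "x \<in> E (d - 1)" for d x
  proof -
    obtain a where "x = hcomb (v' d) a" using vE(2)[OF d] x by (auto simp: hbasis_def)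
    then have "h *v x = hcomb (v d) a" unfolding h(2)[OF d, symmetric] hcomb_map by simp
    then show ?thesis using vE(1)[OF d] by (auto simp: hbasis_def)
  qed
  then have hHY: "h ** H = H ** h" "h ** Y = Y ** h" using commute_HY[OF h(1)[symmetric]] by blast+
  obtain r where r: "r > 0" "r *\<^sub>R h \<in> SLH" by (rule SLH_scaling[OF hi])
  define z where "z = r *\<^sub>R h"
  have z: "z \<in> ?Z"
    using r(2) h(1) hHY by (simp add: z_def centralizer_iff qmult_scaleR_left qmult_scaleR_right)
  have iz: "matrix_inv z = (1 / r) *\<^sub>R matrix_inv h"
    by (rule matrix_inv_unique) (use r(1) in \<open>simp add: z_def qmult_scaleR_left qmult_scaleR_right matrix_inv_mult hi\<close>)
  have "Lambda (total_basis X H Y v) (Ad z k) = Lambda (total_basis X H Y v') k" for k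
  proof -
    \<comment> \<open>The change of basis by h cancels the conjugation by z, whose real factor drops
      out of \<open>Ad\<close>.\<close>
    have bb: "basis_matrix ?B = h ** b'"
      unfolding BB' b'_def by (rule basis_matrix_map[OF hbasis_UNIV_length[OF B']])
    have Adz: "Ad z k = h ** k ** matrix_inv h"
      using r(1) by (simp add: Ad_def iz) (simp add: z_def qmult_scaleR_left qmult_scaleR_right)
    have "Lambda (total_basis X H Y v) (Ad z k) = matrix_inv (h ** b') ** Ad z k ** (h ** b')"
      unfolding total_basis_frame bb[symmetric] by (rule Lambda_eq(1)[OF hbasis_UNIV_invertible[OF B]])
    also have "\<dots> = matrix_inv b' ** (matrix_inv h ** h) ** k ** (matrix_inv h ** h) ** b'"
      by (simp add: Adz matrix_inv_mult_distrib hi inv matrix_mul_assoc)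
    also have "\<dots> = matrix_inv b' ** k ** b'" by (simp add: matrix_inv_mult hi)
    finally show ?thesis by (simp add: Lam)
  qed
  then have Lz: "Lambda (total_basis X H Y v) ` (Ad z ` K) = block_Sp ?ds (part_mult X H Y)"
    using LK by (simp add: image_image)
  show ?thesis
    by (intro conjI bexI[OF _ z] exI[of _ v'] v'(1) Lz LK) (simp_all only: Lz LK G(3))
qed

end
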